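(* Let $d\ge 1$, $\alpha\in(0,2)$, $\nu(\mathrm{d}z)=\mathbf{1}_{\{|z|\ge 1\}}|z|^{-(d+\alpha)}\,\mathrm{d}z$, and let $J_0$, $a_1$, $a_2$, $c$, $J$ and the regular Dirichlet form $(\mathcal{E}^{(2)},\mathcal{F}^{(2)})$ on $L^2(\mathbb{R}^d)$ (the big jump part) be as described in the context. If there exist $c_0>0$ and $q>(\alpha-d)/2$ such that $$a_2(x)\ge c_0(1+|x|^2)^q,\quad x\in\mathbb{R}^d,$$ then $(\mathcal{E}^{(2)},\mathcal{F}^{(2)})$ is transient.
   Context: Setting. $\nu(\mathrm{d}z)=\mathbf{1}_{\{|z|\ge 1\}}|z|^{-(d+\alpha)}\,\mathrm{d}z$ on $\mathbb{R}^d$. $J_0(x,\mathrm{d}y)$ is a nonnegative kernel on $\mathbb{R}^d\times\mathcal{B}(\mathbb{R}^d)$ such that the measure $J_0(x,\mathrm{d}y)\,\mathrm{d}x$ on $\mathbb{R}^d\times\mathbb{R}^d$ is symmetric and $J_0(x,x+A)\ge\nu(A)$ for all $x\in\mathbb{R}^d$, $A\in\mathcal{B}(\mathbb{R}^d)$. $a_1,a_2$ are positive Borel measurable functions on $\mathbb{R}^d$, $$c(x,y)=(a_1(x)+a_1(y))\mathbf{1}_{\{|x-y|<1\}}+(a_2(x)+a_2(y))\mathbf{1}_{\{|x-y|\ge 1\}},$$ $J(x,\mathrm{d}y)=c(x,y)J_0(x,\mathrm{d}y)$ and $J(\mathrm{d}x\,\mathrm{d}y)=J(x,\mathrm{d}y)\,\mathrm{d}x$.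 It is assumed that $J(\mathrm{d}x\,\mathrm{d}y)$ is symmetric and that $x\mapsto\int_{\mathbb{R}^d}(1\wedge|x-y|^2)J(x,\mathrm{d}y)$ belongs to $L^1_{\rm loc}(\mathbb{R}^d)$. Big jump form. Let $J^{(2)}(\mathrm{d}x\,\mathrm{d}y)=\mathbf{1}_{\{|x-y|\ge1\}}J(\mathrm{d}x\,\mathrm{d}y)$ and $$\mathcal{E}^{(2)}(u,v)=\iint_{\mathbb{R}^d\times\mathbb{R}^d}(u(x)-u(y))(v(x)-v(y))\,J^{(2)}(\mathrm{d}x\,\mathrm{d}y)$$ on $\mathcal{D}(\mathcal{E}^{(2)})=\{u\in L^2(\mathbb{R}^d):\mathcal{E}^{(2)}(u,u)<\infty\}$. Then $\mathcal{F}^{(2)}$ denotes the closure of $C_0^\infty(\mathbb{R}^d)$ (smooth functions with compact support) in $\mathcal{D}(\mathcal{E}^{(2)})$ with respect to the norm $(\mathcal{E}^{(2)}(u,u)+\|u\|_{L^2}^2)^{1/2}$; $(\mathcal{E}^{(2)},\mathcal{F}^{(2)})$ is a regular Dirichlet form on $L^2(\mathbb{R}^d)$. Transience. Let $\{T_t\}_{t>0}$ be the strongly continuous Markovian semigroup on $L^2$ associated with a Dirichlet form, $S_tf=\int_0^tT_sf\,\mathrm{d}s$ (extended from $L^1\cap L^2$ to $L^1$), and $Gf=\lim_{N\to\infty}S_Nf$ for $f\in L^1$, $f\ge 0$ a.e. The form is transient if $Gf<\infty$ a.e. for every $f\in L^1$ with $f\ge0$ a.e. *)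

theory Defs
  imports "HOL-Analysis.Analysis"
begin

section \<open>The Hilbert space of square-integrable functions\<close>

definition square_integrable :: "('a::euclidean_space \<Rightarrow> real) \<Rightarrow> bool" where
  "square_integrable f \<longleftrightarrow> f \<in> borel_measurable lborel \<and> integrable lborel (\<lambda>x. (f x)\<^sup>2)"

lemma square_integrable_zero: "square_integrable (\<lambda>x. 0)"
  by (simp add: square_integrable_def)

lemma square_integrable_mult:
  assumes "square_integrable f" "square_integrable g"
  shows "integrable lborel (\<lambda>x. f x * g x)"
proof (rule Bochner_Integration.integrable_bound)
  show "integrable lborel (\<lambda>x. (f x)\<^sup>2 + (g x)\<^sup>2)"
    using assms by (auto simp: square_integrable_def)
  show "(\<lambda>x. f x * g x) \<in> borel_measurable lborel"
    using assms by (auto simp: square_integrable_def)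
  have "norm (f x * g x) \<le> norm ((f x)\<^sup>2 + (g x)\<^sup>2)" for x
  proof -
    have "2 * \<bar>f x\<bar> * \<bar>g x\<bar> \<le> \<bar>f x\<bar>\<^sup>2 + \<bar>g x\<bar>\<^sup>2"
      by (rule sum_squares_bound)
    moreover have "0 \<le> \<bar>f x\<bar> * \<bar>g x\<bar>" by simp
    ultimately have "\<bar>f x\<bar> * \<bar>g x\<bar> \<le> (f x)\<^sup>2 + (g x)\<^sup>2"
      unfolding power2_abs mult.assoc by linarith
    then show ?thesis by (simp add: abs_mult)
  qed
  then show "AE x in lborel. norm (f x * g x) \<le> norm ((f x)\<^sup>2 + (g x)\<^sup>2)" by simp
qed

lemma square_integrable_add:
  assumes "square_integrable f" "square_integrable g"
  shows "square_integrable (\<lambda>x. f x + g x)"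
  using square_integrable_mult[OF assms] assms
  by (auto simp: square_integrable_def power2_sum mult.assoc)

lemma square_integrable_scale:
  "square_integrable f \<Longrightarrow> square_integrable (\<lambda>x. c * f x)"
  by (auto simp: square_integrable_def power_mult_distrib)

quotient_type (overloaded) 'a l2 = "'a::euclidean_space \<Rightarrow> real" / partial:
  "\<lambda>f g. square_integrable f \<and> square_integrable g \<and> (AE x in lborel. f x = g x)"
  morphisms fun_of l2_of
proof (rule part_equivpI)
  show "\<exists>f::'a \<Rightarrow> real. square_integrable f \<and> square_integrable f \<and> (AE x in lborel. f x = f x)"
    using square_integrable_zero by auto
  show "symp (\<lambda>f g :: 'a \<Rightarrow> real. square_integrable f \<and> square_integrable g \<and> (AE x in lborel. f x = g x))"
    by (rule sympI) (simp add: eq_commute)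
  show "transp (\<lambda>f g :: 'a \<Rightarrow> real. square_integrable f \<and> square_integrable g \<and> (AE x in lborel. f x = g x))"
    by (auto simp: transp_def elim: eventually_elim2)
qed

instantiation l2 :: (euclidean_space) real_inner
begin

lift_definition zero_l2 :: "'a l2" is "\<lambda>x. 0"
  by (simp add: square_integrable_zero)

lift_definition plus_l2 :: "'a l2 \<Rightarrow> 'a l2 \<Rightarrow> 'a l2" is "\<lambda>f g x. f x + g x"
  by (auto intro: square_integrable_add elim: eventually_elim2)

lift_definition scaleR_l2 :: "real \<Rightarrow> 'a l2 \<Rightarrow> 'a l2" is "\<lambda>c f x. c * f x"
  by (auto intro: square_integrable_scale elim: eventually_mono)

lift_definition uminus_l2 :: "'a l2 \<Rightarrow> 'a l2" is "\<lambda>f x. - f x"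
  by (auto simp: square_integrable_def)

definition minus_l2 :: "'a l2 \<Rightarrow> 'a l2 \<Rightarrow> 'a l2" where
  "minus_l2 u v = u + (- v)"

lift_definition inner_l2 :: "'a l2 \<Rightarrow> 'a l2 \<Rightarrow> real" is
  "\<lambda>f g. integral\<^sup>L lborel (\<lambda>x. f x * g x)"
  by (rule integral_cong_AE) (auto simp: square_integrable_def elim: eventually_elim2)

definition norm_l2 :: "'a l2 \<Rightarrow> real" where
  "norm_l2 u = sqrt (inner u u)"

definition sgn_l2 :: "'a l2 \<Rightarrow> 'a l2" where
  "sgn_l2 u = scaleR (inverse (norm u)) u"

definition dist_l2 :: "'a l2 \<Rightarrow> 'a l2 \<Rightarrow> real" where
  "dist_l2 u v = norm (u - v)"

definition uniformity_l2 :: "('a l2 \<times> 'a l2) filter" where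
  "uniformity_l2 = (INF e\<in>{0<..}. principal {(u, v). dist u v < e})"

definition open_l2 :: "'a l2 set \<Rightarrow> bool" where
  "open_l2 U \<longleftrightarrow> (\<forall>u\<in>U. eventually (\<lambda>(u', v). u' = u \<longrightarrow> v \<in> U) uniformity)"

instance
proof
  fix u v w :: "'a l2" and a b :: real and U :: "'a l2 set"
  show "u + v + w = u + (v + w)"
    by transfer (auto intro!: square_integrable_add simp: add.assoc)
  show "u + v = v + u"
    by transfer (auto intro!: square_integrable_add simp: add.commute)
  show "0 + u = u" by transfer auto
  show "- u + u = 0"
    by transfer (auto simp: square_integrable_zero)
  show "u - v = u + - v" by (rule minus_l2_def)
  show "a *\<^sub>R (u + v) = a *\<^sub>R u + a *\<^sub>R v"
    by transfer (auto intro!: square_integrable_add square_integrable_scale simp: distrib_left)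
  show "(a + b) *\<^sub>R u = a *\<^sub>R u + b *\<^sub>R u"
    by transfer (auto intro!: square_integrable_add square_integrable_scale simp: distrib_right)
  show "a *\<^sub>R b *\<^sub>R u = (a * b) *\<^sub>R u"
    by transfer (auto intro!: square_integrable_scale simp: mult.assoc)
  show "1 *\<^sub>R u = u" by transfer auto
  show "dist u v = norm (u - v)" by (rule dist_l2_def)
  show "sgn u = scaleR (inverse (norm u)) u" by (rule sgn_l2_def)
  show "(uniformity :: ('a l2 \<times> 'a l2) filter) = (INF e\<in>{0<..}. principal {(u, v). dist u v < e})"
    by (rule uniformity_l2_def)
  show "open U \<longleftrightarrow> (\<forall>u\<in>U. \<forall>\<^sub>F (u', v) in uniformity. u' = u \<longrightarrow> v \<in> U)"
    by (rule open_l2_def)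
  show "inner u v = inner v u"
    by transfer (simp add: mult.commute)
  show "inner (u + v) w = inner u w + inner v w"
    by transfer (simp add: distrib_right square_integrable_mult)
  show "inner (a *\<^sub>R u) v = a * inner u v"
    by transfer (simp add: mult.assoc)
  show "0 \<le> inner u u"
    by transfer simp
  show "inner u u = 0 \<longleftrightarrow> u = 0"
  proof transfer
    fix f :: "'a \<Rightarrow> real"
    assume f: "square_integrable f \<and> square_integrable f \<and> (AE x in lborel. f x = f x)"
    then have "(\<integral>x. f x * f x \<partial>lborel) = 0 \<longleftrightarrow> (AE x in lborel. f x * f x = 0)"
      by (intro integral_nonneg_eq_0_iff_AE) (auto intro: square_integrable_mult)
    with f show "(\<integral>x. f x * f x \<partial>lborel) = 0 \<longleftrightarrow>
        square_integrable f \<and> square_integrable (\<lambda>x::'a. 0) \<and> (AE x in lborel. f x = 0)"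
      by (simp add: square_integrable_zero)
  qed
  show "norm u = sqrt (inner u u)" by (rule norm_l2_def)
qed

end


section \<open>Semigroups, forms and transience\<close>

definition markovian_semigroup :: "(real \<Rightarrow> 'a::euclidean_space l2 \<Rightarrow> 'a l2) \<Rightarrow> bool" where
  "markovian_semigroup T \<longleftrightarrow>
     (\<forall>t>0. linear (T t)) \<and>
     (\<forall>t>0. \<forall>u v. inner (T t u) v = inner u (T t v)) \<and>
     (\<forall>t>0. \<forall>u. norm (T t u) \<le> norm u) \<and>
     (\<forall>s>0. \<forall>t>0. \<forall>u. T (s + t) u = T s (T t u)) \<and>
     (\<forall>u. ((\<lambda>t. T t u) \<longlongrightarrow> u) (at_right 0)) \<and>
     (\<forall>t>0. \<forall>u. (AE x in lborel. 0 \<le> fun_of u x \<and> fun_of u x \<le> 1) \<longrightarrow>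
        (AE x in lborel. 0 \<le> fun_of (T t u) x \<and> fun_of (T t u) x \<le> 1))"

text \<open>Generators are given by their graphs.\<close>

definition semigroup_generator :: "(real \<Rightarrow> 'a::euclidean_space l2 \<Rightarrow> 'a l2) \<Rightarrow> ('a l2 \<times> 'a l2) set" where
  "semigroup_generator T = {(u, f). ((\<lambda>t. (T t u - u) /\<^sub>R t) \<longlongrightarrow> f) (at_right 0)}"

definition form_generator ::
    "('a::euclidean_space l2 \<Rightarrow> 'a l2 \<Rightarrow> real) \<Rightarrow> 'a l2 set \<Rightarrow> ('a l2 \<times> 'a l2) set" where
  "form_generator E F = {(u, f). u \<in> F \<and> (\<forall>v\<in>F. E u v = inner (- f) v)}"

text \<open>
  A Dirichlet form \<open>(E, F)\<close> has exactly one associated strongly continuous Markovian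
  semigroup (up to the irrelevant values at \<open>t \<le> 0\<close>), the one whose generator is
  the generator of the form.
\<close>

definition associated_semigroup ::
    "('a::euclidean_space l2 \<Rightarrow> 'a l2 \<Rightarrow> real) \<Rightarrow> 'a l2 set \<Rightarrow> (real \<Rightarrow> 'a l2 \<Rightarrow> 'a l2) \<Rightarrow> bool" where
  "associated_semigroup E F T \<longleftrightarrow>
     markovian_semigroup T \<and> semigroup_generator T = form_generator E F"

definition potential_upto :: "(real \<Rightarrow> 'a::euclidean_space l2 \<Rightarrow> 'a l2) \<Rightarrow> real \<Rightarrow> 'a l2 \<Rightarrow> 'a l2" where
  "potential_upto T t u = integral {0..t} (\<lambda>s. T s u)"

text \<open>
  The extension of \<open>potential_upto T t\<close> from \<open>L1 \<inter> L2\<close> to \<open>L1\<close> by continuity;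
  its value at \<open>f\<close> is an integrable function, unique up to a null set.
\<close>

definition potential_upto_L1 ::
    "(real \<Rightarrow> 'a::euclidean_space l2 \<Rightarrow> 'a l2) \<Rightarrow> real \<Rightarrow> ('a \<Rightarrow> real) \<Rightarrow> 'a \<Rightarrow> real" where
  "potential_upto_L1 T t f = (SOME g. integrable lborel g \<and>
     (\<forall>h :: nat \<Rightarrow> 'a l2.
        (\<forall>n. integrable lborel (fun_of (h n))) \<and>
        (\<lambda>n. \<integral>x. \<bar>fun_of (h n) x - f x\<bar> \<partial>lborel) \<longlonglongrightarrow> 0 \<longrightarrow>
        (\<forall>n. integrable lborel (fun_of (potential_upto T t (h n)))) \<and>
        (\<lambda>n. \<integral>x. \<bar>fun_of (potential_upto T t (h n)) x - g x\<bar> \<partial>lborel) \<longlonglongrightarrow> 0))"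

definition green :: "(real \<Rightarrow> 'a::euclidean_space l2 \<Rightarrow> 'a l2) \<Rightarrow> ('a \<Rightarrow> real) \<Rightarrow> 'a \<Rightarrow> ereal" where
  "green T f x = lim (\<lambda>N::nat. ereal (potential_upto_L1 T (real N) f x))"

text \<open>
  The semigroup being unique, the quantifier over \<open>T\<close> only serves to name it.
\<close>

definition transient :: "('a::euclidean_space l2 \<Rightarrow> 'a l2 \<Rightarrow> real) \<Rightarrow> 'a l2 set \<Rightarrow> bool" where
  "transient E F \<longleftrightarrow>
     (\<forall>T. associated_semigroup E F T \<longrightarrow>
        (\<forall>f. integrable lborel f \<and> (AE x in lborel. 0 \<le> f x) \<longrightarrow>
           (AE x in lborel. green T f x < \<infinity>)))"


section \<open>Smooth functions with compact support\<close>

fun times_differentiable :: "nat \<Rightarrow> ('a::euclidean_space \<Rightarrow> real) \<Rightarrow> bool" where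
  "times_differentiable 0 f \<longleftrightarrow> continuous_on UNIV f"
| "times_differentiable (Suc n) f \<longleftrightarrow>
     (\<forall>x. f differentiable (at x)) \<and>
     (\<forall>v. times_differentiable n (\<lambda>x. frechet_derivative f (at x) v))"

definition test_functions :: "('a::euclidean_space \<Rightarrow> real) set" where
  "test_functions =
     {\<phi>. (\<forall>n. times_differentiable n \<phi>) \<and> compact (closure {x. \<phi> x \<noteq> 0})}"


section \<open>Jump kernels and the big jump form\<close>

definition nonneg_kernel :: "('a::euclidean_space \<Rightarrow> 'a measure) \<Rightarrow> bool" where
  "nonneg_kernel K \<longleftrightarrow>
     (\<forall>x. sets (K x) = sets borel) \<and>
     (\<forall>A\<in>sets borel. (\<lambda>x. emeasure (K x) A) \<in> borel_measurable borel)"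

text \<open>The mass that the measure \<open>K(x,dy)dx\<close> gives to \<open>A\<close>.\<close>

definition kernel_mass :: "('a::euclidean_space \<Rightarrow> 'a measure) \<Rightarrow> ('a \<times> 'a) set \<Rightarrow> ennreal" where
  "kernel_mass K A = (\<integral>\<^sup>+x. emeasure (K x) {y. (x, y) \<in> A} \<partial>lborel)"

definition symmetric_kernel :: "('a::euclidean_space \<Rightarrow> 'a measure) \<Rightarrow> bool" where
  "symmetric_kernel K \<longleftrightarrow>
     (\<forall>A\<in>sets borel. kernel_mass K A = kernel_mass K (prod.swap ` A))"

text \<open>
  Lebesgue rather than Borel measurability, since members of \<open>L1_loc\<close> matter only up to null sets.
\<close>

definition locally_integrable :: "('a::euclidean_space \<Rightarrow> ennreal) \<Rightarrow> bool" where
  "locally_integrable f \<longleftrightarrow> f \<in> borel_measurable lebesgue \<and>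
     (\<forall>C. compact C \<longrightarrow> (\<integral>\<^sup>+x\<in>C. f x \<partial>lebesgue) < \<infinity>)"

definition stable_tail :: "real \<Rightarrow> 'a::euclidean_space measure" where
  "stable_tail \<alpha> = density lborel
     (\<lambda>z. ennreal (indicator {z. norm z \<ge> 1} z * norm z powr - (real DIM('a) + \<alpha>)))"

definition jump_coeff :: "('a::euclidean_space \<Rightarrow> real) \<Rightarrow> ('a \<Rightarrow> real) \<Rightarrow> 'a \<Rightarrow> 'a \<Rightarrow> real" where
  "jump_coeff a1 a2 x y =
     (a1 x + a1 y) * indicator {z. norm z < 1} (x - y) +
     (a2 x + a2 y) * indicator {z. norm z \<ge> 1} (x - y)"

definition jump_kernel ::
    "('a::euclidean_space \<Rightarrow> real) \<Rightarrow> ('a \<Rightarrow> real) \<Rightarrow> ('a \<Rightarrow> 'a measure) \<Rightarrow> 'a \<Rightarrow> 'a measure" where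
  "jump_kernel a1 a2 J0 x = density (J0 x) (\<lambda>y. ennreal (jump_coeff a1 a2 x y))"

definition big_jumps :: "('a::euclidean_space \<Rightarrow> 'a measure) \<Rightarrow> 'a \<Rightarrow> 'a measure" where
  "big_jumps J x = density (J x) (indicator {y. norm (x - y) \<ge> 1})"

text \<open>
  Integrals against \<open>K(x,dy)dx\<close> are iterated integrals. The outer one is over \<open>lebesgue\<close>,
  because \<open>x \<mapsto> \<integral> h(x,y) K(x,dy)\<close> may fail to be Borel on a null set of \<open>x\<close>.
  If \<open>K(x,dy)dx\<close> is symmetric, neither definition depends on the chosen representatives
  of \<open>u\<close> and \<open>v\<close>.
\<close>

definition jump_form :: "('a::euclidean_space \<Rightarrow> 'a measure) \<Rightarrow> 'a l2 \<Rightarrow> 'a l2 \<Rightarrow> real" where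
  "jump_form K u v =
     (\<integral>x. (\<integral>y. (fun_of u x - fun_of u y) * (fun_of v x - fun_of v y) \<partial>K x) \<partial>lebesgue)"

definition jump_form_domain :: "('a::euclidean_space \<Rightarrow> 'a measure) \<Rightarrow> 'a l2 set" where
  "jump_form_domain K =
     {u. (\<integral>\<^sup>+x. (\<integral>\<^sup>+y. ennreal ((fun_of u x - fun_of u y)\<^sup>2) \<partial>K x) \<partial>lebesgue) < \<infinity>}"

text \<open>The closure of the test functions in the domain of the form.\<close>

definition jump_form_closure :: "('a::euclidean_space \<Rightarrow> 'a measure) \<Rightarrow> 'a l2 set" where
  "jump_form_closure K =
     {u \<in> jump_form_domain K. \<forall>\<epsilon>>0. \<exists>\<phi>\<in>test_functions. l2_of \<phi> \<in> jump_form_domain K \<and>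
        sqrt (jump_form K (u - l2_of \<phi>) (u - l2_of \<phi>) + (norm (u - l2_of \<phi>))\<^sup>2) < \<epsilon>}"

end

theory Submission
  imports Defs "HOL-Probability.Giry_Monad"
begin

text \<open>
  The form has to be related to the semigroup, and the jump rates to the form. The link is the
  following property: for every ball \<open>B\<close> around the origin there is a constant \<open>C\<close> such that
  \<open>\<integral>\<^sub>B \<bar>u\<bar> \<le> C sqrt (E u u)\<close> for all \<open>u\<close> in the domain of the form.

  This property holds because conductances grow towards infinity
  (\<open>big_jump_form_dominates_L1\<close>). Take a chain of balls of radii
  \<open>s = r 4\<^sup>k\<close> that starts with \<open>B\<close> and whose further members lie at
  distances of order \<open>s\<close> from their neighbours and from the origin. The hypotheses
  bound the jump density between consecutive balls from below by a multiple of
  \<open>s powr (2 q - d - \<alpha>)\<close>, and their volumes are of order \<open>s\<^sup>d\<close>. So the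
  energy of \<open>u\<close> bounds the square of the difference of the means of
  \<open>\<bar>u\<bar>\<close> over them, times \<open>s powr (2 q + d - \<alpha>)\<close>.
  The exponent is positive precisely when \<open>q > (\<alpha> - d) / 2\<close>. Then the
  differences are summable, and since the means tend to 0 for \<open>u\<close> in L2, the mean
  over \<open>B\<close> is at most a constant times \<open>sqrt (E u u)\<close>. The form
  being given by iterated Bochner integrals, this uses that the inner integral is a Lebesgue
  measurable function (\<open>borel_measurable_big_jumps_integral\<close>).

  The property implies transience (\<open>transient_if_locally_dominated\<close>). The potential
  \<open>u = \<integral>\<^sub>0\<^sup>N T\<^sub>s 1\<^sub>B ds\<close> solves \<open>- A u = 1\<^sub>B - T\<^sub>N 1\<^sub>B\<close>, so \<open>E u u \<le> \<integral>\<^sub>B u \<le> C sqrt (E u u)\<close>, and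
  \<open>\<integral>\<^sub>B u \<le> C\<^sup>2\<close> for all \<open>N\<close>. Thus the potential of \<open>1\<^sub>B\<close> is finite almost everywhere on \<open>B\<close>. To pass
  from \<open>1\<^sub>B\<close> to an arbitrary integrable \<open>f \<ge> 0\<close>, Hopf's maximal ergodic inequality is applied to
  \<open>f - a 1\<^sub>B\<close> for large \<open>a\<close> (\<open>maximal_inequality\<close>, \<open>green_finite_on\<close>): the points of \<open>B\<close> at which
  the potential of \<open>f\<close> is infinite while that of \<open>1\<^sub>B\<close> is finite form a null set.
\<close>


section \<open>Completeness of Lebesgue spaces\<close>

text \<open>
  Riesz and Fischer. Along a fast subsequence the weights \<open>2 ^ k\<close> still leave
  \<open>\<Sum>k. 2 ^ k * \<bar>f (k + 1) - f k\<bar> ^ p\<close> integrable, so the increments decay geometrically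
  almost everywhere, whatever the exponent is. Fatou's lemma then bounds the distance to the
  pointwise limit. The exponent 2 serves to integrate functions with values in L2, and the
  exponent 1 to extend operators from L1 \<open>\<inter>\<close> L2 to L1.
\<close>

lemma Lp_complete:
  fixes f :: "nat \<Rightarrow> 'a \<Rightarrow> real" and p :: nat
  assumes p: "0 < p" and [measurable]: "\<And>n. f n \<in> borel_measurable M"
    and Cauchy: "\<And>e. 0 < e \<Longrightarrow> \<exists>N. \<forall>m\<ge>N. \<forall>n\<ge>N. (\<integral>\<^sup>+x. ennreal (\<bar>f m x - f n x\<bar> ^ p) \<partial>M) \<le> ennreal e"
  obtains g where "g \<in> borel_measurable M"
    and "(\<lambda>n. \<integral>\<^sup>+x. ennreal (\<bar>f n x - g x\<bar> ^ p) \<partial>M) \<longlonglongrightarrow> 0"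
proof -
  have "\<exists>N. \<forall>m\<ge>N. \<forall>n\<ge>N. (\<integral>\<^sup>+x. ennreal (\<bar>f m x - f n x\<bar> ^ p) \<partial>M) \<le> ennreal ((1/4) ^ k)" for k
    by (rule Cauchy) simp
  then have "\<exists>N. \<forall>k. \<forall>m\<ge>N k. \<forall>n\<ge>N k. (\<integral>\<^sup>+x. ennreal (\<bar>f m x - f n x\<bar> ^ p) \<partial>M) \<le> ennreal ((1/4) ^ k)"
    by (intro choice allI)
  then obtain N where N: "\<And>k m n. N k \<le> m \<Longrightarrow> N k \<le> n \<Longrightarrow>
      (\<integral>\<^sup>+x. ennreal (\<bar>f m x - f n x\<bar> ^ p) \<partial>M) \<le> ennreal ((1/4) ^ k)"
    by blast
  \<comment> \<open>Summing makes the indices monotone: \<open>r k\<close> lies beyond \<open>N j\<close> for every \<open>j \<le> k\<close>.\<close>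
  define r where "r k = (\<Sum>i\<le>k. N i)" for k
  have r: "N j \<le> r k" if "j \<le> k" for j k
    unfolding r_def using that by (intro member_le_sum) auto
  define D where "D k x = \<bar>f (r (Suc k)) x - f (r k) x\<bar>" for k x
  have [measurable]: "D k \<in> borel_measurable M" for k
    unfolding D_def by measurable
  have "(\<integral>\<^sup>+x. (\<Sum>k. ennreal (2 ^ k * D k x ^ p)) \<partial>M) = (\<Sum>k. \<integral>\<^sup>+x. ennreal (2 ^ k * D k x ^ p) \<partial>M)"
    by (rule nn_integral_suminf) simp
  also have "\<dots> \<le> (\<Sum>k. ennreal ((1/2) ^ k))"
  proof (rule suminf_le)
    fix k
    have "(\<integral>\<^sup>+x. ennreal (2 ^ k * D k x ^ p) \<partial>M) = ennreal (2 ^ k) * (\<integral>\<^sup>+x. ennreal (D k x ^ p) \<partial>M)"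
      by (subst nn_integral_cmult[symmetric]) (auto simp: ennreal_mult D_def)
    also have "\<dots> \<le> ennreal (2 ^ k) * ennreal ((1/4) ^ k)"
      unfolding D_def by (intro mult_left_mono N r) auto
    also have "\<dots> = ennreal ((1/2) ^ k)"
      by (subst ennreal_mult[symmetric]) (auto simp: power_mult_distrib[symmetric])
    finally show "(\<integral>\<^sup>+x. ennreal (2 ^ k * D k x ^ p) \<partial>M) \<le> ennreal ((1/2) ^ k)" .
  qed auto
  also have "\<dots> = ennreal (\<Sum>k. (1/2) ^ k)"
    by (rule suminf_ennreal2) (auto intro: summable_geometric)
  also have "\<dots> < \<infinity>" by simp
  finally have "(\<integral>\<^sup>+x. (\<Sum>k. ennreal (2 ^ k * D k x ^ p)) \<partial>M) \<noteq> \<infinity>" by simp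
  then have "AE x in M. (\<Sum>k. ennreal (2 ^ k * D k x ^ p)) \<noteq> \<infinity>"
    by (intro nn_integral_PInf_AE) auto
  then have conv: "AE x in M. convergent (\<lambda>k. f (r k) x)"
  proof (rule eventually_mono)
    fix x assume fin: "(\<Sum>k. ennreal (2 ^ k * D k x ^ p)) \<noteq> \<infinity>"
    obtain S where S: "0 \<le> S" "(\<Sum>k. ennreal (2 ^ k * D k x ^ p)) = ennreal S"
      using fin by (cases "(\<Sum>k. ennreal (2 ^ k * D k x ^ p))") auto
    have D0: "0 \<le> D k x" for k by (simp add: D_def)
    have bound: "D k x \<le> root p S * root p (1/2) ^ k" for k
    proof -
      have "ennreal (2 ^ k * D k x ^ p) \<le> (\<Sum>k. ennreal (2 ^ k * D k x ^ p))"
        using sum_le_suminf[of "\<lambda>k. ennreal (2 ^ k * D k x ^ p)" "{k}"] by simp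
      then have "2 ^ k * D k x ^ p \<le> S"
        using S by simp
      then have "D k x ^ p \<le> S * (1/2) ^ k"
        by (simp add: field_simps)
      also have "\<dots> = (root p S * root p (1/2) ^ k) ^ p"
        using p S by (simp add: power_mult_distrib power_mult[symmetric] mult.commute[of k p] del: power_one_over)
                     (simp add: power_mult)
      finally show ?thesis
        using p S D0 by (subst (asm) power_mono_iff) (simp_all del: power_one_over)
    qed
    have "summable (\<lambda>k. root p S * root p (1/2) ^ k)"
      using p by (intro summable_mult summable_geometric) auto
    then have "summable (\<lambda>k. f (r (Suc k)) x - f (r k) x)"
      by (rule summable_comparison_test'[where N=0]) (use bound in \<open>auto simp: D_def\<close>)
    then have "(\<lambda>n. \<Sum>k<n. f (r (Suc k)) x - f (r k) x) \<longlonglongrightarrow> (\<Sum>k. f (r (Suc k)) x - f (r k) x)"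
      by (rule summable_LIMSEQ)
    then have "(\<lambda>n. f (r n) x - f (r 0) x) \<longlonglongrightarrow> (\<Sum>k. f (r (Suc k)) x - f (r k) x)"
      using sum_lessThan_telescope[of "\<lambda>k. f (r k) x"] by simp
    then have "(\<lambda>n. f (r n) x - f (r 0) x + f (r 0) x) \<longlonglongrightarrow> (\<Sum>k. f (r (Suc k)) x - f (r k) x) + f (r 0) x"
      by (intro tendsto_intros)
    then show "convergent (\<lambda>k. f (r k) x)"
      by (auto simp: convergent_def)
  qed
  define g where "g x = lim (\<lambda>k. f (r k) x)" for x
  have g[measurable]: "g \<in> borel_measurable M"
    unfolding g_def by measurable
  have tail: "(\<integral>\<^sup>+x. ennreal (\<bar>f m x - g x\<bar> ^ p) \<partial>M) \<le> ennreal ((1/4) ^ j)" if m: "N j \<le> m" for m j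
  proof -
    have "(\<integral>\<^sup>+x. ennreal (\<bar>f m x - g x\<bar> ^ p) \<partial>M)
        = (\<integral>\<^sup>+x. liminf (\<lambda>k. ennreal (\<bar>f m x - f (r k) x\<bar> ^ p)) \<partial>M)"
    proof (rule nn_integral_cong_AE, use conv in eventually_elim)
      fix x assume "convergent (\<lambda>k. f (r k) x)"
      then have "(\<lambda>k. f (r k) x) \<longlonglongrightarrow> g x"
        unfolding g_def by (rule convergent_LIMSEQ_iff[THEN iffD1])
      then have "(\<lambda>k. ennreal (\<bar>f m x - f (r k) x\<bar> ^ p)) \<longlonglongrightarrow> ennreal (\<bar>f m x - g x\<bar> ^ p)"
        by (intro tendsto_intros)
      then show "ennreal (\<bar>f m x - g x\<bar> ^ p) = liminf (\<lambda>k. ennreal (\<bar>f m x - f (r k) x\<bar> ^ p))"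
        by (intro lim_imp_Liminf[symmetric]) auto
    qed
    also have "\<dots> \<le> liminf (\<lambda>k. \<integral>\<^sup>+x. ennreal (\<bar>f m x - f (r k) x\<bar> ^ p) \<partial>M)"
      by (rule nn_integral_liminf) measurable
    also have "\<dots> \<le> liminf (\<lambda>k::nat. ennreal ((1/4) ^ j))"
      by (rule Liminf_mono, rule eventually_sequentiallyI[of j]) (auto intro!: N m r)
    also have "\<dots> = ennreal ((1/4) ^ j)"
      by (simp add: Liminf_const)
    finally show ?thesis .
  qed
  have "(\<lambda>n. \<integral>\<^sup>+x. ennreal (\<bar>f n x - g x\<bar> ^ p) \<partial>M) \<longlonglongrightarrow> 0"
  proof (rule order_tendstoI)
    fix a :: ennreal assume "0 < a"
    have "(\<lambda>j. ennreal ((1/4) ^ j)) \<longlonglongrightarrow> ennreal 0"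
      by (intro tendsto_ennrealI LIMSEQ_power_zero) auto
    then have "\<forall>\<^sub>F j in sequentially. ennreal ((1/4) ^ j) < a"
      using \<open>0 < a\<close> by (intro order_tendstoD) auto
    then obtain j where "ennreal ((1/4) ^ j) < a"
      by (auto simp: eventually_sequentially)
    then show "\<forall>\<^sub>F n in sequentially. (\<integral>\<^sup>+x. ennreal (\<bar>f n x - g x\<bar> ^ p) \<partial>M) < a"
      using tail by (intro eventually_sequentiallyI[of "N j"]) (auto intro: le_less_trans)
  qed simp
  with g show ?thesis by (rule that)
qed


section \<open>Order and integration in L2\<close>

lemma square_integrable_fun_of: "square_integrable (fun_of u)"
  using Quotient3_rep_reflp[OF Quotient3_l2, of u] by simp

lemma borel_measurable_fun_of [measurable]: "fun_of u \<in> borel_measurable borel"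
  using square_integrable_fun_of[of u] by (simp add: square_integrable_def)

lemma integrable_fun_of_square: "integrable lborel (\<lambda>x. (fun_of u x)\<^sup>2)"
  using square_integrable_fun_of[of u] by (simp add: square_integrable_def)

lemma l2_of_fun_of [simp]: "l2_of (fun_of u) = u"
  by (rule Quotient3_abs_rep[OF Quotient3_l2])

lemma fun_of_l2_of:
  assumes "square_integrable f"
  shows "AE x in lborel. fun_of (l2_of f) x = f x"
  using rep_abs_rsp_left[OF Quotient3_l2, of f f] assms by simp

lemma fun_of_add: "AE x in lborel. fun_of (u + v) x = fun_of u x + fun_of v x"
proof -
  have "u + v = l2_of (\<lambda>x. fun_of u x + fun_of v x)"
    using plus_l2.abs_eq[of "fun_of u" "fun_of v"] square_integrable_fun_of[of u] square_integrable_fun_of[of v] by simp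
  then show ?thesis
    using fun_of_l2_of[OF square_integrable_add[OF square_integrable_fun_of[of u] square_integrable_fun_of[of v]]] by simp
qed

lemma fun_of_scaleR: "AE x in lborel. fun_of (c *\<^sub>R u) x = c * fun_of u x"
proof -
  have "c *\<^sub>R u = l2_of (\<lambda>x. c * fun_of u x)"
    using scaleR_l2.abs_eq[of "fun_of u" c] square_integrable_fun_of[of u] by simp
  then show ?thesis
    using fun_of_l2_of[OF square_integrable_scale[OF square_integrable_fun_of[of u], of c]] by simp
qed

lemma fun_of_diff: "AE x in lborel. fun_of (u - v) x = fun_of u x - fun_of v x"
proof -
  have "u - v = u + (-1) *\<^sub>R v" by simp
  then show ?thesis
    using fun_of_add[of u "(-1) *\<^sub>R v"] fun_of_scaleR[of "-1" v] by auto
qed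

lemma inner_l2: "inner u v = (\<integral>x. fun_of u x * fun_of v x \<partial>lborel)"
  using inner_l2.abs_eq[of "fun_of u" "fun_of v"] square_integrable_fun_of[of u] square_integrable_fun_of[of v] by simp

lemma norm_l2_square: "(norm u)\<^sup>2 = (\<integral>x. (fun_of u x)\<^sup>2 \<partial>lborel)"
  unfolding power2_norm_eq_inner inner_l2 by (simp add: power2_eq_square)

lemma norm_l2_square_nn: "ennreal ((norm u)\<^sup>2) = (\<integral>\<^sup>+x. ennreal ((fun_of u x)\<^sup>2) \<partial>lborel)"
  unfolding norm_l2_square by (rule nn_integral_eq_integral[symmetric]) (auto simp: integrable_fun_of_square)

text \<open>
  Completeness is what makes continuous functions from an interval to L2 integrable, and hence
  gives the potentials \<open>\<integral>\<^sub>0\<^sup>t T\<^sub>s u ds\<close> a meaning.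
\<close>

instance l2 :: (euclidean_space) banach
proof
  fix X :: "nat \<Rightarrow> 'a l2"
  assume X: "Cauchy X"
  have dist_sq: "(\<integral>\<^sup>+x. ennreal (\<bar>fun_of u x - fun_of v x\<bar> ^ 2) \<partial>lborel) = ennreal ((norm (u - v))\<^sup>2)" for u v :: "'a l2"
    unfolding norm_l2_square_nn
    by (rule nn_integral_cong_AE) (use fun_of_diff[of u v] in \<open>auto elim!: eventually_mono\<close>)
  have "\<exists>N. \<forall>m\<ge>N. \<forall>n\<ge>N. (\<integral>\<^sup>+x. ennreal (\<bar>fun_of (X m) x - fun_of (X n) x\<bar> ^ 2) \<partial>lborel) \<le> ennreal e"
    if "0 < e" for e :: real
  proof -
    have "0 < sqrt e" using that by simp
    then obtain N where N: "\<And>m n. N \<le> m \<Longrightarrow> N \<le> n \<Longrightarrow> norm (X m - X n) < sqrt e"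
      using X[unfolded Cauchy_iff] by meson
    have "(norm (X m - X n))\<^sup>2 \<le> e" if "N \<le> m" "N \<le> n" for m n
      using power_mono[OF less_imp_le[OF N[OF that]], of 2] \<open>0 < e\<close> by simp
    then show ?thesis
      unfolding dist_sq by (intro exI[of _ N]) (auto intro!: ennreal_leI)
  qed
  then obtain g where g[measurable]: "g \<in> borel_measurable lborel"
    and lim: "(\<lambda>n. \<integral>\<^sup>+x. ennreal (\<bar>fun_of (X n) x - g x\<bar> ^ 2) \<partial>lborel) \<longlonglongrightarrow> 0"
    by (rule Lp_complete[of 2 "\<lambda>n. fun_of (X n)" lborel, rotated 2]) simp_all
  have "\<forall>\<^sub>F n in sequentially. (\<integral>\<^sup>+x. ennreal (\<bar>fun_of (X n) x - g x\<bar> ^ 2) \<partial>lborel) < \<infinity>"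
    using lim by (rule order_tendstoD) simp
  then obtain n where n: "(\<integral>\<^sup>+x. ennreal (\<bar>fun_of (X n) x - g x\<bar> ^ 2) \<partial>lborel) < \<infinity>"
    by (auto simp: eventually_sequentially)
  have "square_integrable (\<lambda>x. fun_of (X n) x - g x)"
    unfolding square_integrable_def using n by (auto intro!: integrableI_bounded)
  then have "square_integrable (\<lambda>x. fun_of (X n) x + (-1) * (fun_of (X n) x - g x))"
    by (intro square_integrable_add square_integrable_scale square_integrable_fun_of)
  then have gs: "square_integrable g" by simp
  have "ennreal ((norm (X n - l2_of g))\<^sup>2) = (\<integral>\<^sup>+x. ennreal (\<bar>fun_of (X n) x - g x\<bar> ^ 2) \<partial>lborel)" for n
    unfolding dist_sq[symmetric]
    by (rule nn_integral_cong_AE) (use fun_of_l2_of[OF gs] in \<open>auto elim!: eventually_mono\<close>)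
  then have "(\<lambda>n. ennreal ((norm (X n - l2_of g))\<^sup>2)) \<longlonglongrightarrow> ennreal 0"
    using lim by simp
  then have "(\<lambda>n. (norm (X n - l2_of g))\<^sup>2) \<longlonglongrightarrow> 0"
    by (rule tendsto_ennrealD) auto
  then have "(\<lambda>n. sqrt ((norm (X n - l2_of g))\<^sup>2)) \<longlonglongrightarrow> sqrt 0"
    by (rule tendsto_real_sqrt)
  then have "(\<lambda>n. norm (X n - l2_of g)) \<longlonglongrightarrow> 0" by simp
  then show "convergent X"
    unfolding convergent_def by (intro exI[of _ "l2_of g"]) (simp add: LIM_zero_iff tendsto_norm_zero_iff)
qed

definition l2_nonneg :: "'a::euclidean_space l2 \<Rightarrow> bool" where
  "l2_nonneg u \<longleftrightarrow> (AE x in lborel. 0 \<le> fun_of u x)"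

lemma inner_nonneg: "l2_nonneg u \<Longrightarrow> l2_nonneg v \<Longrightarrow> 0 \<le> inner u v"
  unfolding inner_l2 l2_nonneg_def by (rule integral_nonneg_AE) auto

text \<open>
  The cone of nonnegative functions is self-dual, as one sees by testing with the negative part.
  Positivity thus becomes a family of closed linear conditions, which survive limits in L2 and
  integration of L2-valued functions.
\<close>

lemma l2_nonneg_iff_inner: "l2_nonneg u \<longleftrightarrow> (\<forall>v. l2_nonneg v \<longrightarrow> 0 \<le> inner u v)"
proof
  assume *: "\<forall>v. l2_nonneg v \<longrightarrow> 0 \<le> inner u v"
  define g where "g x = max 0 (- fun_of u x)" for x
  have [measurable]: "g \<in> borel_measurable borel" unfolding g_def by measurable
  have g: "square_integrable g"
    unfolding square_integrable_def
  proof
    show "integrable lborel (\<lambda>x. (g x)\<^sup>2)"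
      by (rule Bochner_Integration.integrable_bound[OF integrable_fun_of_square[of u]])
         (auto simp: g_def max_def)
  qed simp
  have gae: "AE x in lborel. fun_of (l2_of g) x = g x" by (rule fun_of_l2_of[OF g])
  then have "l2_nonneg (l2_of g)"
    unfolding l2_nonneg_def by (auto elim!: eventually_mono simp: g_def)
  with * have "0 \<le> inner u (l2_of g)" by blast
  also have "inner u (l2_of g) = (\<integral>x. - (g x)\<^sup>2 \<partial>lborel)"
    unfolding inner_l2 by (rule integral_cong_AE)
      (use gae in \<open>auto elim!: eventually_mono simp: g_def max_def power2_eq_square\<close>)
  finally have "(\<integral>x. (g x)\<^sup>2 \<partial>lborel) \<le> 0" by simp
  moreover have "0 \<le> (\<integral>x. (g x)\<^sup>2 \<partial>lborel)" by simp
  ultimately have "(\<integral>x. (g x)\<^sup>2 \<partial>lborel) = 0" by linarith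
  then have "AE x in lborel. (g x)\<^sup>2 = 0"
    using g by (subst (asm) integral_nonneg_eq_0_iff_AE) (auto simp: square_integrable_def)
  then show "l2_nonneg u"
    unfolding l2_nonneg_def by (auto elim!: eventually_mono simp: g_def max_def split: if_splits)
qed (blast intro: inner_nonneg)

lemma l2_nonneg_diff_iff: "l2_nonneg (v - u) \<longleftrightarrow> (AE x in lborel. fun_of u x \<le> fun_of v x)"
  unfolding l2_nonneg_def
proof
  assume "AE x in lborel. 0 \<le> fun_of (v - u) x"
  with fun_of_diff[of v u] show "AE x in lborel. fun_of u x \<le> fun_of v x"
    by eventually_elim simp
next
  assume "AE x in lborel. fun_of u x \<le> fun_of v x"
  with fun_of_diff[of v u] show "AE x in lborel. 0 \<le> fun_of (v - u) x"
    by eventually_elim simp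
qed

definition l2_abs :: "'a::euclidean_space l2 \<Rightarrow> 'a l2" where
  "l2_abs u = l2_of (\<lambda>x. \<bar>fun_of u x\<bar>)"

lemma fun_of_l2_abs: "AE x in lborel. fun_of (l2_abs u) x = \<bar>fun_of u x\<bar>"
  unfolding l2_abs_def
  by (rule fun_of_l2_of) (use square_integrable_fun_of[of u] in \<open>auto simp: square_integrable_def\<close>)

definition l2_indicator :: "'a::euclidean_space set \<Rightarrow> 'a l2" where
  "l2_indicator A = l2_of (indicator A)"

lemma fun_of_l2_indicator:
  assumes "A \<in> sets borel" "emeasure lborel A < \<infinity>"
  shows "AE x in lborel. fun_of (l2_indicator A) x = indicator A x"
  unfolding l2_indicator_def
proof (rule fun_of_l2_of)
  have "(\<lambda>x. (indicator A x)\<^sup>2) = (indicator A :: 'a \<Rightarrow> real)"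
    by (auto simp: fun_eq_iff indicator_def)
  then show "square_integrable (indicator A :: 'a \<Rightarrow> real)"
    unfolding square_integrable_def using assms by (auto simp: integrable_indicator_iff)
qed

lemma inner_l2_indicator:
  assumes "A \<in> sets borel" "emeasure lborel A < \<infinity>"
  shows "inner u (l2_indicator A) = (\<integral>x. fun_of u x * indicator A x \<partial>lborel)"
  unfolding inner_l2 using assms(1)
  by (intro integral_cong_AE) (use fun_of_l2_indicator[OF assms] in \<open>auto elim!: eventually_mono\<close>)

lemma integrable_fun_of_indicator:
  assumes "A \<in> sets borel" "emeasure lborel A < \<infinity>"
  shows "integrable lborel (\<lambda>x. fun_of u x * indicator A x)"
proof -
  have "(\<lambda>x. (indicator A x)\<^sup>2) = (indicator A :: 'a \<Rightarrow> real)"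
    by (auto simp: fun_eq_iff indicator_def)
  then have "square_integrable (indicator A :: 'a \<Rightarrow> real)"
    unfolding square_integrable_def using assms by (auto simp: integrable_indicator_iff)
  then show ?thesis by (intro square_integrable_mult square_integrable_fun_of)
qed

lemma l2_indicator_nonneg:
  assumes "A \<in> sets borel" "emeasure lborel A < \<infinity>"
  shows "l2_nonneg (l2_indicator A)"
  unfolding l2_nonneg_def using fun_of_l2_indicator[OF assms] by (auto elim!: eventually_mono)

text \<open>
  The integral is the pairing with the constant 1, which is not in L2; indicators of balls
  exhaust it.
\<close>

lemma integrable_if_inner_indicator_bounded:
  fixes u :: "'a::euclidean_space l2"
  assumes u: "l2_nonneg u" and le: "\<And>n::nat. inner u (l2_indicator (ball 0 (real n))) \<le> c"
  shows "integrable lborel (fun_of u)" and "(\<integral>x. fun_of u x \<partial>lborel) \<le> c"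
proof -
  have fin: "emeasure lborel (ball (0::'a) r) < \<infinity>" for r
    by (rule emeasure_lborel_ball_finite)
  have c: "0 \<le> c"
    using inner_nonneg[OF u l2_indicator_nonneg[OF _ fin[of 0]]] le[of 0] by simp
  have ex: "\<exists>n. norm x < real n" for x :: 'a by (rule reals_Archimedean2)
  have "(\<integral>\<^sup>+x. ennreal (fun_of u x) \<partial>lborel)
      = (\<integral>\<^sup>+x. (SUP n. ennreal (fun_of u x) * indicator (ball 0 (real n)) x) \<partial>lborel)"
  proof (rule nn_integral_cong)
    fix x :: 'a
    obtain n where n: "norm x < real n" using ex by blast
    show "ennreal (fun_of u x) = (SUP n. ennreal (fun_of u x) * indicator (ball 0 (real n)) x)"
      by (intro antisym SUP_upper2[of n] SUP_least) (use n in \<open>auto simp: indicator_def\<close>)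
  qed
  also have "\<dots> = (SUP n. \<integral>\<^sup>+x. ennreal (fun_of u x) * indicator (ball 0 (real n)) x \<partial>lborel)"
    by (rule nn_integral_monotone_convergence_SUP)
       (auto simp: incseq_def le_fun_def indicator_def)
  also have "\<dots> \<le> ennreal c"
  proof (rule SUP_least)
    fix n :: nat
    have "(\<integral>\<^sup>+x. ennreal (fun_of u x) * indicator (ball 0 (real n)) x \<partial>lborel)
        = (\<integral>\<^sup>+x. ennreal (fun_of u x * indicator (ball 0 (real n)) x) \<partial>lborel)"
      by (intro nn_integral_cong) (auto simp: indicator_def)
    also have "\<dots> = ennreal (\<integral>x. fun_of u x * indicator (ball 0 (real n)) x \<partial>lborel)"
      using u unfolding l2_nonneg_def
      by (intro nn_integral_eq_integral integrable_fun_of_indicator fin)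
         (auto elim!: eventually_mono simp: indicator_def)
    also have "\<dots> \<le> ennreal c"
      using le[of n] inner_l2_indicator[OF _ fin[of "real n"], of u] by (auto intro: ennreal_leI)
    finally show "(\<integral>\<^sup>+x. ennreal (fun_of u x) * indicator (ball 0 (real n)) x \<partial>lborel) \<le> ennreal c" .
  qed
  finally have le: "(\<integral>\<^sup>+x. ennreal (fun_of u x) \<partial>lborel) \<le> ennreal c" .
  then have "(\<integral>\<^sup>+x. ennreal (fun_of u x) \<partial>lborel) < \<infinity>"
    using le_less_trans ennreal_less_top by fastforce
  then show int: "integrable lborel (fun_of u)"
    using u unfolding l2_nonneg_def by (intro integrableI_nonneg) auto
  have "(\<integral>\<^sup>+x. ennreal (fun_of u x) \<partial>lborel) = ennreal (\<integral>x. fun_of u x \<partial>lborel)"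
    using u int unfolding l2_nonneg_def by (intro nn_integral_eq_integral) auto
  with le c show "(\<integral>x. fun_of u x \<partial>lborel) \<le> c"
    by simp
qed

text \<open>
  A symmetric positive operator that is bounded by \<open>c\<close> on indicators has norm at most \<open>c\<close> on L1:
  pair \<open>V \<bar>u\<bar>\<close> with the indicator of a ball and move \<open>V\<close> to the other side. This is used both for
  the semigroup, with \<open>c = 1\<close>, and for its potential up to time \<open>t\<close>, with \<open>c = t\<close>.
\<close>

lemma L1_bound:
  fixes V :: "'a::euclidean_space l2 \<Rightarrow> 'a l2"
  assumes lin: "linear V" and sym: "\<And>u v. inner (V u) v = inner u (V v)"
    and pos: "\<And>u. l2_nonneg u \<Longrightarrow> l2_nonneg (V u)"
    and le: "\<And>n::nat. AE x in lborel. fun_of (V (l2_indicator (ball 0 (real n)))) x \<le> c"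
    and u: "integrable lborel (fun_of u)"
  shows "integrable lborel (fun_of (V u))"
    and "(\<integral>x. \<bar>fun_of (V u) x\<bar> \<partial>lborel) \<le> c * (\<integral>x. \<bar>fun_of u x\<bar> \<partial>lborel)"
proof -
  have a: "l2_nonneg (l2_abs u)"
    unfolding l2_nonneg_def using fun_of_l2_abs[of u] by (auto elim!: eventually_mono)
  have "inner (V (l2_abs u)) (l2_indicator (ball 0 (real n))) \<le> c * (\<integral>x. \<bar>fun_of u x\<bar> \<partial>lborel)" for n
  proof -
    have "inner (V (l2_abs u)) (l2_indicator (ball 0 (real n))) 
        = (\<integral>x. fun_of (l2_abs u) x * fun_of (V (l2_indicator (ball 0 (real n)))) x \<partial>lborel)"
      by (subst sym) (rule inner_l2)
    also have "\<dots> \<le> (\<integral>x. c * \<bar>fun_of u x\<bar> \<partial>lborel)"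
    proof (rule integral_mono_AE)
      show "integrable lborel (\<lambda>x. fun_of (l2_abs u) x * fun_of (V (l2_indicator (ball 0 (real n)))) x)"
        by (intro square_integrable_mult square_integrable_fun_of)
      show "integrable lborel (\<lambda>x. c * \<bar>fun_of u x\<bar>)" using u by auto
      show "AE x in lborel. fun_of (l2_abs u) x * fun_of (V (l2_indicator (ball 0 (real n)))) x \<le> c * \<bar>fun_of u x\<bar>"
        using fun_of_l2_abs[of u] le[of n]
        by eventually_elim (auto intro: mult_left_mono simp: mult.commute[of c])
    qed
    finally show ?thesis by simp
  qed
  note Va = integrable_if_inner_indicator_bounded[OF pos[OF a] this]
  have "l2_nonneg (l2_abs u - u)"
    unfolding l2_nonneg_def using fun_of_l2_abs[of u] fun_of_diff[of "l2_abs u" u]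
    by eventually_elim simp
  moreover have "l2_nonneg (l2_abs u + u)"
    unfolding l2_nonneg_def using fun_of_l2_abs[of u] fun_of_add[of "l2_abs u" u]
    by eventually_elim simp
  ultimately have "l2_nonneg (V (l2_abs u) - V u)" "l2_nonneg (V (l2_abs u) + V u)"
    using pos[of "l2_abs u - u"] pos[of "l2_abs u + u"] by (simp_all add: linear_diff[OF lin] linear_add[OF lin])
  then have dom: "AE x in lborel. \<bar>fun_of (V u) x\<bar> \<le> fun_of (V (l2_abs u)) x"
    unfolding l2_nonneg_def using fun_of_diff[of "V (l2_abs u)" "V u"] fun_of_add[of "V (l2_abs u)" "V u"]
    by eventually_elim auto
  show int: "integrable lborel (fun_of (V u))"
    by (rule Bochner_Integration.integrable_bound[OF Va(1)]) (use dom in \<open>auto elim!: eventually_mono\<close>)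
  have "(\<integral>x. \<bar>fun_of (V u) x\<bar> \<partial>lborel) \<le> (\<integral>x. fun_of (V (l2_abs u)) x \<partial>lborel)"
    using int Va(1) dom by (intro integral_mono_AE) auto
  with Va(2) show "(\<integral>x. \<bar>fun_of (V u) x\<bar> \<partial>lborel) \<le> c * (\<integral>x. \<bar>fun_of u x\<bar> \<partial>lborel)"
    by linarith
qed


section \<open>Potentials of Markovian semigroups\<close>

text \<open>
  Constants are not in L2, so an upper bound by a constant is tested on sets of finite measure;
  in this form it passes through integrals of L2-valued functions.
\<close>

lemma l2_le_const_if_inner:
  fixes w :: "'a::euclidean_space l2"
  assumes le: "\<And>A. A \<in> sets borel \<Longrightarrow> emeasure lborel A < \<infinity> \<Longrightarrow>
    inner w (l2_indicator A) \<le> c * measure lborel A"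
  shows "AE x in lborel. fun_of w x \<le> c"
proof -
  have "AE x in lborel. \<not> (norm x < real n \<and> c < fun_of w x)" for n :: nat
  proof -
    define A where "A = {x \<in> ball 0 (real n). c < fun_of w x}"
    have A [measurable]: "A \<in> sets borel" unfolding A_def by measurable
    have "emeasure lborel A \<le> emeasure lborel (ball (0::'a) (real n))"
      by (rule emeasure_mono) (auto simp: A_def)
    also have "\<dots> < \<infinity>" by (rule emeasure_lborel_ball_finite)
    finally have fin: "emeasure lborel A < \<infinity>" .
    have int: "integrable lborel (\<lambda>x. fun_of w x * indicator A x)"
      by (rule integrable_fun_of_indicator[OF A fin])
    have int1: "integrable lborel (indicator A :: 'a \<Rightarrow> real)"
      using fin A by (auto simp: integrable_indicator_iff)
    have "(\<integral>x. fun_of w x * indicator A x - c * indicator A x \<partial>lborel)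
        = inner w (l2_indicator A) - c * measure lborel A"
      using int int1 by (simp add: inner_l2_indicator[OF A fin])
    also have "\<dots> \<le> 0" using le[OF A fin] by simp
    finally have "(\<integral>x. fun_of w x * indicator A x - c * indicator A x \<partial>lborel) \<le> 0" .
    moreover have nonneg: "0 \<le> fun_of w x * indicator A x - c * indicator A x" for x
      by (auto simp: A_def indicator_def)
    then have "0 \<le> (\<integral>x. fun_of w x * indicator A x - c * indicator A x \<partial>lborel)"
      by (auto intro!: Bochner_Integration.integral_nonneg)
    ultimately have "(\<integral>x. fun_of w x * indicator A x - c * indicator A x \<partial>lborel) = 0"
      by linarith
    then have "AE x in lborel. fun_of w x * indicator A x - c * indicator A x = 0"
      using int int1 nonneg by (subst (asm) integral_nonneg_eq_0_iff_AE) auto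
    then show ?thesis
      by eventually_elim (auto simp: A_def indicator_def)
  qed
  then have "AE x in lborel. \<forall>n::nat. \<not> (norm x < real n \<and> c < fun_of w x)"
    by (subst AE_all_countable) blast
  then show ?thesis
  proof eventually_elim
    fix x assume *: "\<forall>n::nat. \<not> (norm x < real n \<and> c < fun_of w x)"
    obtain n :: nat where "norm x < real n" using reals_Archimedean2 by blast
    with * show "fun_of w x \<le> c" using not_less by blast
  qed
qed

text \<open>
  Markovian semigroups are only required to preserve bounds of bounded functions; truncations
  reach all nonnegative functions in L2.
\<close>

lemma l2_truncation_tendsto:
  fixes u :: "'a::euclidean_space l2"
  shows "square_integrable (\<lambda>x. min (real n) (fun_of u x))"
    and "(\<lambda>n. l2_of (\<lambda>x. min (real n) (fun_of u x))) \<longlonglongrightarrow> u"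
proof -
  show sq: "square_integrable (\<lambda>x. min (real n) (fun_of u x))" for n
    unfolding square_integrable_def
  proof
    show "integrable lborel (\<lambda>x. (min (real n) (fun_of u x))\<^sup>2)"
      by (rule Bochner_Integration.integrable_bound[OF integrable_fun_of_square[of u]])
         (auto simp: min_def abs_le_square_iff[symmetric])
  qed measurable
  define U where "U n = l2_of (\<lambda>x. min (real n) (fun_of u x))" for n
  have U: "AE x in lborel. fun_of (U n) x = min (real n) (fun_of u x)" for n
    unfolding U_def by (rule fun_of_l2_of[OF sq])
  have "(norm (U n - u))\<^sup>2 = (\<integral>x. (min (real n) (fun_of u x) - fun_of u x)\<^sup>2 \<partial>lborel)" for n
    unfolding norm_l2_square
  proof (rule integral_cong_AE)
    show "AE x in lborel. (fun_of (U n - u) x)\<^sup>2 = (min (real n) (fun_of u x) - fun_of u x)\<^sup>2"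
      using U[of n] fun_of_diff[of "U n" u] by eventually_elim simp
  qed measurable
  moreover have "(\<lambda>n. \<integral>x. (min (real n) (fun_of u x) - fun_of u x)\<^sup>2 \<partial>lborel) \<longlonglongrightarrow> (\<integral>x. 0 \<partial>(lborel :: 'a measure))"
  proof (rule integral_dominated_convergence[where w = "\<lambda>x. (fun_of u x)\<^sup>2"])
    show "AE x in lborel. (\<lambda>n. (min (real n) (fun_of u x) - fun_of u x)\<^sup>2) \<longlonglongrightarrow> 0"
    proof (rule AE_I2)
      fix x
      obtain N :: nat where "fun_of u x < real N" using reals_Archimedean2 by blast
      then have "\<forall>\<^sub>F n in sequentially. (min (real n) (fun_of u x) - fun_of u x)\<^sup>2 = 0"
        by (intro eventually_sequentiallyI[of N]) (auto simp: min_def)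
      then show "(\<lambda>n. (min (real n) (fun_of u x) - fun_of u x)\<^sup>2) \<longlonglongrightarrow> 0"
        by (rule tendsto_eventually)
    qed
    show "AE x in lborel. norm ((min (real n) (fun_of u x) - fun_of u x)\<^sup>2) \<le> (fun_of u x)\<^sup>2" for n
      by (rule AE_I2) (auto simp: min_def abs_le_square_iff[symmetric])
  qed (auto simp: integrable_fun_of_square)
  ultimately have "(\<lambda>n. (norm (U n - u))\<^sup>2) \<longlonglongrightarrow> 0" by simp
  then have "(\<lambda>n. sqrt ((norm (U n - u))\<^sup>2)) \<longlonglongrightarrow> sqrt 0"
    by (rule tendsto_real_sqrt)
  then have "(\<lambda>n. norm (U n - u)) \<longlonglongrightarrow> 0" by simp
  then show "(\<lambda>n. l2_of (\<lambda>x. min (real n) (fun_of u x))) \<longlonglongrightarrow> u"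
    unfolding U_def[symmetric] by (simp add: LIM_zero_iff tendsto_norm_zero_iff)
qed

locale l2_markov_semigroup =
  fixes T :: "real \<Rightarrow> 'a::euclidean_space l2 \<Rightarrow> 'a l2"
  assumes markovian: "markovian_semigroup T"
begin

text \<open>
  A Markovian semigroup is unconstrained at times \<open>t \<le> 0\<close>. Putting the identity there makes
  \<open>t \<mapsto> P t u\<close> continuous on the closed half line.
\<close>

definition P :: "real \<Rightarrow> 'a l2 \<Rightarrow> 'a l2" where
  "P t u = (if t \<le> 0 then u else T t u)"

abbreviation S :: "real \<Rightarrow> 'a l2 \<Rightarrow> 'a l2" where
  "S \<equiv> potential_upto T"

lemma P_0 [simp]: "P 0 u = u"
  by (simp add: P_def)

lemma linear_P: "linear (P t)"
  using markovian by (cases "t \<le> 0") (auto simp: P_def[abs_def] markovian_semigroup_def linear_id[unfolded id_def])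

lemma P_sym: "inner (P t u) v = inner u (P t v)"
  using markovian by (auto simp: P_def markovian_semigroup_def)

lemma norm_P_le: "norm (P t u) \<le> norm u"
  using markovian by (auto simp: P_def markovian_semigroup_def)

lemma bounded_linear_P: "bounded_linear (P t)"
  using linear_P[of t] norm_P_le[of t]
  by (auto simp: linear_conv_bounded_linear bounded_linear_def bounded_linear_axioms_def intro!: exI[of _ 1])

lemma P_add:
  assumes "0 \<le> s" "0 \<le> t"
  shows "P (s + t) u = P s (P t u)"
  using markovian assms by (cases "s = 0"; cases "t = 0") (auto simp: P_def markovian_semigroup_def)

lemma P_tendsto_0: "((\<lambda>t. P t u) \<longlongrightarrow> u) (at_right 0)"
proof -
  have "((\<lambda>t. T t u) \<longlongrightarrow> u) (at_right 0)"
    using markovian by (auto simp: markovian_semigroup_def)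
  then show ?thesis
    by (rule Lim_transform_eventually) (auto simp: eventually_at_filter P_def)
qed

text \<open>
  By contractivity, \<open>\<parallel>P t u - P s u\<parallel>\<close> is at most \<open>\<parallel>P \<bar>t - s\<bar> u - u\<parallel>\<close>, so continuity at 0 suffices.
\<close>

lemma continuous_on_P: "continuous_on {0..} (\<lambda>t. P t u)"
proof -
  have mono: "dist (P t u) (P s u) \<le> dist (P (t - s) u) u" if "0 \<le> s" "s \<le> t" for s t
  proof -
    have "P t u - P s u = P s (P (t - s) u - u)"
      using that P_add[of s "t - s" u] by (simp add: linear_diff[OF linear_P])
    then show ?thesis
      unfolding dist_norm using norm_P_le by metis
  qed
  show ?thesis
    unfolding continuous_on_iff
  proof (intro ballI allI impI)
    fix s e :: real assume s: "s \<in> {0..}" and e: "0 < e"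
    obtain d where d: "0 < d" "\<And>t. 0 < t \<Longrightarrow> t < d \<Longrightarrow> dist (P t u) u < e"
      using tendstoD[OF P_tendsto_0[of u] e] by (auto simp: eventually_at_right_field)
    have d': "dist (P t u) u < e" if "0 \<le> t" "t < d" for t
      using d(2)[of t] that e by (cases "t = 0") auto
    have "dist (P t u) (P s u) < e" if "t \<in> {0..}" "dist t s < d" for t
    proof (cases "s \<le> t")
      case True
      then show ?thesis using mono[of s t] d'[of "t - s"] that s by (auto simp: dist_real_def)
    next
      case False
      then show ?thesis using mono[of t s] d'[of "s - t"] that s by (auto simp: dist_real_def dist_commute[of "P t u"])
    qed
    then show "\<exists>d>0. \<forall>t\<in>{0..}. dist t s < d \<longrightarrow> dist (P t u) (P s u) < e"
      using d(1) by blast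
  qed
qed

lemma P_integrable: "0 \<le> a \<Longrightarrow> (\<lambda>s. P s u) integrable_on {a..b}"
  by (intro integrable_continuous_real continuous_on_subset[OF continuous_on_P]) auto

lemma S_eq: "S t u = integral {0..t} (\<lambda>s. P s u)"
  unfolding potential_upto_def by (rule integral_spike[of "{0}"]) (auto simp: P_def)

lemma has_integral_S: "((\<lambda>s. P s u) has_integral S t u) {0..t}"
  unfolding S_eq by (intro integrable_integral P_integrable) simp

lemma has_integral_inner_S: "((\<lambda>s. inner (P s u) v) has_integral inner (S t u) v) {0..t}"
  using has_integral_linear[OF has_integral_S bounded_linear_inner_left] by (simp add: o_def)

lemma linear_S: "linear (S t)"
proof (rule linearI)
  fix u v
  show "S t (u + v) = S t u + S t v"
    using has_integral_add[OF has_integral_S[of u t] has_integral_S[of v t]]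
    by (intro has_integral_unique[OF has_integral_S]) (simp add: linear_add[OF linear_P])
next
  fix c u
  show "S t (c *\<^sub>R u) = c *\<^sub>R S t u"
    using has_integral_cmul[OF has_integral_S[of u t], of c]
    by (intro has_integral_unique[OF has_integral_S]) (simp add: linear_scale[OF linear_P])
qed

lemma S_sym: "inner (S t u) v = inner u (S t v)"
  using has_integral_unique[OF has_integral_inner_S[of u v t]] has_integral_inner_S[of v u t]
  by (simp add: P_sym inner_commute[of u])

lemma P_S:
  assumes "0 \<le> h" "0 \<le> t"
  shows "P h (S t u) = S (t + h) u - S h u"
proof -
  have "((\<lambda>s. P h (P s u)) has_integral P h (S t u)) {0..t}"
    using has_integral_linear[OF has_integral_S bounded_linear_P] by (simp add: o_def)
  then have "((\<lambda>s. P (s + h) u) has_integral P h (S t u)) {0..t}"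
    by (rule has_integral_eq[rotated]) (use assms in \<open>simp add: P_add[symmetric] add.commute\<close>)
  then have "((\<lambda>s. P s u) has_integral P h (S t u)) {h..t + h}"
    using has_integral_shift_real_ivl_iff[of "\<lambda>s. P s u" _ h "t + h" h] by simp
  then have "integral {h..t + h} (\<lambda>s. P s u) = P h (S t u)"
    by (rule integral_unique)
  moreover have "S h u + integral {h..t + h} (\<lambda>s. P s u) = S (t + h) u"
    unfolding S_eq using assms by (intro Henstock_Kurzweil_Integration.integral_combine P_integrable) auto
  ultimately show ?thesis by (simp add: algebra_simps)
qed

lemma S_0 [simp]: "S 0 u = 0"
  by (simp add: S_eq)

lemma S_increment_tendsto:
  assumes "0 \<le> t"
  shows "((\<lambda>h. (S (t + h) u - S t u) /\<^sub>R h) \<longlongrightarrow> P t u) (at_right 0)"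
proof -
  define f where "f y = integral {t..y} (\<lambda>s. P s u)" for y
  have "(f has_vector_derivative P t u) (at t within {t..t + 1})"
    unfolding f_def using assms
    by (intro integral_has_vector_derivative continuous_on_subset[OF continuous_on_P]) auto
  then have "((\<lambda>y. (f y - f t - (y - t) *\<^sub>R P t u) /\<^sub>R norm (y - t)) \<longlongrightarrow> 0) (at_right t)"
    by (simp add: has_vector_derivative_def has_derivative_within at_within_Icc_at_right diff_diff_eq divide_inverse)
  then have "((\<lambda>h. (f (h + t) - f t - h *\<^sub>R P t u) /\<^sub>R norm h) \<longlongrightarrow> 0) (at_right 0)"
    by (subst (asm) filterlim_at_right_to_0) simp
  then have "((\<lambda>h. (S (t + h) u - S t u) /\<^sub>R h - P t u) \<longlongrightarrow> 0) (at_right 0)"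
  proof (rule Lim_transform_eventually)
    show "\<forall>\<^sub>F h in at_right 0. (f (h + t) - f t - h *\<^sub>R P t u) /\<^sub>R norm h = (S (t + h) u - S t u) /\<^sub>R h - P t u"
      unfolding eventually_at_filter
    proof (rule always_eventually, intro allI impI)
      fix h :: real assume "h \<in> {0<..}"
      then have h: "0 < h" by simp
      have "S t u + f (h + t) = S (t + h) u"
        unfolding S_eq f_def add.commute[of h t] using assms h
        by (intro Henstock_Kurzweil_Integration.integral_combine P_integrable) auto
      then have "f (h + t) = S (t + h) u - S t u" by (simp add: algebra_simps)
      moreover have "f t = 0" by (simp add: f_def)
      ultimately show "(f (h + t) - f t - h *\<^sub>R P t u) /\<^sub>R norm h = (S (t + h) u - S t u) /\<^sub>R h - P t u"
        using h by (simp add: scaleR_diff_right)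
    qed
  qed
  then show ?thesis by (rule LIM_zero_cancel)
qed

text \<open>
  The potential up to time \<open>t\<close> solves the Poisson equation \<open>- A (S t u) = u - P t u\<close>: the
  increment \<open>P h (S t u) - S t u\<close> is an integral of the semigroup over \<open>[t, t + h]\<close> minus one over
  \<open>[0, h]\<close>.
\<close>

lemma S_in_generator:
  assumes "0 \<le> t"
  shows "(S t u, P t u - u) \<in> semigroup_generator T"
proof -
  have "((\<lambda>h. (S (t + h) u - S t u) /\<^sub>R h - S h u /\<^sub>R h) \<longlongrightarrow> P t u - u) (at_right 0)"
    using tendsto_diff[OF S_increment_tendsto[OF assms, of u] S_increment_tendsto[of 0 u]] by simp
  then have "((\<lambda>h. (T h (S t u) - S t u) /\<^sub>R h) \<longlongrightarrow> P t u - u) (at_right 0)"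
  proof (rule Lim_transform_eventually)
    show "\<forall>\<^sub>F h in at_right 0. (S (t + h) u - S t u) /\<^sub>R h - S h u /\<^sub>R h = (T h (S t u) - S t u) /\<^sub>R h"
      unfolding eventually_at_filter
    proof (rule always_eventually, intro allI impI)
      fix h :: real assume "h \<in> {0<..}"
      then have h: "0 < h" by simp
      then have "T h (S t u) = S (t + h) u - S h u"
        using P_S[of h t u] assms by (simp add: P_def)
      then show "(S (t + h) u - S t u) /\<^sub>R h - S h u /\<^sub>R h = (T h (S t u) - S t u) /\<^sub>R h"
        by (simp add: scaleR_diff_right[symmetric])
    qed
  qed
  then show ?thesis by (simp add: semigroup_generator_def)
qed

lemma P_bounded_nonneg:
  assumes "0 < c" "AE x in lborel. 0 \<le> fun_of u x \<and> fun_of u x \<le> c"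
  shows "AE x in lborel. 0 \<le> fun_of (P t u) x \<and> fun_of (P t u) x \<le> c"
proof (cases "t \<le> 0")
  case False
  have "AE x in lborel. 0 \<le> fun_of ((1 / c) *\<^sub>R u) x \<and> fun_of ((1 / c) *\<^sub>R u) x \<le> 1"
    using assms(2) fun_of_scaleR[of "1 / c" u]
    by eventually_elim (use assms(1) in auto)
  then have "AE x in lborel. 0 \<le> fun_of (P t ((1 / c) *\<^sub>R u)) x \<and> fun_of (P t ((1 / c) *\<^sub>R u)) x \<le> 1"
    using markovian False unfolding markovian_semigroup_def P_def by auto
  moreover have "P t ((1 / c) *\<^sub>R u) = (1 / c) *\<^sub>R P t u"
    by (simp add: linear_scale[OF linear_P])
  ultimately have "AE x in lborel. 0 \<le> fun_of ((1 / c) *\<^sub>R P t u) x \<and> fun_of ((1 / c) *\<^sub>R P t u) x \<le> 1"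
    by simp
  with fun_of_scaleR[of "1 / c" "P t u"] show ?thesis
    by eventually_elim (use assms(1) in \<open>auto simp: zero_le_divide_iff\<close>)
qed (use assms in \<open>simp add: P_def\<close>)

lemma P_nonneg:
  assumes u: "l2_nonneg u"
  shows "l2_nonneg (P t u)"
proof (subst l2_nonneg_iff_inner, intro allI impI)
  fix v :: "'a l2" assume v: "l2_nonneg v"
  define U where "U n = l2_of (\<lambda>x. min (real n) (fun_of u x))" for n
  have "l2_nonneg (P t (U (Suc n)))" for n
  proof -
    have "AE x in lborel. 0 \<le> fun_of (U (Suc n)) x \<and> fun_of (U (Suc n)) x \<le> real (Suc n)"
      using fun_of_l2_of[OF l2_truncation_tendsto(1)[of "Suc n" u]] u[unfolded l2_nonneg_def]
      unfolding U_def by eventually_elim auto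
    then have "AE x in lborel. 0 \<le> fun_of (P t (U (Suc n))) x \<and> fun_of (P t (U (Suc n))) x \<le> real (Suc n)"
      by (rule P_bounded_nonneg[rotated]) simp
    then show ?thesis unfolding l2_nonneg_def by eventually_elim simp
  qed
  then have "0 \<le> inner (P t (U (Suc n))) v" for n
    using v by (rule inner_nonneg)
  moreover have "(\<lambda>n. inner (P t (U (Suc n))) v) \<longlonglongrightarrow> inner (P t u) v"
    using LIMSEQ_Suc[OF l2_truncation_tendsto(2)[of u]] unfolding U_def[symmetric]
    by (intro tendsto_inner tendsto_const bounded_linear.tendsto[OF bounded_linear_P])
  ultimately show "0 \<le> inner (P t u) v"
    by (intro LIMSEQ_le_const) auto
qed

lemma S_nonneg:
  assumes "l2_nonneg u"
  shows "l2_nonneg (S t u)"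
proof (subst l2_nonneg_iff_inner, intro allI impI)
  fix v :: "'a l2" assume "l2_nonneg v"
  then show "0 \<le> inner (S t u) v"
    by (intro has_integral_nonneg[OF has_integral_inner_S] inner_nonneg P_nonneg assms)
qed

lemma S_mono:
  assumes "l2_nonneg u" "0 \<le> s" "s \<le> t"
  shows "AE x in lborel. fun_of (S s u) x \<le> fun_of (S t u) x"
proof -
  have "S t u - S s u = P s (S (t - s) u)"
    using P_S[of s "t - s" u] assms by simp
  then show ?thesis
    unfolding l2_nonneg_diff_iff[symmetric] by (simp add: P_nonneg S_nonneg assms)
qed

lemma P_indicator_le_1:
  assumes "A \<in> sets borel" "emeasure lborel A < \<infinity>"
  shows "AE x in lborel. fun_of (P t (l2_indicator A)) x \<le> 1"
proof -
  have "AE x in lborel. 0 \<le> fun_of (l2_indicator A) x \<and> fun_of (l2_indicator A) x \<le> 1"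
    using fun_of_l2_indicator[OF assms] by eventually_elim (simp add: indicator_def)
  then have "AE x in lborel. 0 \<le> fun_of (P t (l2_indicator A)) x \<and> fun_of (P t (l2_indicator A)) x \<le> 1"
    by (rule P_bounded_nonneg[rotated]) simp
  then show ?thesis by eventually_elim simp
qed

lemma S_indicator_le:
  assumes "0 \<le> t" and B: "B \<in> sets borel" "emeasure lborel B < \<infinity>"
  shows "AE x in lborel. fun_of (S t (l2_indicator B)) x \<le> t"
proof (rule l2_le_const_if_inner)
  fix A :: "'a set" assume A: "A \<in> sets borel" "emeasure lborel A < \<infinity>"
  have "inner (P s (l2_indicator B)) (l2_indicator A) \<le> measure lborel A" for s
  proof -
    have int1: "integrable lborel (indicator A :: 'a \<Rightarrow> real)"
      using A by (auto simp: integrable_indicator_iff)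
    have "inner (P s (l2_indicator B)) (l2_indicator A) \<le> (\<integral>x. indicator A x \<partial>lborel)"
      unfolding inner_l2_indicator[OF A]
    proof (rule integral_mono_AE)
      show "AE x in lborel. fun_of (P s (l2_indicator B)) x * indicator A x \<le> indicator A x"
        using P_indicator_le_1[OF B, of s] by eventually_elim (auto simp: indicator_def)
    qed (use int1 integrable_fun_of_indicator[OF A] in auto)
    then show ?thesis by simp
  qed
  then show "inner (S t (l2_indicator B)) (l2_indicator A) \<le> t * measure lborel A"
    using has_integral_le[OF has_integral_inner_S has_integral_const_real[of "measure lborel A" 0 t]] assms(1)
    by simp
qed

lemma P_L1:
  assumes "integrable lborel (fun_of u)"
  shows "integrable lborel (fun_of (P t u))"
    and "(\<integral>x. \<bar>fun_of (P t u) x\<bar> \<partial>lborel) \<le> (\<integral>x. \<bar>fun_of u x\<bar> \<partial>lborel)"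
proof -
  have "AE x in lborel. fun_of (P t (l2_indicator (ball 0 (real n)))) x \<le> 1" for n
    by (rule P_indicator_le_1) (auto simp: emeasure_lborel_ball_finite[unfolded infinity_ennreal_def])
  note * = L1_bound[OF linear_P P_sym P_nonneg this assms]
  show "integrable lborel (fun_of (P t u))" 
    and "(\<integral>x. \<bar>fun_of (P t u) x\<bar> \<partial>lborel) \<le> (\<integral>x. \<bar>fun_of u x\<bar> \<partial>lborel)"
    using * by simp_all
qed

lemma S_L1:
  assumes "0 \<le> t" "integrable lborel (fun_of u)"
  shows "integrable lborel (fun_of (S t u))"
    and "(\<integral>x. \<bar>fun_of (S t u) x\<bar> \<partial>lborel) \<le> t * (\<integral>x. \<bar>fun_of u x\<bar> \<partial>lborel)"
proof -
  have "AE x in lborel. fun_of (S t (l2_indicator (ball 0 (real n)))) x \<le> t" for n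
    by (rule S_indicator_le[OF assms(1)]) (auto simp: emeasure_lborel_ball_finite[unfolded infinity_ennreal_def])
  note * = L1_bound[OF linear_S S_sym S_nonneg this assms(2)]
  show "integrable lborel (fun_of (S t u))" 
    and "(\<integral>x. \<bar>fun_of (S t u) x\<bar> \<partial>lborel) \<le> t * (\<integral>x. \<bar>fun_of u x\<bar> \<partial>lborel)"
    using * by simp_all
qed

text \<open>
  If \<open>S t 1\<^sub>A\<close> vanished on a part \<open>B\<close> of \<open>A\<close>, then so would the nonnegative continuous function
  \<open>s \<mapsto> \<langle>P s 1\<^sub>A, 1\<^sub>B\<rangle>\<close>, whose value at 0 is the measure of \<open>B\<close>.
\<close>

lemma S_indicator_pos:
  assumes "0 < t" and A: "A \<in> sets borel" "emeasure lborel A < \<infinity>"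
  shows "AE x in lborel. x \<in> A \<longrightarrow> 0 < fun_of (S t (l2_indicator A)) x"
proof -
  define B where "B = {x \<in> A. fun_of (S t (l2_indicator A)) x \<le> 0}"
  have B [measurable]: "B \<in> sets borel"
    using A(1) unfolding B_def by measurable
  have "emeasure lborel B \<le> emeasure lborel A"
    using A(1) by (intro emeasure_mono) (auto simp: B_def)
  then have finB: "emeasure lborel B < \<infinity>" using A(2) by (rule le_less_trans)
  have "inner (S t (l2_indicator A)) (l2_indicator B) \<le> (\<integral>x. 0 \<partial>(lborel :: 'a measure))"
    unfolding inner_l2_indicator[OF B finB]
    by (rule integral_mono[OF integrable_fun_of_indicator[OF B finB]]) (auto simp: B_def indicator_def)
  then have "inner (S t (l2_indicator A)) (l2_indicator B) = 0"
    using inner_nonneg[OF S_nonneg[OF l2_indicator_nonneg[OF A]] l2_indicator_nonneg[OF B finB]] by (simp add: antisym)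
  then have I: "((\<lambda>s. inner (P s (l2_indicator A)) (l2_indicator B)) has_integral 0) (cbox 0 t)"
    using has_integral_inner_S[of "l2_indicator A" "l2_indicator B" t] by simp
  have "inner (P 0 (l2_indicator A)) (l2_indicator B) = 0"
  proof (rule has_integral_0_cbox_imp_0[OF _ _ I])
    show "continuous_on (cbox 0 t) (\<lambda>s. inner (P s (l2_indicator A)) (l2_indicator B))"
      by (intro continuous_on_inner continuous_on_const continuous_on_subset[OF continuous_on_P]) auto
    show "0 \<le> inner (P s (l2_indicator A)) (l2_indicator B)" for s
      by (intro inner_nonneg P_nonneg l2_indicator_nonneg A B finB)
  qed (use assms(1) in auto)
  then have "(\<integral>x. fun_of (l2_indicator A) x * indicator B x \<partial>lborel) = 0"
    by (simp add: inner_l2_indicator[OF B finB])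
  moreover have "(\<integral>x. fun_of (l2_indicator A) x * indicator B x \<partial>lborel) = (\<integral>x. indicator B x \<partial>lborel)"
  proof (rule integral_cong_AE)
    show "AE x in lborel. fun_of (l2_indicator A) x * indicator B x = indicator B x"
      using fun_of_l2_indicator[OF A] by eventually_elim (auto simp: B_def indicator_def)
  qed measurable
  ultimately have "measure lborel B = 0" by simp
  then have "emeasure lborel B = 0"
    using finB by (auto simp: measure_def enn2real_eq_0_iff)
  then have "AE x in lborel. x \<notin> B"
    by (intro AE_not_in) (auto simp: null_sets_def)
  then show ?thesis
    by eventually_elim (auto simp: B_def not_le)
qed

text \<open>
  Hopf's maximal ergodic inequality for the operator \<open>P 1\<close> and the function \<open>S 1 u\<close>, whose ergodic
  sums are the potentials \<open>S k u\<close>. This is Garsia's proof: where the maximum \<open>m\<close> of 0 and the first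
  \<open>N\<close> sums is positive, \<open>m \<le> P 1 m + S 1 u\<close>, because \<open>S (k + 1) u = P 1 (S k u) + S 1 u\<close> and
  \<open>P 1\<close> is monotone; integrate, and use that \<open>P 1\<close> does not increase the L1 norm.
\<close>

lemma maximal_inequality:
  assumes u: "integrable lborel (fun_of u)"
  shows "0 \<le> (\<integral>x. fun_of (S 1 u) x * indicator {x. \<exists>k\<in>{1..N}. 0 < fun_of (S (real k) u) x} x \<partial>lborel)"
proof -
  define m where "m = rec_nat (\<lambda>x::'a. 0) (\<lambda>n f x. max (f x) (fun_of (S (real (Suc n)) u) x))"
  have m_0: "m 0 x = 0" and m_Suc: "m (Suc n) x = max (m n x) (fun_of (S (real (Suc n)) u) x)" for n x
    by (simp_all add: m_def)
  have m_meas [measurable]: "m n \<in> borel_measurable borel" for n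
  proof (induction n)
    case 0 then show ?case by (simp add: m_def)
  next
    case (Suc n)
    have "m (Suc n) = (\<lambda>x. max (m n x) (fun_of (S (real (Suc n)) u) x))"
      by (simp add: fun_eq_iff m_Suc)
    with Suc show ?case by simp
  qed
  have m_int: "integrable lborel (m n)" for n
  proof (induction n)
    case 0 then show ?case by (simp add: m_def)
  next
    case (Suc n)
    have "m (Suc n) = (\<lambda>x. max (m n x) (fun_of (S (real (Suc n)) u) x))"
      by (simp add: fun_eq_iff m_Suc)
    with Suc S_L1(1)[OF _ u, of "real (Suc n)"] show ?case by simp
  qed
  have m_sq: "integrable lborel (\<lambda>x. (m n x)\<^sup>2)" for n
  proof (induction n)
    case 0 then show ?case by (simp add: m_def)
  next
    case (Suc n)
    show ?case
    proof (rule Bochner_Integration.integrable_bound)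
      show "integrable lborel (\<lambda>x. (m n x)\<^sup>2 + (fun_of (S (real (Suc n)) u) x)\<^sup>2)"
        using Suc integrable_fun_of_square by (rule Bochner_Integration.integrable_add)
    qed (auto simp: m_Suc max_def)
  qed
  have m_nonneg: "0 \<le> m n x" for n x
    by (induction n) (auto simp: m_0 m_Suc)
  have m_ge: "fun_of (S (real k) u) x \<le> m n x" if "k \<in> {1..n}" for k n x
    using that by (induction n) (auto simp: m_Suc le_Suc_eq)
  have m_attained: "m n x = 0 \<or> (\<exists>k\<in>{1..n}. m n x = fun_of (S (real k) u) x)" for n x
  proof (induction n)
    case (Suc n)
    show ?case
    proof (cases "m n x \<le> fun_of (S (real (Suc n)) u) x")
      case True
      then have "m (Suc n) x = fun_of (S (real (Suc n)) u) x" by (simp add: m_Suc)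
      then show ?thesis by (intro disjI2 bexI[of _ "Suc n"]) auto
    next
      case False
      then have "m (Suc n) x = m n x" by (simp add: m_Suc)
      moreover have "{1..n} \<subseteq> {1..Suc n}" by auto
      ultimately show ?thesis using Suc by auto
    qed
  qed (simp add: m_0)
  have m_pos_iff: "0 < m n x \<longleftrightarrow> (\<exists>k\<in>{1..n}. 0 < fun_of (S (real k) u) x)" for n x
    using m_attained[of n x] m_ge[of _ n x] by (metis less_irrefl less_le_trans)
  define w where "w = l2_of (m N)"
  have w: "AE x in lborel. fun_of w x = m N x"
    unfolding w_def using m_sq m_meas by (intro fun_of_l2_of) (simp add: square_integrable_def)
  have w_nonneg: "l2_nonneg w"
    unfolding l2_nonneg_def using w by eventually_elim (simp add: m_nonneg)
  have Pw_nonneg: "AE x in lborel. 0 \<le> fun_of (P 1 w) x"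
    using P_nonneg[OF w_nonneg, of 1] by (simp add: l2_nonneg_def)
  have step: "AE x in lborel. \<forall>k<N. fun_of (S (real (Suc k)) u) x \<le> fun_of (P 1 w) x + fun_of (S 1 u) x"
  proof (subst AE_all_countable, intro allI)
    fix k
    show "AE x in lborel. k < N \<longrightarrow> fun_of (S (real (Suc k)) u) x \<le> fun_of (P 1 w) x + fun_of (S 1 u) x"
    proof (cases "k < N")
      case True
      have "l2_nonneg (w - S (real k) u)"
      proof (cases "k = 0")
        case False
        with True have "k \<in> {1..N}" by auto
        from w m_ge[OF this] show ?thesis
          unfolding l2_nonneg_diff_iff by (auto elim: eventually_mono)
      qed (simp add: w_nonneg)
      then have "l2_nonneg (P 1 w - P 1 (S (real k) u))"
        unfolding linear_diff[OF linear_P, symmetric] by (rule P_nonneg)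
      also have "P 1 w - P 1 (S (real k) u) = (P 1 w + S 1 u) - S (real (Suc k)) u"
        using P_S[of 1 "real k" u] by (simp add: algebra_simps)
      finally have "AE x in lborel. fun_of (S (real (Suc k)) u) x \<le> fun_of (P 1 w + S 1 u) x"
        unfolding l2_nonneg_diff_iff .
      with fun_of_add[of "P 1 w" "S 1 u"] show ?thesis by eventually_elim simp
    qed simp
  qed
  let ?A = "{x. \<exists>k\<in>{1..N}. 0 < fun_of (S (real k) u) x}"
  have A: "?A = {x. 0 < m N x}" by (auto simp: m_pos_iff)
  have le: "AE x in lborel. m N x \<le> fun_of (P 1 w) x + fun_of (S 1 u) x * indicator ?A x"
    using step Pw_nonneg
  proof eventually_elim
    fix x
    assume s: "\<forall>k<N. fun_of (S (real (Suc k)) u) x \<le> fun_of (P 1 w) x + fun_of (S 1 u) x"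
      and p: "0 \<le> fun_of (P 1 w) x"
    show "m N x \<le> fun_of (P 1 w) x + fun_of (S 1 u) x * indicator ?A x"
    proof (cases "0 < m N x")
      case True
      with m_attained[of N x] obtain k where k: "k \<in> {1..N}" "m N x = fun_of (S (real k) u) x" by auto
      then have "m N x \<le> fun_of (P 1 w) x + fun_of (S 1 u) x"
        using s[rule_format, of "k - 1"] by auto
      with True show ?thesis unfolding A by (simp add: indicator_def)
    next
      case False
      with m_nonneg[of N x] p show ?thesis unfolding A by (simp add: indicator_def)
    qed
  qed
  have w_int: "integrable lborel (fun_of w)"
    using w m_int[of N] by (subst integrable_cong_AE[of _ _ "m N"]) auto
  have S1: "integrable lborel (\<lambda>x. fun_of (S 1 u) x * indicator ?A x)"
    using S_L1(1)[OF _ u, of 1] unfolding A by (intro integrable_real_mult_indicator) auto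
  have "(\<integral>x. m N x \<partial>lborel) \<le> (\<integral>x. fun_of (P 1 w) x + fun_of (S 1 u) x * indicator ?A x \<partial>lborel)"
    using m_int P_L1(1)[OF w_int] S1 le by (intro integral_mono_AE) auto
  also have "\<dots> = (\<integral>x. fun_of (P 1 w) x \<partial>lborel) + (\<integral>x. fun_of (S 1 u) x * indicator ?A x \<partial>lborel)"
    using P_L1(1)[OF w_int] S1 by simp
  also have "(\<integral>x. fun_of (P 1 w) x \<partial>lborel) \<le> (\<integral>x. \<bar>fun_of (P 1 w) x\<bar> \<partial>lborel)"
    using P_L1(1)[OF w_int] by (intro integral_mono) auto
  also have "\<dots> \<le> (\<integral>x. \<bar>fun_of w x\<bar> \<partial>lborel)" by (rule P_L1(2)[OF w_int])
  also have "\<dots> = (\<integral>x. m N x \<partial>lborel)"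
  proof (rule integral_cong_AE)
    show "AE x in lborel. \<bar>fun_of w x\<bar> = m N x"
      using w by eventually_elim (simp add: m_nonneg)
  qed measurable
  finally show ?thesis by simp
qed

end


section \<open>Transience from local domination by the form\<close>

text \<open>
  Cutting off the values above \<open>n\<close> makes an integrable function square integrable, since then
  \<open>f\<^sup>2 \<le> n \<bar>f\<bar>\<close>.
\<close>

lemma L1_approximation:
  fixes f :: "'a::euclidean_space \<Rightarrow> real"
  assumes f: "integrable lborel f"
  obtains h :: "nat \<Rightarrow> 'a l2" where
    "\<And>n. AE x in lborel. fun_of (h n) x = (if \<bar>f x\<bar> \<le> real n then f x else 0)"
    "\<And>n. integrable lborel (fun_of (h n))"
    "(\<lambda>n. \<integral>x. \<bar>fun_of (h n) x - f x\<bar> \<partial>lborel) \<longlonglongrightarrow> 0"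
proof -
  have [measurable]: "f \<in> borel_measurable borel" using f by auto
  define g where "g n x = (if \<bar>f x\<bar> \<le> real n then f x else 0)" for n :: nat and x
  have [measurable]: "g n \<in> borel_measurable borel" for n unfolding g_def by measurable
  have g_int: "integrable lborel (g n)" for n
    by (rule Bochner_Integration.integrable_bound[OF f]) (auto simp: g_def)
  have g_sq: "square_integrable (g n)" for n
    unfolding square_integrable_def
  proof
    show "integrable lborel (\<lambda>x. (g n x)\<^sup>2)"
    proof (rule Bochner_Integration.integrable_bound)
      show "integrable lborel (\<lambda>x. real n * f x)" using f by auto
      have "(g n x)\<^sup>2 \<le> \<bar>real n * f x\<bar>" for x
      proof (cases "\<bar>f x\<bar> \<le> real n")
        case True
        have "(g n x)\<^sup>2 = \<bar>f x\<bar> * \<bar>f x\<bar>" using True by (simp add: g_def power2_eq_square)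
        also have "\<dots> \<le> real n * \<bar>f x\<bar>" using True by (intro mult_right_mono) auto
        finally show ?thesis by (simp add: abs_mult)
      qed (simp add: g_def)
      then show "AE x in lborel. norm ((g n x)\<^sup>2) \<le> norm (real n * f x)" by simp
    qed measurable
  qed measurable
  define h where "h n = l2_of (g n)" for n
  have h: "AE x in lborel. fun_of (h n) x = g n x" for n
    unfolding h_def by (rule fun_of_l2_of[OF g_sq])
  have h_int: "integrable lborel (fun_of (h n))" for n
    using h[of n] g_int[of n] by (subst integrable_cong_AE[of _ _ "g n"]) auto
  have "(\<integral>x. \<bar>fun_of (h n) x - f x\<bar> \<partial>lborel) = (\<integral>x. \<bar>g n x - f x\<bar> \<partial>lborel)" for n
  proof (rule integral_cong_AE)
    show "AE x in lborel. \<bar>fun_of (h n) x - f x\<bar> = \<bar>g n x - f x\<bar>"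
      using h[of n] by eventually_elim simp
  qed measurable
  moreover have "(\<lambda>n. \<integral>x. \<bar>g n x - f x\<bar> \<partial>lborel) \<longlonglongrightarrow> (\<integral>x. 0 \<partial>(lborel :: 'a measure))"
  proof (rule integral_dominated_convergence[where w = "\<lambda>x. \<bar>f x\<bar>"])
    show "AE x in lborel. (\<lambda>n. \<bar>g n x - f x\<bar>) \<longlonglongrightarrow> 0"
    proof (rule AE_I2)
      fix x
      obtain N :: nat where "\<bar>f x\<bar> < real N" using reals_Archimedean2 by blast
      then have "\<forall>\<^sub>F n in sequentially. \<bar>g n x - f x\<bar> = 0"
        by (intro eventually_sequentiallyI[of N]) (auto simp: g_def)
      then show "(\<lambda>n. \<bar>g n x - f x\<bar>) \<longlonglongrightarrow> 0" by (rule tendsto_eventually)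
    qed
    show "AE x in lborel. norm \<bar>g n x - f x\<bar> \<le> \<bar>f x\<bar>" for n
      by (rule AE_I2) (auto simp: g_def)
  qed (use f in auto)
  ultimately have "(\<lambda>n. \<integral>x. \<bar>fun_of (h n) x - f x\<bar> \<partial>lborel) \<longlonglongrightarrow> 0" by simp
  with h h_int show ?thesis unfolding g_def by (rule that)
qed

lemma L1_triangle:
  fixes a b c :: "'a \<Rightarrow> real"
  assumes "integrable M a" "integrable M b" "integrable M c"
  shows "(\<integral>x. \<bar>a x - c x\<bar> \<partial>M) \<le> (\<integral>x. \<bar>a x - b x\<bar> \<partial>M) + (\<integral>x. \<bar>b x - c x\<bar> \<partial>M)"
proof -
  have "(\<integral>x. \<bar>a x - c x\<bar> \<partial>M) \<le> (\<integral>x. \<bar>a x - b x\<bar> + \<bar>b x - c x\<bar> \<partial>M)"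
    using assms by (intro integral_mono) auto
  then show ?thesis using assms by simp
qed

lemma L1_limit_mono:
  fixes a b :: "nat \<Rightarrow> 'a \<Rightarrow> real"
  assumes int: "\<And>n. integrable M (a n)" "\<And>n. integrable M (b n)" "integrable M a'" "integrable M b'"
    and le: "\<And>n. AE x in M. a n x \<le> b n x"
    and lim: "(\<lambda>n. \<integral>x. \<bar>a n x - a' x\<bar> \<partial>M) \<longlonglongrightarrow> 0" "(\<lambda>n. \<integral>x. \<bar>b n x - b' x\<bar> \<partial>M) \<longlonglongrightarrow> 0"
  shows "AE x in M. a' x \<le> b' x"
proof -
  have le': "(\<integral>x. max 0 (a' x - b' x) \<partial>M) \<le> (\<integral>x. \<bar>a n x - a' x\<bar> \<partial>M) + (\<integral>x. \<bar>b n x - b' x\<bar> \<partial>M)" for n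
  proof -
    have "(\<integral>x. max 0 (a' x - b' x) \<partial>M) \<le> (\<integral>x. \<bar>a n x - a' x\<bar> + \<bar>b n x - b' x\<bar> \<partial>M)"
    proof (rule integral_mono_AE)
      show "AE x in M. max 0 (a' x - b' x) \<le> \<bar>a n x - a' x\<bar> + \<bar>b n x - b' x\<bar>"
        using le[of n] by eventually_elim auto
    qed (use int in auto)
    then show ?thesis using int by simp
  qed
  have "(\<lambda>n. (\<integral>x. \<bar>a n x - a' x\<bar> \<partial>M) + (\<integral>x. \<bar>b n x - b' x\<bar> \<partial>M)) \<longlonglongrightarrow> 0"
    using tendsto_add[OF lim] by simp
  then have "(\<integral>x. max 0 (a' x - b' x) \<partial>M) \<le> 0"
    by (rule LIMSEQ_le_const) (use le' in auto)
  moreover have "0 \<le> (\<integral>x. max 0 (a' x - b' x) \<partial>M)"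
    by (rule Bochner_Integration.integral_nonneg) simp
  ultimately have "(\<integral>x. max 0 (a' x - b' x) \<partial>M) = 0" by linarith
  then have "AE x in M. max 0 (a' x - b' x) = 0"
    using int by (subst (asm) integral_nonneg_eq_0_iff_AE) auto
  then show ?thesis by eventually_elim (auto simp: max_def split: if_splits)
qed

context l2_markov_semigroup
begin

abbreviation S_bar :: "real \<Rightarrow> ('a \<Rightarrow> real) \<Rightarrow> 'a \<Rightarrow> real" where
  "S_bar \<equiv> potential_upto_L1 T"

lemma S_L1_Lipschitz:
  assumes t: "0 \<le> t" and u: "integrable lborel (fun_of u)" and v: "integrable lborel (fun_of v)"
  shows "(\<integral>x. \<bar>fun_of (S t u) x - fun_of (S t v) x\<bar> \<partial>lborel) \<le> t * (\<integral>x. \<bar>fun_of u x - fun_of v x\<bar> \<partial>lborel)"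
proof -
  have d: "(\<integral>x. \<bar>fun_of a x - fun_of b x\<bar> \<partial>lborel) = (\<integral>x. \<bar>fun_of (a - b) x\<bar> \<partial>lborel)" for a b :: "'a l2"
  proof (rule integral_cong_AE)
    show "AE x in lborel. \<bar>fun_of a x - fun_of b x\<bar> = \<bar>fun_of (a - b) x\<bar>"
      using fun_of_diff[of a b] by eventually_elim simp
  qed measurable
  have "integrable lborel (fun_of (u - v))"
    using fun_of_diff[of u v] u v
    by (subst integrable_cong_AE[of _ _ "\<lambda>x. fun_of u x - fun_of v x"]) auto
  from S_L1(2)[OF t this] show ?thesis
    unfolding d by (simp add: linear_diff[OF linear_S])
qed

text \<open>
  The characterization by which the extension is chosen has a witness: \<open>S t\<close> is Lipschitz in the
  L1 norm, so it maps an approximating sequence of \<open>f\<close> to a Cauchy sequence in L1, and any two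
  approximating sequences to sequences with the same limit.
\<close>

lemma S_bar_extends_S:
  assumes t: "0 \<le> t" and f: "integrable lborel f"
  shows "integrable lborel (S_bar t f)"
    and "\<And>h. (\<And>n. integrable lborel (fun_of (h n))) \<Longrightarrow>
      (\<lambda>n. \<integral>x. \<bar>fun_of (h n) x - f x\<bar> \<partial>lborel) \<longlonglongrightarrow> 0 \<Longrightarrow>
      (\<lambda>n. \<integral>x. \<bar>fun_of (S t (h n)) x - S_bar t f x\<bar> \<partial>lborel) \<longlonglongrightarrow> 0"
proof -
  obtain h :: "nat \<Rightarrow> 'a l2" where h_int: "\<And>n. integrable lborel (fun_of (h n))"
    and h_lim: "(\<lambda>n. \<integral>x. \<bar>fun_of (h n) x - f x\<bar> \<partial>lborel) \<longlonglongrightarrow> 0"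
    by (rule L1_approximation[OF f]) blast
  define \<epsilon> where "\<epsilon> h n = (\<integral>x. \<bar>fun_of (h n) x - f x\<bar> \<partial>lborel)" for h :: "nat \<Rightarrow> 'a l2" and n
  have close: "(\<integral>x. \<bar>fun_of (S t (h m)) x - fun_of (S t (h' n)) x\<bar> \<partial>lborel) \<le> t * (\<epsilon> h m + \<epsilon> h' n)"
    if "\<And>n. integrable lborel (fun_of (h n))" "\<And>n. integrable lborel (fun_of (h' n))"
    for h h' :: "nat \<Rightarrow> 'a l2" and m n
  proof -
    have "(\<integral>x. \<bar>fun_of (S t (h m)) x - fun_of (S t (h' n)) x\<bar> \<partial>lborel)
        \<le> t * (\<integral>x. \<bar>fun_of (h m) x - fun_of (h' n) x\<bar> \<partial>lborel)"
      by (rule S_L1_Lipschitz[OF t that])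
    also have "(\<integral>x. \<bar>fun_of (h m) x - fun_of (h' n) x\<bar> \<partial>lborel)
        \<le> \<epsilon> h m + (\<integral>x. \<bar>f x - fun_of (h' n) x\<bar> \<partial>lborel)"
      unfolding \<epsilon>_def by (rule L1_triangle[OF that(1) f that(2)])
    also have "(\<integral>x. \<bar>f x - fun_of (h' n) x\<bar> \<partial>lborel) = \<epsilon> h' n"
      unfolding \<epsilon>_def by (simp add: abs_minus_commute)
    finally show ?thesis using t by (simp add: mult_left_mono)
  qed
  have S_int: "integrable lborel (fun_of (S t (h n)))" for n by (rule S_L1(1)[OF t h_int])
  have nn: "(\<integral>\<^sup>+x. ennreal \<bar>a x\<bar> \<partial>lborel) = ennreal (\<integral>x. \<bar>a x\<bar> \<partial>lborel)" if "integrable lborel a" for a :: "'a \<Rightarrow> real"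
    using that by (intro nn_integral_eq_integral) auto
  have "\<exists>N. \<forall>m\<ge>N. \<forall>n\<ge>N. (\<integral>\<^sup>+x. ennreal (\<bar>fun_of (S t (h m)) x - fun_of (S t (h n)) x\<bar> ^ 1) \<partial>lborel) \<le> ennreal e"
    if e: "0 < e" for e :: real
  proof -
    have "(\<lambda>n. t * (\<epsilon> h n + \<epsilon> h n)) \<longlonglongrightarrow> t * (0 + 0)"
      unfolding \<epsilon>_def by (intro tendsto_intros h_lim)
    then have "(\<lambda>n. t * (\<epsilon> h n + \<epsilon> h n)) \<longlonglongrightarrow> 0" by simp
    then have "\<forall>\<^sub>F n in sequentially. t * (\<epsilon> h n + \<epsilon> h n) < e"
      using e by (rule order_tendstoD)
    then obtain N where N: "\<And>n. N \<le> n \<Longrightarrow> t * (\<epsilon> h n + \<epsilon> h n) < e"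
      by (auto simp: eventually_sequentially)
    have "(\<integral>\<^sup>+x. ennreal (\<bar>fun_of (S t (h m)) x - fun_of (S t (h n)) x\<bar> ^ 1) \<partial>lborel) \<le> ennreal e"
      if "N \<le> m" "N \<le> n" for m n
    proof -
      have "t * (\<epsilon> h m + \<epsilon> h n) \<le> e"
        using N[OF that(1)] N[OF that(2)] by (simp add: algebra_simps)
      with close[of h h m n, OF h_int h_int] show ?thesis
        using S_int by (simp add: nn ennreal_leI)
    qed
    then show ?thesis by blast
  qed
  then obtain g where g[measurable]: "g \<in> borel_measurable lborel"
    and g_lim: "(\<lambda>n. \<integral>\<^sup>+x. ennreal (\<bar>fun_of (S t (h n)) x - g x\<bar> ^ 1) \<partial>lborel) \<longlonglongrightarrow> 0"
    by (rule Lp_complete[of 1 "\<lambda>n. fun_of (S t (h n))" lborel, rotated 2]) simp_all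
  have "\<forall>\<^sub>F n in sequentially. (\<integral>\<^sup>+x. ennreal (\<bar>fun_of (S t (h n)) x - g x\<bar> ^ 1) \<partial>lborel) < \<infinity>"
    using g_lim by (rule order_tendstoD) simp
  then obtain n where n: "(\<integral>\<^sup>+x. ennreal (\<bar>fun_of (S t (h n)) x - g x\<bar> ^ 1) \<partial>lborel) < \<infinity>"
    by (auto simp: eventually_sequentially)
  have "integrable lborel (\<lambda>x. fun_of (S t (h n)) x - g x)"
    using n by (intro integrableI_bounded) auto
  from Bochner_Integration.integrable_diff[OF S_int[of n] this] have g_int: "integrable lborel g" by simp
  have "(\<lambda>n. ennreal (\<integral>x. \<bar>fun_of (S t (h n)) x - g x\<bar> \<partial>lborel)) \<longlonglongrightarrow> ennreal 0"
    using g_lim S_int g_int by (simp add: nn)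
  then have g_lim: "(\<lambda>n. \<integral>x. \<bar>fun_of (S t (h n)) x - g x\<bar> \<partial>lborel) \<longlonglongrightarrow> 0"
    by (rule tendsto_ennrealD) auto
  have g_prop: "(\<lambda>n. \<integral>x. \<bar>fun_of (S t (h' n)) x - g x\<bar> \<partial>lborel) \<longlonglongrightarrow> 0"
    if h': "\<And>n. integrable lborel (fun_of (h' n))" "(\<lambda>n. \<integral>x. \<bar>fun_of (h' n) x - f x\<bar> \<partial>lborel) \<longlonglongrightarrow> 0"
    for h' :: "nat \<Rightarrow> 'a l2"
  proof (rule tendsto_sandwich[OF _ _ tendsto_const])
    show "\<forall>\<^sub>F n in sequentially. 0 \<le> (\<integral>x. \<bar>fun_of (S t (h' n)) x - g x\<bar> \<partial>lborel)" by simp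
    show "\<forall>\<^sub>F n in sequentially. (\<integral>x. \<bar>fun_of (S t (h' n)) x - g x\<bar> \<partial>lborel)
        \<le> t * (\<epsilon> h' n + \<epsilon> h n) + (\<integral>x. \<bar>fun_of (S t (h n)) x - g x\<bar> \<partial>lborel)"
    proof (rule always_eventually, rule allI)
      fix n
      show "(\<integral>x. \<bar>fun_of (S t (h' n)) x - g x\<bar> \<partial>lborel)
        \<le> t * (\<epsilon> h' n + \<epsilon> h n) + (\<integral>x. \<bar>fun_of (S t (h n)) x - g x\<bar> \<partial>lborel)"
        using L1_triangle[OF S_L1(1)[OF t h'(1)[of n]] S_int[of n] g_int] close[of h' h n n, OF h'(1) h_int]
        by linarith
    qed
    have "(\<lambda>n. t * (\<epsilon> h' n + \<epsilon> h n) + (\<integral>x. \<bar>fun_of (S t (h n)) x - g x\<bar> \<partial>lborel)) \<longlonglongrightarrow> t * (0 + 0) + 0"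
      unfolding \<epsilon>_def by (intro tendsto_intros h_lim h' g_lim)
    then show "(\<lambda>n. t * (\<epsilon> h' n + \<epsilon> h n) + (\<integral>x. \<bar>fun_of (S t (h n)) x - g x\<bar> \<partial>lborel)) \<longlonglongrightarrow> 0"
      by simp
  qed
  define Q where "Q g \<longleftrightarrow> integrable lborel g \<and>
     (\<forall>h :: nat \<Rightarrow> 'a l2.
        (\<forall>n. integrable lborel (fun_of (h n))) \<and>
        (\<lambda>n. \<integral>x. \<bar>fun_of (h n) x - f x\<bar> \<partial>lborel) \<longlonglongrightarrow> 0 \<longrightarrow>
        (\<forall>n. integrable lborel (fun_of (S t (h n)))) \<and>
        (\<lambda>n. \<integral>x. \<bar>fun_of (S t (h n)) x - g x\<bar> \<partial>lborel) \<longlonglongrightarrow> 0)" for g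
  have "Q g"
    unfolding Q_def using g_int g_prop S_L1(1)[OF t] by blast
  then have "Q (SOME g. Q g)" by (rule someI[of Q])
  then have "Q (S_bar t f)"
    unfolding potential_upto_L1_def Q_def .
  then show "integrable lborel (S_bar t f)"
    and "\<And>h. (\<And>n. integrable lborel (fun_of (h n))) \<Longrightarrow>
      (\<lambda>n. \<integral>x. \<bar>fun_of (h n) x - f x\<bar> \<partial>lborel) \<longlonglongrightarrow> 0 \<Longrightarrow>
      (\<lambda>n. \<integral>x. \<bar>fun_of (S t (h n)) x - S_bar t f x\<bar> \<partial>lborel) \<longlonglongrightarrow> 0"
    unfolding Q_def by blast+
qed

lemma L1_nonneg_approximation:
  assumes f: "integrable lborel f" "AE x in lborel. 0 \<le> f x"
  obtains h :: "nat \<Rightarrow> 'a l2" where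
    "\<And>n. l2_nonneg (h n)" "\<And>n. integrable lborel (fun_of (h n))"
    "\<And>n. (\<integral>x. \<bar>fun_of (h n) x\<bar> \<partial>lborel) \<le> (\<integral>x. f x \<partial>lborel)"
    "(\<lambda>n. \<integral>x. \<bar>fun_of (h n) x - f x\<bar> \<partial>lborel) \<longlonglongrightarrow> 0"
proof -
  obtain h :: "nat \<Rightarrow> 'a l2" where
    h: "\<And>n. AE x in lborel. fun_of (h n) x = (if \<bar>f x\<bar> \<le> real n then f x else 0)"
    and int: "\<And>n. integrable lborel (fun_of (h n))"
    and lim: "(\<lambda>n. \<integral>x. \<bar>fun_of (h n) x - f x\<bar> \<partial>lborel) \<longlonglongrightarrow> 0"
    by (rule L1_approximation[OF f(1)]) blast
  have "l2_nonneg (h n)" for n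
    unfolding l2_nonneg_def using h[of n] f(2) by eventually_elim simp
  moreover have "(\<integral>x. \<bar>fun_of (h n) x\<bar> \<partial>lborel) \<le> (\<integral>x. f x \<partial>lborel)" for n
  proof (rule integral_mono_AE)
    show "AE x in lborel. \<bar>fun_of (h n) x\<bar> \<le> f x"
      using h[of n] f(2) by eventually_elim simp
  qed (use int f in auto)
  ultimately show ?thesis using that[OF _ int _ lim] by blast
qed

lemma S_bar_mono:
  assumes f: "integrable lborel f" "AE x in lborel. 0 \<le> f x" and st: "0 \<le> s" "s \<le> t"
  shows "AE x in lborel. S_bar s f x \<le> S_bar t f x"
proof -
  obtain h :: "nat \<Rightarrow> 'a l2" where h: "\<And>n. l2_nonneg (h n)" "\<And>n. integrable lborel (fun_of (h n))"
    "(\<lambda>n. \<integral>x. \<bar>fun_of (h n) x - f x\<bar> \<partial>lborel) \<longlonglongrightarrow> 0"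
    by (rule L1_nonneg_approximation[OF f]) blast
  have t: "0 \<le> t" using st by simp
  show ?thesis
    by (rule L1_limit_mono[OF S_L1(1)[OF st(1) h(2)] S_L1(1)[OF t h(2)] S_bar_extends_S(1)[OF st(1) f(1)]
          S_bar_extends_S(1)[OF t f(1)] S_mono[OF h(1) st] S_bar_extends_S(2)[OF st(1) f(1) h(2,3)]
          S_bar_extends_S(2)[OF t f(1) h(2,3)]])
qed

text \<open>
  The maximal inequality for \<open>f - a 1\<^sub>B\<close>, obtained from truncations of \<open>f\<close>. Along a subsequence
  the potentials of the truncations up to the times \<open>1, \<dots>, N\<close> converge almost everywhere, so that
  Fatou's lemma applies to the indicators of the exceedance sets.
\<close>

lemma maximal_inequality_L1:
  assumes f: "integrable lborel f" "AE x in lborel. 0 \<le> f x" and a: "0 < a"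
    and B: "B \<in> sets borel" "emeasure lborel B < \<infinity>"
  shows "(\<integral>\<^sup>+x. ennreal (fun_of (S 1 (l2_indicator B)) x) *
      indicator {x. \<exists>k\<in>{1..N}. a * fun_of (S (real k) (l2_indicator B)) x < S_bar (real k) f x} x \<partial>lborel)
    \<le> ennreal ((\<integral>x. f x \<partial>lborel) / a)"
proof -
  let ?b = "l2_indicator B"
  obtain h :: "nat \<Rightarrow> 'a l2" where h: "\<And>n. l2_nonneg (h n)" "\<And>n. integrable lborel (fun_of (h n))"
    "\<And>n. (\<integral>x. \<bar>fun_of (h n) x\<bar> \<partial>lborel) \<le> (\<integral>x. f x \<partial>lborel)"
    "(\<lambda>n. \<integral>x. \<bar>fun_of (h n) x - f x\<bar> \<partial>lborel) \<longlonglongrightarrow> 0"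
    by (rule L1_nonneg_approximation[OF f]) blast
  have b_int: "integrable lborel (fun_of ?b)"
    using fun_of_l2_indicator[OF B] B by (subst integrable_cong_AE[of _ _ "indicator B"]) (auto simp: integrable_indicator_iff)
  have S1_meas [measurable]: "S_bar (real k) f \<in> borel_measurable borel" for k
    using S_bar_extends_S(1)[OF _ f(1), of "real k"] by auto
  define u where "u n = h n - a *\<^sub>R ?b" for n
  have u_int: "integrable lborel (fun_of (u n))" for n
  proof (subst integrable_cong_AE[of _ _ "\<lambda>x. fun_of (h n) x - a * fun_of ?b x"])
    show "AE x in lborel. fun_of (u n) x = fun_of (h n) x - a * fun_of ?b x"
      unfolding u_def using fun_of_diff[of "h n" "a *\<^sub>R ?b"] fun_of_scaleR[of a ?b] by eventually_elim simp
  qed (use h(2) b_int in auto)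
  have S_u: "AE x in lborel. fun_of (S t (u n)) x = fun_of (S t (h n)) x - a * fun_of (S t ?b) x" for t n
  proof -
    have "S t (u n) = S t (h n) - a *\<^sub>R S t ?b"
      unfolding u_def by (simp add: linear_diff[OF linear_S] linear_scale[OF linear_S])
    then show ?thesis
      using fun_of_diff[of "S t (h n)" "a *\<^sub>R S t ?b"] fun_of_scaleR[of a "S t ?b"]
      by (auto elim: eventually_elim2)
  qed
  define A where "A n = {x. \<exists>k\<in>{1..N}. 0 < fun_of (S (real k) (u n)) x}" for n
  have A_meas [measurable]: "A n \<in> sets borel" for n
    unfolding A_def by measurable
  have s1_nonneg: "AE x in lborel. 0 \<le> fun_of (S 1 ?b) x"
    using S_nonneg[OF l2_indicator_nonneg[OF B], of 1] by (simp add: l2_nonneg_def)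
  have s1_int: "integrable lborel (\<lambda>x. fun_of (S 1 ?b) x * indicator (A n) x)"
    and h1_int: "integrable lborel (\<lambda>x. fun_of (S 1 (h n)) x * indicator (A n) x)" for n
    using S_L1(1)[OF _ b_int, of 1] S_L1(1)[OF _ h(2), of 1] by (auto intro!: integrable_real_mult_indicator)
  have An: "(\<integral>\<^sup>+x. ennreal (fun_of (S 1 ?b) x) * indicator (A n) x \<partial>lborel) \<le> ennreal ((\<integral>x. f x \<partial>lborel) / a)" for n
  proof -
    have "0 \<le> (\<integral>x. fun_of (S 1 (u n)) x * indicator (A n) x \<partial>lborel)"
      unfolding A_def by (rule maximal_inequality[OF u_int])
    also have "\<dots> = (\<integral>x. fun_of (S 1 (h n)) x * indicator (A n) x - a * (fun_of (S 1 ?b) x * indicator (A n) x) \<partial>lborel)"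
    proof (rule integral_cong_AE)
      show "AE x in lborel. fun_of (S 1 (u n)) x * indicator (A n) x
          = fun_of (S 1 (h n)) x * indicator (A n) x - a * (fun_of (S 1 ?b) x * indicator (A n) x)"
        using S_u[of 1 n] by eventually_elim (simp add: left_diff_distrib mult.assoc)
    qed measurable
    also have "\<dots> = (\<integral>x. fun_of (S 1 (h n)) x * indicator (A n) x \<partial>lborel) - a * (\<integral>x. fun_of (S 1 ?b) x * indicator (A n) x \<partial>lborel)"
      using s1_int[of n] h1_int[of n] by simp
    finally have "a * (\<integral>x. fun_of (S 1 ?b) x * indicator (A n) x \<partial>lborel) \<le> (\<integral>x. fun_of (S 1 (h n)) x * indicator (A n) x \<partial>lborel)"
      by simp
    also have "\<dots> \<le> (\<integral>x. \<bar>fun_of (S 1 (h n)) x\<bar> \<partial>lborel)"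
      using h1_int[of n] S_L1(1)[OF _ h(2), of 1 n] by (intro integral_mono) (auto simp: indicator_def)
    also have "\<dots> \<le> (\<integral>x. \<bar>fun_of (h n) x\<bar> \<partial>lborel)"
      using S_L1(2)[OF _ h(2), of 1 n] by simp
    also have "\<dots> \<le> (\<integral>x. f x \<partial>lborel)" by (rule h(3))
    finally have le: "(\<integral>x. fun_of (S 1 ?b) x * indicator (A n) x \<partial>lborel) \<le> (\<integral>x. f x \<partial>lborel) / a"
      using a by (simp add: field_simps)
    have "(\<integral>\<^sup>+x. ennreal (fun_of (S 1 ?b) x) * indicator (A n) x \<partial>lborel)
        = (\<integral>\<^sup>+x. ennreal (fun_of (S 1 ?b) x * indicator (A n) x) \<partial>lborel)"
      by (intro nn_integral_cong) (auto simp: indicator_def)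
    also have "\<dots> = ennreal (\<integral>x. fun_of (S 1 ?b) x * indicator (A n) x \<partial>lborel)"
    proof (rule nn_integral_eq_integral[OF s1_int])
      show "AE x in lborel. 0 \<le> fun_of (S 1 ?b) x * indicator (A n) x"
        using s1_nonneg by eventually_elim simp
    qed
    finally show ?thesis using le by (simp add: ennreal_leI)
  qed
  define v where "v n x = (\<Sum>k\<in>{1..N}. \<bar>fun_of (S (real k) (h n)) x - S_bar (real k) f x\<bar>)" for n x
  have v_int: "integrable lborel (v n)" for n
    unfolding v_def using S_L1(1)[OF _ h(2)] S_bar_extends_S(1)[OF _ f(1)] by auto
  have "(\<integral>x. norm (v n x) \<partial>lborel) = (\<Sum>k\<in>{1..N}. \<integral>x. \<bar>fun_of (S (real k) (h n)) x - S_bar (real k) f x\<bar> \<partial>lborel)" for n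
    unfolding v_def using S_L1(1)[OF _ h(2)] S_bar_extends_S(1)[OF _ f(1)]
    by (subst Bochner_Integration.integral_sum[symmetric]) (auto simp: sum_nonneg)
  moreover have "(\<lambda>n. \<Sum>k\<in>{1..N}. \<integral>x. \<bar>fun_of (S (real k) (h n)) x - S_bar (real k) f x\<bar> \<partial>lborel) \<longlonglongrightarrow> (\<Sum>k\<in>{1..N}. 0)"
    by (intro tendsto_sum S_bar_extends_S(2)[OF _ f(1) h(2,4)]) simp
  ultimately have "(\<lambda>n. \<integral>x. norm (v n x) \<partial>lborel) \<longlonglongrightarrow> 0" by simp
  then obtain r where r: "strict_mono (r :: nat \<Rightarrow> nat)" "AE x in lborel. (\<lambda>n. v (r n) x) \<longlonglongrightarrow> 0"
    using tendsto_L1_AE_subseq[of lborel v, OF v_int] by blast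
  have S_u': "AE x in lborel. \<forall>k n. fun_of (S (real k) (u n)) x = fun_of (S (real k) (h n)) x - a * fun_of (S (real k) ?b) x"
    by (simp add: AE_all_countable S_u)
  let ?E = "{x. \<exists>k\<in>{1..N}. a * fun_of (S (real k) ?b) x < S_bar (real k) f x}"
  have "(\<integral>\<^sup>+x. ennreal (fun_of (S 1 ?b) x) * indicator ?E x \<partial>lborel)
      \<le> (\<integral>\<^sup>+x. liminf (\<lambda>n. ennreal (fun_of (S 1 ?b) x) * indicator (A (r n)) x) \<partial>lborel)"
  proof (rule nn_integral_mono_AE, use r(2) S_u' in eventually_elim)
    fix x
    assume v: "(\<lambda>n. v (r n) x) \<longlonglongrightarrow> 0"
      and eq: "\<forall>k n. fun_of (S (real k) (u n)) x = fun_of (S (real k) (h n)) x - a * fun_of (S (real k) ?b) x"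
    show "ennreal (fun_of (S 1 ?b) x) * indicator ?E x
        \<le> liminf (\<lambda>n. ennreal (fun_of (S 1 ?b) x) * indicator (A (r n)) x)"
    proof (cases "x \<in> ?E")
      case True
      then obtain k where k: "k \<in> {1..N}" "a * fun_of (S (real k) ?b) x < S_bar (real k) f x" by blast
      have "\<forall>\<^sub>F n in sequentially. v (r n) x < S_bar (real k) f x - a * fun_of (S (real k) ?b) x"
        using v by (rule order_tendstoD) (use k in simp)
      then have "\<forall>\<^sub>F n in sequentially. x \<in> A (r n)"
      proof eventually_elim
        fix n assume *: "v (r n) x < S_bar (real k) f x - a * fun_of (S (real k) ?b) x"
        have "\<bar>fun_of (S (real k) (h (r n))) x - S_bar (real k) f x\<bar> \<le> v (r n) x"
          unfolding v_def using k(1) by (intro member_le_sum) auto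
        with * have "0 < fun_of (S (real k) (u (r n))) x" unfolding eq[rule_format] by linarith
        then show "x \<in> A (r n)" unfolding A_def using k(1) by blast
      qed
      then have "ennreal (fun_of (S 1 ?b) x) \<le> liminf (\<lambda>n. ennreal (fun_of (S 1 ?b) x) * indicator (A (r n)) x)"
        by (intro Liminf_bounded) (auto elim: eventually_mono)
      then show ?thesis using True by simp
    qed simp
  qed
  also have "\<dots> \<le> liminf (\<lambda>n. \<integral>\<^sup>+x. ennreal (fun_of (S 1 ?b) x) * indicator (A (r n)) x \<partial>lborel)"
    by (rule nn_integral_liminf) measurable
  also have "\<dots> \<le> liminf (\<lambda>n::nat. ennreal ((\<integral>x. f x \<partial>lborel) / a))"
    by (rule Liminf_mono) (auto intro!: always_eventually An)
  finally show ?thesis by (simp add: Liminf_const)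
qed

text \<open>
  Where the potential of \<open>1\<^sub>B\<close> is finite and that of \<open>f\<close> is not, the latter exceeds the former \<open>a\<close>
  times at some time, for every \<open>a\<close>. With respect to the density \<open>S 1 1\<^sub>B\<close>, the maximal inequality
  bounds the mass of such points by \<open>\<integral>f / a\<close>, so they form a null set for this density, which is
  positive on \<open>B\<close>. Elsewhere in \<open>B\<close> the potentials \<open>S_bar N f\<close> increase to a finite limit, so that
  the limit in the definition of \<open>green\<close> exists.
\<close>

lemma green_finite_on:
  assumes f: "integrable lborel f" "AE x in lborel. 0 \<le> f x"
    and B: "B \<in> sets borel" "emeasure lborel B < \<infinity>"
    and bound: "\<And>N::nat. inner (S (real N) (l2_indicator B)) (l2_indicator B) \<le> C"
  shows "AE x in lborel. x \<in> B \<longrightarrow> green T f x < \<infinity>"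
proof -
  let ?b = "l2_indicator B"
  define s where "s k x = fun_of (S (real k) ?b) x" for k x
  define p where "p k x = S_bar (real k) f x" for k x
  have [measurable]: "s k \<in> borel_measurable borel" for k
    unfolding s_def by measurable
  have [measurable]: "p k \<in> borel_measurable borel" for k
    unfolding p_def using S_bar_extends_S(1)[OF _ f(1), of "real k"] by auto
  note b_nonneg = l2_indicator_nonneg[OF B]
  have s_nonneg: "AE x in lborel. 0 \<le> s k x" for k
    using S_nonneg[OF b_nonneg, of "real k"] by (simp add: l2_nonneg_def s_def)
  have s_mono: "AE x in lborel. \<forall>k. s k x \<le> s (Suc k) x"
    unfolding s_def by (simp add: AE_all_countable S_mono[OF b_nonneg])
  have p_mono: "AE x in lborel. \<forall>k. p k x \<le> p (Suc k) x"
    unfolding p_def by (simp add: AE_all_countable S_bar_mono[OF f])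
  have s_bounded: "AE x in lborel. x \<in> B \<longrightarrow> (\<exists>c. \<forall>k. s k x \<le> c)"
  proof -
    have "(\<integral>\<^sup>+x. (SUP k. ennreal (s k x) * indicator B x) \<partial>lborel) = (SUP k. \<integral>\<^sup>+x. ennreal (s k x) * indicator B x \<partial>lborel)"
    proof (rule nn_integral_monotone_convergence_SUP_AE)
      show "AE x in lborel. ennreal (s k x) * indicator B x \<le> ennreal (s (Suc k) x) * indicator B x" for k
        using s_mono by eventually_elim (auto intro!: mult_right_mono ennreal_leI)
    qed (use B in measurable)
    also have "\<dots> \<le> ennreal C"
    proof (rule SUP_least)
      fix k
      have "(\<integral>\<^sup>+x. ennreal (s k x) * indicator B x \<partial>lborel) = (\<integral>\<^sup>+x. ennreal (s k x * indicator B x) \<partial>lborel)"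
        by (intro nn_integral_cong) (auto simp: indicator_def)
      also have "\<dots> = ennreal (\<integral>x. s k x * indicator B x \<partial>lborel)"
      proof (rule nn_integral_eq_integral)
        show "integrable lborel (\<lambda>x. s k x * indicator B x)"
          unfolding s_def by (rule integrable_fun_of_indicator[OF B])
        show "AE x in lborel. 0 \<le> s k x * indicator B x"
          using s_nonneg[of k] by eventually_elim simp
      qed
      also have "\<dots> \<le> ennreal C"
        using bound[of k] unfolding inner_l2_indicator[OF B] s_def by (rule ennreal_leI)
      finally show "(\<integral>\<^sup>+x. ennreal (s k x) * indicator B x \<partial>lborel) \<le> ennreal C" .
    qed
    finally have "(\<integral>\<^sup>+x. (SUP k. ennreal (s k x) * indicator B x) \<partial>lborel) \<noteq> \<infinity>"
      using ennreal_less_top[of C] by (auto simp: top_unique)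
    then have "AE x in lborel. (SUP k. ennreal (s k x) * indicator B x) \<noteq> \<infinity>"
      using B by (intro nn_integral_PInf_AE) auto
    then show ?thesis
    proof eventually_elim
      fix x assume *: "(SUP k. ennreal (s k x) * indicator B x) \<noteq> \<infinity>"
      show "x \<in> B \<longrightarrow> (\<exists>c. \<forall>k. s k x \<le> c)"
      proof
        assume x: "x \<in> B"
        obtain c where c: "0 \<le> c" "(SUP k. ennreal (s k x) * indicator B x) = ennreal c"
          using * by (cases "SUP k. ennreal (s k x) * indicator B x") auto
        have "ennreal (s k x) \<le> ennreal c" for k
          using SUP_upper[of k UNIV "\<lambda>k. ennreal (s k x) * indicator B x"] c x by simp
        then have "s k x \<le> c" for k using c(1) by simp
        then show "\<exists>c. \<forall>k. s k x \<le> c" by blast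
      qed
    qed
  qed
  define E where "E a = {x. \<exists>k\<ge>1. a * s k x < p k x}" for a :: real
  have E_meas [measurable]: "E a \<in> sets borel" for a unfolding E_def by measurable
  have E: "(\<integral>\<^sup>+x. ennreal (s 1 x) * indicator (E a) x \<partial>lborel) \<le> ennreal ((\<integral>x. f x \<partial>lborel) / a)" if a: "0 < a" for a
  proof -
    define EN where "EN N = {x. \<exists>k\<in>{1..N}. a * s k x < p k x}" for N
    have [measurable]: "EN N \<in> sets borel" for N unfolding EN_def by measurable
    have "(\<integral>\<^sup>+x. ennreal (s 1 x) * indicator (E a) x \<partial>lborel)
        = (\<integral>\<^sup>+x. (SUP N. ennreal (s 1 x) * indicator (EN N) x) \<partial>lborel)"
    proof (rule nn_integral_cong)
      fix x
      show "ennreal (s 1 x) * indicator (E a) x = (SUP N. ennreal (s 1 x) * indicator (EN N) x)"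
      proof (cases "x \<in> E a")
        case True
        then obtain k where "1 \<le> k" "a * s k x < p k x" by (auto simp: E_def)
        then have "x \<in> EN k" by (auto simp: EN_def)
        with True show ?thesis
          by (intro antisym SUP_upper2[of k] SUP_least) (auto simp: indicator_def)
      next
        case False
        then have "x \<notin> EN N" for N by (auto simp: E_def EN_def)
        with False show ?thesis by simp
      qed
    qed
    also have "\<dots> = (SUP N. \<integral>\<^sup>+x. ennreal (s 1 x) * indicator (EN N) x \<partial>lborel)"
    proof (rule nn_integral_monotone_convergence_SUP)
      show "incseq (\<lambda>N x. ennreal (s 1 x) * indicator (EN N) x)"
      proof (rule incseq_SucI, rule le_funI)
        fix N x
        have "EN N \<subseteq> EN (Suc N)" by (fastforce simp: EN_def)
        then show "ennreal (s 1 x) * indicator (EN N) x \<le> ennreal (s 1 x) * indicator (EN (Suc N)) x"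
          by (auto simp: indicator_def)
      qed
    qed measurable
    also have "\<dots> \<le> ennreal ((\<integral>x. f x \<partial>lborel) / a)"
      using maximal_inequality_L1[OF f a B] unfolding EN_def s_def p_def by (intro SUP_least) simp
    finally show ?thesis .
  qed
  define D where "D = (\<Inter>n::nat. E (real (Suc n)))"
  have D_meas [measurable]: "D \<in> sets borel" unfolding D_def by measurable
  have "(\<integral>\<^sup>+x. ennreal (s 1 x) * indicator D x \<partial>lborel) \<le> ennreal ((\<integral>x. f x \<partial>lborel) / real (Suc n))" for n
  proof -
    have "(\<integral>\<^sup>+x. ennreal (s 1 x) * indicator D x \<partial>lborel) \<le> (\<integral>\<^sup>+x. ennreal (s 1 x) * indicator (E (real (Suc n))) x \<partial>lborel)"
      by (intro nn_integral_mono mult_left_mono) (auto simp: D_def indicator_def)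
    also have "\<dots> \<le> ennreal ((\<integral>x. f x \<partial>lborel) / real (Suc n))" by (rule E) simp
    finally show ?thesis .
  qed
  moreover have "(\<lambda>n. ennreal ((\<integral>x. f x \<partial>lborel) / real (Suc n))) \<longlonglongrightarrow> ennreal 0"
    by (intro tendsto_ennrealI LIMSEQ_Suc[OF lim_const_over_n])
  ultimately have "(\<integral>\<^sup>+x. ennreal (s 1 x) * indicator D x \<partial>lborel) \<le> ennreal 0"
    by (intro LIMSEQ_le_const) auto
  then have "(\<integral>\<^sup>+x. ennreal (s 1 x) * indicator D x \<partial>lborel) = 0" by simp
  then have D0: "AE x in lborel. ennreal (s 1 x) * indicator D x = 0"
    by (subst (asm) nn_integral_0_iff_AE) auto
  have pos: "AE x in lborel. x \<in> B \<longrightarrow> 0 < s 1 x"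
    using S_indicator_pos[OF _ B, of 1] by (simp add: s_def)
  show ?thesis
    using D0 pos s_bounded s_mono p_mono
  proof eventually_elim
    fix x assume D0: "ennreal (s 1 x) * indicator D x = 0" and pos: "x \<in> B \<longrightarrow> 0 < s 1 x"
      and sb: "x \<in> B \<longrightarrow> (\<exists>c. \<forall>k. s k x \<le> c)"
      and p: "\<forall>k. p k x \<le> p (Suc k) x"
    show "x \<in> B \<longrightarrow> green T f x < \<infinity>"
    proof
      assume x: "x \<in> B"
      with D0 pos have "x \<notin> D" by (auto simp: indicator_def)
      then obtain n where n: "x \<notin> E (real (Suc n))" by (auto simp: D_def)
      obtain c where c: "\<And>k. s k x \<le> c" using sb x by blast
      have "p (Suc k) x \<le> real (Suc n) * c" for k
      proof -
        have "p (Suc k) x \<le> real (Suc n) * s (Suc k) x"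
          using n unfolding E_def by (auto simp: not_less)
        also have "\<dots> \<le> real (Suc n) * c" using c by (intro mult_left_mono) auto
        finally show ?thesis .
      qed
      then have ub: "p k x \<le> real (Suc n) * c" for k
        \<comment> \<open>The case \<open>k = 0\<close> lies outside the range of times in \<open>E\<close>; it is covered by monotonicity.\<close>
        using p[rule_format, of k] order_trans by blast
      have "incseq (\<lambda>k. p k x)" using p by (intro incseq_SucI) auto
      then obtain L where "(\<lambda>k. p k x) \<longlonglongrightarrow> L"
        by (rule incseq_convergent[of _ "real (Suc n) * c"]) (use ub in blast)+
      then have "(\<lambda>k. ereal (p k x)) \<longlonglongrightarrow> ereal L" by simp
      then have "lim (\<lambda>k. ereal (p k x)) = ereal L" by (rule limI)
      then show "green T f x < \<infinity>" by (simp add: green_def p_def)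
    qed
  qed
qed

end

text \<open>
  Let \<open>B\<close> be a ball and \<open>u = S N 1\<^sub>B\<close>. The Poisson equation gives
  \<open>E u u = \<langle>1\<^sub>B - P N 1\<^sub>B, u\<rangle> \<le> \<langle>1\<^sub>B, u\<rangle>\<close>, and \<open>\<langle>1\<^sub>B, u\<rangle> = \<integral>\<^sub>B u \<le> C sqrt (E u u)\<close> by hypothesis. Hence
  \<open>\<langle>1\<^sub>B, u\<rangle> \<le> C\<^sup>2\<close> for all \<open>N\<close>, which is the bound that the maximal inequality needs.
\<close>

lemma transient_if_locally_dominated:
  fixes E :: "'a::euclidean_space l2 \<Rightarrow> 'a l2 \<Rightarrow> real"
  assumes dom: "\<And>n::nat. \<exists>C\<ge>0. \<forall>u\<in>F. (\<integral>x. \<bar>fun_of u x\<bar> * indicator (ball 0 (real n)) x \<partial>lborel) \<le> C * sqrt (E u u)"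
  shows "transient E F"
  unfolding transient_def
proof (intro allI impI)
  fix T :: "real \<Rightarrow> 'a l2 \<Rightarrow> 'a l2" and f :: "'a \<Rightarrow> real"
  assume T: "associated_semigroup E F T" and f: "integrable lborel f \<and> (AE x in lborel. 0 \<le> f x)"
  interpret l2_markov_semigroup T
    using T by unfold_locales (simp add: associated_semigroup_def)
  have gen: "S t u \<in> F \<and> E (S t u) (S t u) = inner (u - P t u) (S t u)" if "0 \<le> t" for t u
    using S_in_generator[OF that, of u] T
    by (auto simp: associated_semigroup_def form_generator_def inner_diff_left)
  have "AE x in lborel. x \<in> ball 0 (real n) \<longrightarrow> green T f x < \<infinity>" for n :: nat
  proof -
    let ?B = "ball (0::'a) (real n)"
    let ?b = "l2_indicator ?B"
    have B: "?B \<in> sets borel" "emeasure lborel ?B < \<infinity>"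
      using emeasure_lborel_ball_finite by auto
    obtain C where C0: "0 \<le> C" and C: "\<And>u. u \<in> F \<Longrightarrow> (\<integral>x. \<bar>fun_of u x\<bar> * indicator ?B x \<partial>lborel) \<le> C * sqrt (E u u)"
      using dom[of n] by blast
    have "inner (S (real N) ?b) ?b \<le> C\<^sup>2" for N
    proof -
      define y where "y = inner (S (real N) ?b) ?b"
      have y0: "0 \<le> y"
        unfolding y_def by (intro inner_nonneg S_nonneg l2_indicator_nonneg B)
      have "E (S (real N) ?b) (S (real N) ?b) = inner (?b - P (real N) ?b) (S (real N) ?b)"
        using gen[of "real N" ?b] by simp
      also have "\<dots> = y - inner (P (real N) ?b) (S (real N) ?b)"
        by (simp add: y_def inner_diff_left inner_commute[of ?b])
      also have "\<dots> \<le> y"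
        by (simp add: inner_nonneg P_nonneg S_nonneg l2_indicator_nonneg[OF B])
      finally have Ey: "E (S (real N) ?b) (S (real N) ?b) \<le> y" .
      have "y = (\<integral>x. fun_of (S (real N) ?b) x * indicator ?B x \<partial>lborel)"
        unfolding y_def by (rule inner_l2_indicator[OF B])
      also have "\<dots> \<le> (\<integral>x. \<bar>fun_of (S (real N) ?b) x\<bar> * indicator ?B x \<partial>lborel)"
      proof (rule integral_mono)
        show i: "integrable lborel (\<lambda>x. fun_of (S (real N) ?b) x * indicator ?B x)"
          by (rule integrable_fun_of_indicator[OF B])
        from integrable_abs[OF i] show "integrable lborel (\<lambda>x. \<bar>fun_of (S (real N) ?b) x\<bar> * indicator ?B x)"
          by (simp add: abs_mult)
      qed (auto simp: indicator_def)
      also have "\<dots> \<le> C * sqrt (E (S (real N) ?b) (S (real N) ?b))"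
        using gen[of "real N" ?b] by (intro C) simp

      also have "\<dots> \<le> C * sqrt y"
        using Ey C0 by (intro mult_left_mono) auto
      finally have *: "sqrt y * sqrt y \<le> C * sqrt y" using y0 by simp
      show "y \<le> C\<^sup>2"
      proof (cases "y = 0")
        case False
        with y0 have "0 < sqrt y" by simp
        with * have "sqrt y \<le> C" by (rule mult_right_le_imp_le)
        with y0 have "(sqrt y)\<^sup>2 \<le> C\<^sup>2" by (intro power_mono) auto
        with y0 show ?thesis by simp
      qed simp
    qed
    then show ?thesis using f B by (intro green_finite_on[of f ?B "C\<^sup>2"]) auto
  qed
  then have "AE x in lborel. \<forall>n::nat. x \<in> ball 0 (real n) \<longrightarrow> green T f x < \<infinity>"
    by (subst AE_all_countable) blast
  then show "AE x in lborel. green T f x < \<infinity>"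
  proof eventually_elim
    fix x assume *: "\<forall>n::nat. x \<in> ball 0 (real n) \<longrightarrow> green T f x < \<infinity>"
    obtain n :: nat where "norm x < real n" using reals_Archimedean2 by blast
    with * show "green T f x < \<infinity>" by (metis mem_ball_0)
  qed
qed


section \<open>The energy of the big jump form\<close>

lemma borel_measurable_lebesgue_AE_cong:
  fixes f g :: "'a::euclidean_space \<Rightarrow> ennreal"
  assumes g [measurable]: "g \<in> borel_measurable lebesgue" and eq: "AE x in lborel. f x = g x"
  shows "f \<in> borel_measurable lebesgue"
proof (rule measurableI)
  fix A :: "ennreal set" assume [measurable]: "A \<in> sets borel"
  have [measurable]: "Measurable.pred lebesgue (\<lambda>x. f x \<noteq> g x)"
    using eq by (intro sets_completion_AE) simp
  have [measurable]: "Measurable.pred lebesgue (\<lambda>x. f x \<noteq> g x \<and> f x \<in> A)"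
    using eq by (intro sets_completion_AE) (auto elim: eventually_mono)
  have "{x \<in> space lebesgue. (f x \<noteq> g x \<and> f x \<in> A) \<or> (\<not> f x \<noteq> g x \<and> g x \<in> A)} \<in> sets lebesgue"
    by measurable
  also have "{x \<in> space lebesgue. (f x \<noteq> g x \<and> f x \<in> A) \<or> (\<not> f x \<noteq> g x \<and> g x \<in> A)} = f -` A \<inter> space lebesgue"
    by auto
  finally show "f -` A \<inter> space lebesgue \<in> sets lebesgue" .
qed simp

lemma locally_integrable_AE_finite:
  fixes f :: "'a::euclidean_space \<Rightarrow> ennreal"
  assumes "locally_integrable f"
  shows "AE x in lborel. f x < \<infinity>"
proof -
  have [measurable]: "f \<in> borel_measurable lebesgue"
    using assms by (simp add: locally_integrable_def)
  have "AE x in lebesgue. f x * indicator (cball 0 (real n)) x \<noteq> \<infinity>" for n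
  proof (rule nn_integral_PInf_AE)
    have "(\<integral>\<^sup>+x. f x * indicator (cball 0 (real n)) x \<partial>lebesgue) < \<infinity>"
      using assms compact_cball[of "0::'a" "real n"] unfolding locally_integrable_def by blast
    then show "(\<integral>\<^sup>+x. f x * indicator (cball 0 (real n)) x \<partial>lebesgue) \<noteq> \<infinity>"
      by simp
    have [measurable]: "cball (0::'a) (real n) \<in> sets lebesgue" by simp
    show "(\<lambda>x. f x * indicator (cball 0 (real n)) x) \<in> borel_measurable lebesgue"
      by measurable
  qed
  then have "AE x in lebesgue. \<forall>n. f x * indicator (cball 0 (real n)) x \<noteq> \<infinity>"
    by (subst AE_all_countable) blast
  then have "AE x in lborel. \<forall>n. f x * indicator (cball 0 (real n)) x \<noteq> \<infinity>"
    unfolding AE_completion_iff .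
  then show ?thesis
  proof eventually_elim
    fix x :: 'a assume *: "\<forall>n. f x * indicator (cball 0 (real n)) x \<noteq> \<infinity>"
    obtain n :: nat where "norm x < real n" using reals_Archimedean2 by blast
    with *[rule_format, of n] show "f x < \<infinity>" by (simp add: less_top)
  qed
qed

lemma borel_measurable_jump_coeff:
  fixes a1 a2 :: "'a::euclidean_space \<Rightarrow> real"
  assumes [measurable]: "a1 \<in> borel_measurable borel" "a2 \<in> borel_measurable borel"
  shows "(\<lambda>(x, y). jump_coeff a1 a2 x y) \<in> borel_measurable (borel \<Otimes>\<^sub>M borel)"
  unfolding jump_coeff_def indicator_def by measurable

lemma nn_integral_jump_kernel:
  fixes a1 a2 :: "'a::euclidean_space \<Rightarrow> real"
  assumes [measurable]: "a1 \<in> borel_measurable borel" "a2 \<in> borel_measurable borel"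
    and J0: "nonneg_kernel J0" and h [measurable]: "h \<in> borel_measurable borel"
  shows "(\<integral>\<^sup>+y. h y \<partial>jump_kernel a1 a2 J0 x) = (\<integral>\<^sup>+y. ennreal (jump_coeff a1 a2 x y) * h y \<partial>J0 x)"
    and "(\<integral>\<^sup>+y. h y \<partial>big_jumps (jump_kernel a1 a2 J0) x)
      = (\<integral>\<^sup>+y. ennreal (jump_coeff a1 a2 x y) * (indicator {y. norm (x - y) \<ge> 1} y * h y) \<partial>J0 x)"
proof -
  have s [measurable_cong]: "sets (J0 x) = sets borel"
    using J0 by (simp add: nonneg_kernel_def)
  have [measurable]: "(\<lambda>y. jump_coeff a1 a2 x y) \<in> borel_measurable borel"
    using measurable_compose[OF measurable_Pair1' borel_measurable_jump_coeff[OF assms(1,2)], of x] by simp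
  have i [measurable]: "(indicator {y. norm (x - y) \<ge> 1} :: 'a \<Rightarrow> ennreal) \<in> borel_measurable borel"
    by measurable
  show "(\<integral>\<^sup>+y. h y \<partial>jump_kernel a1 a2 J0 x) = (\<integral>\<^sup>+y. ennreal (jump_coeff a1 a2 x y) * h y \<partial>J0 x)"
    unfolding jump_kernel_def by (rule nn_integral_density) measurable
  show "(\<integral>\<^sup>+y. h y \<partial>big_jumps (jump_kernel a1 a2 J0) x)
      = (\<integral>\<^sup>+y. ennreal (jump_coeff a1 a2 x y) * (indicator {y. norm (x - y) \<ge> 1} y * h y) \<partial>J0 x)"
    unfolding big_jumps_def jump_kernel_def
    by (subst nn_integral_density, measurable, subst nn_integral_density, measurable)
qed

text \<open>
  Away from the diagonal the coefficient is at least \<open>min (a1 x) (a2 x) > 0\<close>, so the integrability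
  of \<open>J\<close> controls \<open>J0\<close>. The threshold is below 1 to leave room for replacing \<open>x\<close> by a nearby point.
\<close>

lemma AE_far_mass_finite:
  fixes a1 a2 :: "'a::euclidean_space \<Rightarrow> real"
  assumes meas: "a1 \<in> borel_measurable borel" "a2 \<in> borel_measurable borel"
    and pos: "\<And>x. 0 < a1 x" "\<And>x. 0 < a2 x"
    and J0: "nonneg_kernel J0"
    and int: "locally_integrable (\<lambda>x. \<integral>\<^sup>+y. ennreal (min 1 ((norm (x - y))\<^sup>2)) \<partial>jump_kernel a1 a2 J0 x)"
  shows "AE x in lborel. emeasure (J0 x) {y. 5/8 < norm (x - y)} < \<infinity>"
  using locally_integrable_AE_finite[OF int]
proof eventually_elim
  fix x assume fin: "(\<integral>\<^sup>+y. ennreal (min 1 ((norm (x - y))\<^sup>2)) \<partial>jump_kernel a1 a2 J0 x) < \<infinity>"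
  define \<kappa> where "\<kappa> = min (a1 x) (a2 x) * (25/64)"
  have \<kappa>: "0 < \<kappa>" using pos by (simp add: \<kappa>_def)
  have s [measurable_cong]: "sets (J0 x) = sets borel"
    using J0 by (simp add: nonneg_kernel_def)
  have U: "{y. 5/8 < norm (x - y)} \<in> sets borel" by measurable
  have "ennreal \<kappa> * emeasure (J0 x) {y. 5/8 < norm (x - y)}
      = (\<integral>\<^sup>+y. ennreal \<kappa> * indicator {y. 5/8 < norm (x - y)} y \<partial>J0 x)"
    using U s by (simp add: nn_integral_cmult_indicator)
  also have "\<dots> \<le> (\<integral>\<^sup>+y. ennreal (jump_coeff a1 a2 x y) * ennreal (min 1 ((norm (x - y))\<^sup>2)) \<partial>J0 x)"
  proof (rule nn_integral_mono)
    fix y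
    show "ennreal \<kappa> * indicator {y. 5/8 < norm (x - y)} y
      \<le> ennreal (jump_coeff a1 a2 x y) * ennreal (min 1 ((norm (x - y))\<^sup>2))"
    proof (cases "5/8 < norm (x - y)")
      case True
      have "(5/8)\<^sup>2 \<le> (norm (x - y))\<^sup>2" using True by (intro power_mono) auto
      then have n: "25/64 \<le> min 1 ((norm (x - y))\<^sup>2)" by (simp add: power2_eq_square)
      have c: "min (a1 x) (a2 x) \<le> jump_coeff a1 a2 x y"
        using pos[of x] pos[of y] by (auto simp: jump_coeff_def indicator_def)
      have "\<kappa> \<le> jump_coeff a1 a2 x y * min 1 ((norm (x - y))\<^sup>2)"
        unfolding \<kappa>_def using n c pos(1,2)[of x] by (intro mult_mono) (auto simp: min_def split: if_splits)
      moreover have "0 \<le> jump_coeff a1 a2 x y"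
        using c pos(1,2)[of x] by linarith
      ultimately show ?thesis using True by (simp add: ennreal_mult'[symmetric] ennreal_leI)
    qed simp
  qed
  also have "\<dots> = (\<integral>\<^sup>+y. ennreal (min 1 ((norm (x - y))\<^sup>2)) \<partial>jump_kernel a1 a2 J0 x)"
    by (rule nn_integral_jump_kernel(1)[OF meas J0, symmetric]) measurable
  finally have "ennreal \<kappa> * emeasure (J0 x) {y. 5/8 < norm (x - y)} < \<infinity>" using fin by simp
  then show "emeasure (J0 x) {y. 5/8 < norm (x - y)} < \<infinity>"
    using \<kappa> by (auto simp: ennreal_mult_less_top less_top)
qed

text \<open>
  For a kernel without finiteness assumptions, \<open>x \<mapsto> \<integral>g(x,y) K(x,dy)\<close> can fail to be
  measurable. Dividing by the mass of \<open>U\<close> gives a subprobability kernel, for which it is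
  measurable. The conventions \<open>1/\<infinity> = 0\<close> and \<open>0 * \<infinity> = 0\<close> make this correct for all masses, the
  normalized kernel being 0 where the mass of \<open>U\<close> is 0 or infinite.
\<close>

lemma borel_measurable_nn_integral_kernel_normalized:
  fixes K :: "'a::euclidean_space \<Rightarrow> 'a measure"
  assumes K: "nonneg_kernel K" and U [measurable]: "U \<in> sets borel"
    and g [measurable]: "(\<lambda>(x, y). g x y) \<in> borel_measurable (borel \<Otimes>\<^sub>M borel)"
  shows "(\<lambda>x. emeasure (K x) U * (\<integral>\<^sup>+y. inverse (emeasure (K x) U) * (indicator U y * g x y) \<partial>K x)) \<in> borel_measurable borel"
proof -
  have s [measurable_cong]: "sets (K x) = sets borel" for x
    using K by (simp add: nonneg_kernel_def)
  have m [measurable]: "(\<lambda>x. emeasure (K x) A) \<in> borel_measurable borel" if "A \<in> sets borel" for A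
    using K that by (simp add: nonneg_kernel_def)
  define L where "L x = density (K x) (\<lambda>y. inverse (emeasure (K x) U) * indicator U y)" for x
  have L_emeasure: "emeasure (L x) A = inverse (emeasure (K x) U) * emeasure (K x) (U \<inter> A)" if [measurable]: "A \<in> sets borel" for x A
  proof -
    have "emeasure (L x) A = (\<integral>\<^sup>+y. inverse (emeasure (K x) U) * indicator (U \<inter> A) y \<partial>K x)"
      unfolding L_def by (subst emeasure_density) (auto intro!: nn_integral_cong simp: indicator_def s)
    then show ?thesis by (simp add: nn_integral_cmult_indicator s)
  qed
  have L_space: "space (L x) = UNIV" for x
    using sets_eq_imp_space_eq[OF s] by (simp add: L_def)
  have [measurable]: "L \<in> borel \<rightarrow>\<^sub>M subprob_algebra borel"
  proof (rule measurable_subprob_algebra)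
    fix x
    show "subprob_space (L x)"
    proof (rule subprob_spaceI)
      have "emeasure (L x) (space (L x)) = inverse (emeasure (K x) U) * emeasure (K x) U"
        unfolding L_space by (subst L_emeasure) simp_all
      also have "\<dots> \<le> 1"
        by (cases "emeasure (K x) U = 0 \<or> emeasure (K x) U = top")
           (auto simp: divide_ennreal_def[symmetric] mult.commute[of "inverse _"] less_top)
      finally show "emeasure (L x) (space (L x)) \<le> 1" .
    qed (simp add: L_space)
  next
    fix A :: "'a set" assume A [measurable]: "A \<in> sets borel"
    show "(\<lambda>x. emeasure (L x) A) \<in> borel_measurable borel"
      unfolding L_emeasure[OF A] by measurable
  qed (simp add: L_def s)
  have "(\<lambda>x. emeasure (K x) U * (\<integral>\<^sup>+y. g x y \<partial>L x)) \<in> borel_measurable borel"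
    using nn_integral_measurable_subprob_algebra2[OF g, of L] by measurable
  also have "(\<lambda>x. emeasure (K x) U * (\<integral>\<^sup>+y. g x y \<partial>L x))
      = (\<lambda>x. emeasure (K x) U * (\<integral>\<^sup>+y. inverse (emeasure (K x) U) * (indicator U y * g x y) \<partial>K x))"
  proof
    fix x
    have [measurable]: "g x \<in> borel_measurable borel"
      using measurable_compose[OF measurable_Pair1' g, of x] by simp
    show "emeasure (K x) U * (\<integral>\<^sup>+y. g x y \<partial>L x)
      = emeasure (K x) U * (\<integral>\<^sup>+y. inverse (emeasure (K x) U) * (indicator U y * g x y) \<partial>K x)"
      unfolding L_def by (subst nn_integral_density) (auto simp: mult.assoc)
  qed
  finally show ?thesis .
qed

lemma nn_integral_kernel_normalized:
  fixes K :: "'a::euclidean_space \<Rightarrow> 'a measure"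
  assumes K: "nonneg_kernel K" and U [measurable]: "U \<in> sets borel"
    and g [measurable]: "g \<in> borel_measurable borel"
    and supp: "\<And>y. y \<notin> U \<Longrightarrow> g y = 0" and fin: "emeasure (K x) U < \<infinity>"
  shows "emeasure (K x) U * (\<integral>\<^sup>+y. inverse (emeasure (K x) U) * (indicator U y * g y) \<partial>K x) = (\<integral>\<^sup>+y. g y \<partial>K x)"
proof -
  have s [measurable_cong]: "sets (K x) = sets borel" for x
    using K by (simp add: nonneg_kernel_def)
  have g': "indicator U y * g y = g y" for y
    using supp[of y] by (auto simp: indicator_def)
  show ?thesis
  proof (cases "emeasure (K x) U = 0")
    case True
    then have "AE y in K x. y \<notin> U"
      by (intro AE_not_in) (auto simp: null_sets_def s)
    then have "(\<integral>\<^sup>+y. g y \<partial>K x) = (\<integral>\<^sup>+y. 0 \<partial>K x)"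
      by (intro nn_integral_cong_AE) (auto elim!: eventually_mono simp: supp)
    with True show ?thesis by simp
  next
    case False
    have "emeasure (K x) U * (\<integral>\<^sup>+y. inverse (emeasure (K x) U) * (indicator U y * g y) \<partial>K x)
        = (\<integral>\<^sup>+y. emeasure (K x) U * (inverse (emeasure (K x) U) * g y) \<partial>K x)"
      unfolding g' by (rule nn_integral_cmult[symmetric]) measurable
    also have "\<dots> = (\<integral>\<^sup>+y. g y \<partial>K x)"
      using False fin
      by (intro nn_integral_cong) (simp add: mult.assoc[symmetric] divide_ennreal_def[symmetric] ennreal_divide_self)
    finally show ?thesis .
  qed
qed

text \<open>
  The region \<open>\<bar>x - y\<bar> \<ge> 1\<close> moves with \<open>x\<close>. When \<open>x\<close> is within 1/8 of a point \<open>q\<close> of a dense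
  sequence, this region is contained in the fixed set \<open>\<bar>q - y\<bar> > 3/4\<close>, all of whose points are at
  distance more than 5/8 from \<open>x\<close>; for almost every \<open>x\<close> it has finite mass. Choosing the first such
  \<open>q\<close> measurably in \<open>x\<close> reduces the claim to fixed sets.
\<close>

lemma borel_measurable_big_jumps_integral:
  fixes a1 a2 :: "'a::euclidean_space \<Rightarrow> real"
  assumes meas [measurable]: "a1 \<in> borel_measurable borel" "a2 \<in> borel_measurable borel"
    and pos: "\<And>x. 0 < a1 x" "\<And>x. 0 < a2 x"
    and J0: "nonneg_kernel J0"
    and int: "locally_integrable (\<lambda>x. \<integral>\<^sup>+y. ennreal (min 1 ((norm (x - y))\<^sup>2)) \<partial>jump_kernel a1 a2 J0 x)"
    and h [measurable]: "(\<lambda>(x, y). h x y) \<in> borel_measurable (borel \<Otimes>\<^sub>M borel)"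
  shows "(\<lambda>x. \<integral>\<^sup>+y. h x y \<partial>big_jumps (jump_kernel a1 a2 J0) x) \<in> borel_measurable lebesgue"
proof -
  have s: "sets (J0 x) = sets borel" for x
    using J0 by (simp add: nonneg_kernel_def)
  note [measurable] = borel_measurable_jump_coeff[OF meas]
  obtain D :: "'a set" where D: "countable D" "\<And>X. open X \<Longrightarrow> X \<noteq> {} \<Longrightarrow> \<exists>d\<in>D. d \<in> X"
    by (rule countable_dense_setE) blast
  have "D \<noteq> {}" using D(2)[of UNIV] by auto
  define q where "q = from_nat_into D"
  have q: "\<exists>i. norm (q i - x) < 1/8" for x
  proof -
    obtain d where "d \<in> D" "d \<in> ball x (1/8)" using D(2)[of "ball x (1/8)"] by auto
    moreover obtain i where "q i = d"
      using \<open>d \<in> D\<close> D(1) unfolding q_def by (metis from_nat_into_to_nat_on)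
    ultimately show ?thesis by (auto simp: dist_norm norm_minus_commute)
  qed
  define i where "i x = (LEAST i. norm (q i - x) < 1/8)" for x
  have i [measurable]: "i \<in> borel \<rightarrow>\<^sub>M count_space UNIV"
    unfolding i_def by measurable
  have i_near: "norm (q (i x) - x) < 1/8" for x
    unfolding i_def using q[of x] by (rule LeastI_ex)
  define U where "U j = {y. 3/4 < norm (q j - y)}" for j
  have U [measurable]: "U j \<in> sets borel" for j
    unfolding U_def by measurable
  define g where "g x y = ennreal (jump_coeff a1 a2 x y) * (indicator {y. norm (x - y) \<ge> 1} y * h x y)" for x y
  have g [measurable]: "(\<lambda>(x, y). g x y) \<in> borel_measurable (borel \<Otimes>\<^sub>M borel)"
    unfolding g_def indicator_def by measurable
  have gx [measurable]: "g x \<in> borel_measurable borel" for x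
    using measurable_compose[OF measurable_Pair1' g, of x] by simp
  have hx [measurable]: "h x \<in> borel_measurable borel" for x
    using measurable_compose[OF measurable_Pair1' h, of x] by simp
  define \<Phi> where "\<Phi> j x = emeasure (J0 x) (U j) * (\<integral>\<^sup>+y. inverse (emeasure (J0 x) (U j)) * (indicator (U j) y * g x y) \<partial>J0 x)" for j x
  have "\<Phi> j \<in> borel_measurable borel" for j
    unfolding \<Phi>_def by (rule borel_measurable_nn_integral_kernel_normalized[OF J0 U g])
  then have \<Phi>: "(\<lambda>x. \<Phi> (i x) x) \<in> borel_measurable borel"
    by (rule measurable_compose_countable) (rule i)
  show ?thesis
  proof (rule borel_measurable_lebesgue_AE_cong)
    show "(\<lambda>x. \<Phi> (i x) x) \<in> borel_measurable lebesgue"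
      using \<Phi> by (intro measurable_completion) simp
    show "AE x in lborel. (\<integral>\<^sup>+y. h x y \<partial>big_jumps (jump_kernel a1 a2 J0) x) = \<Phi> (i x) x"
      using AE_far_mass_finite[OF meas pos J0 int]
    proof eventually_elim
      fix x assume fin: "emeasure (J0 x) {y. 5/8 < norm (x - y)} < \<infinity>"
      have far: "5/8 < norm (x - y)" if "y \<in> U (i x)" for y
        using that i_near[of x] norm_triangle_ineq[of "q (i x) - x" "x - y"] by (simp add: U_def)
      have "emeasure (J0 x) (U (i x)) \<le> emeasure (J0 x) {y. 5/8 < norm (x - y)}"
        using far by (intro emeasure_mono) (auto simp: s)
      then have fin': "emeasure (J0 x) (U (i x)) < \<infinity>" using fin by (rule le_less_trans)
      have supp: "g x y = 0" if "y \<notin> U (i x)" for y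
      proof -
        have "norm (x - y) < 1"
          using that i_near[of x] norm_triangle_ineq[of "x - q (i x)" "q (i x) - y"]
          by (simp add: U_def norm_minus_commute)
        then show ?thesis by (simp add: g_def)
      qed
      have "(\<integral>\<^sup>+y. h x y \<partial>big_jumps (jump_kernel a1 a2 J0) x) = (\<integral>\<^sup>+y. g x y \<partial>J0 x)"
        unfolding g_def by (rule nn_integral_jump_kernel(2)[OF meas J0 hx])
      also have "\<dots> = \<Phi> (i x) x"
        unfolding \<Phi>_def by (rule nn_integral_kernel_normalized[OF J0 U gx supp fin', symmetric])
      finally show "(\<integral>\<^sup>+y. h x y \<partial>big_jumps (jump_kernel a1 a2 J0) x) = \<Phi> (i x) x" .
    qed
  qed
qed

text \<open>
  The form is defined by Bochner integrals, which are 0 by convention for functions that are not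
  measurable; measurability of the inner integral is therefore what links the form to the energy.
\<close>

lemma jump_form_eq_nn_integral:
  fixes K :: "'a::euclidean_space \<Rightarrow> 'a measure"
  assumes sets: "\<And>x. sets (K x) = sets borel"
    and meas: "(\<lambda>x. \<integral>\<^sup>+y. ennreal ((fun_of u x - fun_of u y)\<^sup>2) \<partial>K x) \<in> borel_measurable lebesgue"
    and u: "u \<in> jump_form_domain K"
  shows "ennreal (jump_form K u u) = (\<integral>\<^sup>+x. (\<integral>\<^sup>+y. ennreal ((fun_of u x - fun_of u y)\<^sup>2) \<partial>K x) \<partial>lebesgue)"
    and "0 \<le> jump_form K u u"
proof -
  define \<Psi> where "\<Psi> x = (\<integral>\<^sup>+y. ennreal ((fun_of u x - fun_of u y)\<^sup>2) \<partial>K x)" for x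
  have [measurable]: "\<Psi> \<in> borel_measurable lebesgue" unfolding \<Psi>_def by (rule meas)
  have fin: "(\<integral>\<^sup>+x. \<Psi> x \<partial>lebesgue) < \<infinity>"
    using u unfolding jump_form_domain_def \<Psi>_def by simp
  have "(\<integral>y. (fun_of u x - fun_of u y) * (fun_of u x - fun_of u y) \<partial>K x) = enn2real (\<Psi> x)" for x
    unfolding \<Psi>_def power2_eq_square
    by (rule integral_eq_nn_integral) (auto simp: measurable_cong_sets[OF sets refl])
  then have eq: "jump_form K u u = (\<integral>x. enn2real (\<Psi> x) \<partial>lebesgue)"
    unfolding jump_form_def by simp
  show "0 \<le> jump_form K u u" unfolding eq by simp
  have eq': "(\<integral>\<^sup>+x. ennreal (enn2real (\<Psi> x)) \<partial>lebesgue) = (\<integral>\<^sup>+x. \<Psi> x \<partial>lebesgue)"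
  proof (rule nn_integral_cong_AE)
    have "AE x in lebesgue. \<Psi> x \<noteq> \<infinity>"
      using fin by (intro nn_integral_PInf_AE) auto
    then show "AE x in lebesgue. ennreal (enn2real (\<Psi> x)) = \<Psi> x"
      by eventually_elim (simp add: less_top)
  qed
  have "ennreal (\<integral>x. enn2real (\<Psi> x) \<partial>lebesgue) = (\<integral>\<^sup>+x. ennreal (enn2real (\<Psi> x)) \<partial>lebesgue)"
    using fin eq' by (intro nn_integral_eq_integral[symmetric] integrableI_nonneg) auto
  then show "ennreal (jump_form K u u) = (\<integral>\<^sup>+x. (\<integral>\<^sup>+y. ennreal ((fun_of u x - fun_of u y)\<^sup>2) \<partial>K x) \<partial>lebesgue)"
    unfolding eq eq' by (simp add: \<Psi>_def[abs_def])
qed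

lemma stable_tail_translate_le:
  fixes J0 :: "'a::euclidean_space \<Rightarrow> 'a measure"
  assumes s: "sets (J0 x) = sets borel"
    and h [measurable]: "h \<in> borel_measurable borel"
    and ge: "\<forall>A\<in>sets borel. emeasure (J0 x) ((+) x ` A) \<ge> emeasure (stable_tail \<alpha>) A"
  shows "(\<integral>\<^sup>+y. ennreal (indicator {z. norm z \<ge> 1} (y - x) * norm (y - x) powr - (real DIM('a) + \<alpha>)) * h y \<partial>lborel) \<le> (\<integral>\<^sup>+y. h y \<partial>J0 x)"
proof -
  define k where "k z = ennreal (indicator {z. norm z \<ge> 1} z * norm z powr - (real DIM('a) + \<alpha>))" for z :: 'a
  have k [measurable]: "k \<in> borel_measurable borel"
    unfolding k_def indicator_def by measurable
  define M where "M = density lborel (\<lambda>y. k (y - x))"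
  have "(\<integral>\<^sup>+y. k (y - x) * h y \<partial>lborel) = (\<integral>\<^sup>+y. h y \<partial>M)"
    unfolding M_def by (rule nn_integral_density[symmetric]) measurable
  also have "\<dots> \<le> (\<integral>\<^sup>+y. h y \<partial>J0 x)"
  proof (rule nn_integral_mono_measure)
    show "sets M = sets (J0 x)" by (simp add: M_def s)
    show "M \<le> J0 x"
    proof (subst le_measure)
      show "sets M = sets (J0 x)" by (simp add: M_def s)
      show "\<forall>A\<in>sets M. emeasure M A \<le> emeasure (J0 x) A"
      proof
        fix A assume "A \<in> sets M"
        then have True [measurable]: "A \<in> sets borel" by (simp add: M_def)
        define A' where "A' = (\<lambda>z. x + z) -` A"
        have A' [measurable]: "A' \<in> sets borel"
        proof -
          have "(\<lambda>z. x + z) -` A \<inter> space borel \<in> sets borel"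
            by (rule measurable_sets[OF _ True]) measurable
          then show ?thesis by (simp add: A'_def)
        qed
        have img: "(+) x ` A' = A"
          unfolding A'_def by (auto simp: image_iff intro!: exI[of _ "_ - x"])
        have "emeasure M A = (\<integral>\<^sup>+y. k (y - x) * indicator A y \<partial>lborel)"
          unfolding M_def by (rule emeasure_density) auto
        also have "\<dots> = (\<integral>\<^sup>+y. k (y - x) * indicator A y \<partial>distr lborel borel ((+) x))"
          by (simp only: lborel_distr_plus)
        also have "\<dots> = (\<integral>\<^sup>+z. k z * indicator A' z \<partial>lborel)"
          by (subst nn_integral_distr) (auto intro!: nn_integral_cong simp: A'_def indicator_def)
        also have "\<dots> = emeasure (stable_tail \<alpha>) A'"
          unfolding stable_tail_def k_def[symmetric] by (rule emeasure_density[symmetric]) auto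
        also have "\<dots> \<le> emeasure (J0 x) A"
          using ge A' img by metis
        finally show "emeasure M A \<le> emeasure (J0 x) A" .
      qed
    qed
  qed
  finally show ?thesis unfolding k_def .
qed


section \<open>Means over a chain of balls\<close>

lemma ennreal_integral_le_nn_integral:
  fixes f :: "'a \<Rightarrow> real"
  assumes f: "integrable M f"
  shows "ennreal (\<integral>x. f x \<partial>M) \<le> (\<integral>\<^sup>+x. ennreal (f x) \<partial>M)"
proof -
  have "(\<integral>x. f x \<partial>M) \<le> (\<integral>x. max 0 (f x) \<partial>M)"
    using f by (intro integral_mono) auto
  then have "ennreal (\<integral>x. f x \<partial>M) \<le> ennreal (\<integral>x. max 0 (f x) \<partial>M)"
    by (rule ennreal_leI)
  also have "\<dots> = (\<integral>\<^sup>+x. ennreal (max 0 (f x)) \<partial>M)"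
    using f by (intro nn_integral_eq_integral[symmetric]) auto
  also have "\<dots> = (\<integral>\<^sup>+x. ennreal (f x) \<partial>M)"
    by (intro nn_integral_cong) (simp add: max_def ennreal_neg)
  finally show ?thesis .
qed

text \<open>
  The Cauchy-Schwarz inequality for the difference \<open>t\<close> of the means of \<open>\<bar>u\<bar>\<close> over \<open>A\<close> and \<open>B\<close>. It is
  used in the linearized form \<open>z\<^sup>2 \<ge> 2 t z - t\<^sup>2\<close> with \<open>z = \<bar>u x\<bar> - \<bar>u y\<bar>\<close>, the mean of whose right
  hand side is \<open>t\<^sup>2\<close>.
\<close>

lemma mean_difference_le_energy:
  fixes u :: "'a::euclidean_space \<Rightarrow> real"
  assumes u [measurable]: "u \<in> borel_measurable borel"
    and A [measurable]: "A \<in> sets borel" and B [measurable]: "B \<in> sets borel"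
    and a: "emeasure lborel A < \<infinity>" "0 < measure lborel A"
    and b: "emeasure lborel B < \<infinity>" "0 < measure lborel B"
    and uA: "integrable lborel (\<lambda>x. \<bar>u x\<bar> * indicator A x)"
    and uB: "integrable lborel (\<lambda>x. \<bar>u x\<bar> * indicator B x)"
  shows "ennreal (measure lborel A * measure lborel B *
      ((\<integral>x. \<bar>u x\<bar> * indicator A x \<partial>lborel) / measure lborel A - (\<integral>x. \<bar>u x\<bar> * indicator B x \<partial>lborel) / measure lborel B)\<^sup>2)
    \<le> (\<integral>\<^sup>+x. indicator A x * (\<integral>\<^sup>+y. indicator B y * ennreal ((u x - u y)\<^sup>2) \<partial>lborel) \<partial>lborel)"
proof -
  let ?a = "measure lborel A" and ?b = "measure lborel B"
  define IA where "IA = (\<integral>x. \<bar>u x\<bar> * indicator A x \<partial>lborel)"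
  define IB where "IB = (\<integral>x. \<bar>u x\<bar> * indicator B x \<partial>lborel)"
  define t where "t = IA / ?a - IB / ?b"
  have iA: "integrable lborel (indicator A :: 'a \<Rightarrow> real)" and iB: "integrable lborel (indicator B :: 'a \<Rightarrow> real)"
    using a b by (auto simp: integrable_indicator_iff)
  have le: "2 * t * (\<bar>u x\<bar> - \<bar>u y\<bar>) - t\<^sup>2 \<le> (u x - u y)\<^sup>2" for x y
  proof -
    have "0 \<le> (\<bar>u x\<bar> - \<bar>u y\<bar> - t)\<^sup>2" by simp
    then have "2 * t * (\<bar>u x\<bar> - \<bar>u y\<bar>) - t\<^sup>2 \<le> (\<bar>u x\<bar> - \<bar>u y\<bar>)\<^sup>2"
      by (simp add: power2_eq_square algebra_simps)
    also have "\<dots> \<le> (u x - u y)\<^sup>2"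
      unfolding abs_le_square_iff[symmetric] by (rule abs_triangle_ineq3)
    finally show ?thesis .
  qed
  have inner: "ennreal ((2 * t * \<bar>u x\<bar> - t\<^sup>2) * ?b - 2 * t * IB) \<le> (\<integral>\<^sup>+y. indicator B y * ennreal ((u x - u y)\<^sup>2) \<partial>lborel)" for x
  proof -
    let ?f = "\<lambda>y. (2 * t * \<bar>u x\<bar> - t\<^sup>2) * indicator B y - 2 * t * (\<bar>u y\<bar> * indicator B y)"
    have "(\<integral>y. ?f y \<partial>lborel) = (2 * t * \<bar>u x\<bar> - t\<^sup>2) * ?b - 2 * t * IB"
      using iB uB by (simp add: IB_def)
    moreover have "ennreal (\<integral>y. ?f y \<partial>lborel) \<le> (\<integral>\<^sup>+y. ennreal (?f y) \<partial>lborel)"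
      using iB uB by (intro ennreal_integral_le_nn_integral) auto
    moreover have "(\<integral>\<^sup>+y. ennreal (?f y) \<partial>lborel) \<le> (\<integral>\<^sup>+y. indicator B y * ennreal ((u x - u y)\<^sup>2) \<partial>lborel)"
    proof (rule nn_integral_mono)
      fix y
      show "ennreal (?f y) \<le> indicator B y * ennreal ((u x - u y)\<^sup>2)"
        using le[of x y] by (cases "y \<in> B") (auto intro!: ennreal_leI simp: algebra_simps)
    qed
    ultimately show ?thesis by simp
  qed
  let ?g = "\<lambda>x. (2 * t * ?b) * (\<bar>u x\<bar> * indicator A x) - (t\<^sup>2 * ?b + 2 * t * IB) * indicator A x"
  have "(\<integral>x. ?g x \<partial>lborel) = 2 * t * ?b * IA - (t\<^sup>2 * ?b + 2 * t * IB) * ?a"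
    using iA uA by (simp add: IA_def)
  also have "\<dots> = ?a * ?b * (2 * t * (IA / ?a - IB / ?b) - t\<^sup>2)"
    using a(2) b(2) by (simp add: field_simps)
  also have "\<dots> = ?a * ?b * t\<^sup>2"
    unfolding t_def[symmetric] by (simp add: power2_eq_square)
  finally have "ennreal (?a * ?b * t\<^sup>2) = ennreal (\<integral>x. ?g x \<partial>lborel)" by simp
  also have "\<dots> \<le> (\<integral>\<^sup>+x. ennreal (?g x) \<partial>lborel)"
    using iA uA by (intro ennreal_integral_le_nn_integral) auto
  also have "\<dots> \<le> (\<integral>\<^sup>+x. indicator A x * (\<integral>\<^sup>+y. indicator B y * ennreal ((u x - u y)\<^sup>2) \<partial>lborel) \<partial>lborel)"
  proof (rule nn_integral_mono)
    fix x
    show "ennreal (?g x) \<le> indicator A x * (\<integral>\<^sup>+y. indicator B y * ennreal ((u x - u y)\<^sup>2) \<partial>lborel)"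
      using inner[of x] by (cases "x \<in> A") (auto simp: algebra_simps)
  qed
  finally show ?thesis unfolding t_def IA_def IB_def .
qed

lemma null_sequence_le_geometric:
  fixes m :: "nat \<Rightarrow> real"
  assumes lim: "m \<longlonglongrightarrow> 0" and step: "\<And>k. \<bar>m k - m (Suc k)\<bar> \<le> D * \<beta> ^ k"
    and \<beta>: "0 \<le> \<beta>" "\<beta> < 1" and D: "0 \<le> D"
  shows "m 0 \<le> D / (1 - \<beta>)"
proof -
  have "m 0 \<le> m n + D / (1 - \<beta>)" for n
  proof -
    have "m 0 - m n = (\<Sum>k<n. m k - m (Suc k))"
      by (rule sum_lessThan_telescope'[symmetric])
    also have "\<dots> \<le> (\<Sum>k<n. D * \<beta> ^ k)"
      using step by (intro sum_mono) (meson abs_le_D1 order_trans)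
    also have "\<dots> = D * (\<Sum>k<n. \<beta> ^ k)" by (rule sum_distrib_left[symmetric])
    also have "\<dots> \<le> D * (\<Sum>k. \<beta> ^ k)"
      using \<beta> D by (intro mult_left_mono sum_le_suminf summable_geometric) auto
    also have "\<dots> = D / (1 - \<beta>)"
      using \<beta> by (simp add: suminf_geometric)
    finally show ?thesis by simp
  qed
  moreover have "(\<lambda>n. m n + D / (1 - \<beta>)) \<longlonglongrightarrow> 0 + D / (1 - \<beta>)"
    by (intro tendsto_intros lim)
  ultimately show ?thesis
    using LIMSEQ_le_const[of "\<lambda>n. m n + D / (1 - \<beta>)"] by auto
qed

text \<open>
  Balls along a ray, with radii growing by the factor 4. The centres are spaced such that the
  distances between points of consecutive balls are comparable to the radius, and that the chain
  starts with a given ball around the origin.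
\<close>

definition chain_ball :: "real \<Rightarrow> nat \<Rightarrow> 'a::euclidean_space set" where
  "chain_ball r k = ball ((2 * r * (4 ^ k - 1)) *\<^sub>R (SOME b. b \<in> Basis)) (r * 4 ^ k)"

lemma chain_ball_0: "chain_ball r 0 = ball 0 r"
  by (simp add: chain_ball_def)

lemma chain_ball_sets [measurable]: "chain_ball r k \<in> sets borel"
  by (simp add: chain_ball_def)

lemma emeasure_chain_ball_finite: "emeasure lborel (chain_ball r k :: 'a::euclidean_space set) < \<infinity>"
  unfolding chain_ball_def by (rule emeasure_lborel_ball_finite)

lemma measure_chain_ball:
  assumes "0 < r"
  shows "measure lborel (chain_ball r k :: 'a::euclidean_space set) = measure lborel (ball (0::'a) 1) * (r * 4 ^ k) ^ DIM('a)"
  unfolding chain_ball_def using assms by (subst content_ball_conv_unit_ball) auto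

lemma chain_ball_geometry:
  fixes x y :: "'a::euclidean_space"
  assumes r: "0 < r" and x: "x \<in> chain_ball r k" and y: "y \<in> chain_ball r (Suc k)"
  shows "r * 4 ^ k \<le> norm (y - x)" "norm (y - x) \<le> 11 * (r * 4 ^ k)"
    and "r * 4 ^ k \<le> norm y" "norm y \<le> 12 * (r * 4 ^ k)"
proof -
  define e :: 'a where "e = (SOME b. b \<in> Basis)"
  have e: "norm e = 1"
    unfolding e_def using someI_ex[of "\<lambda>b::'a. b \<in> Basis"] nonempty_Basis by (auto intro: norm_Basis)
  define s where "s = r * 4 ^ k"
  define p where "p = (2 * r * (4 ^ k - 1)) *\<^sub>R e"
  define p' where "p' = (2 * r * (4 ^ Suc k - 1)) *\<^sub>R e"
  have rs: "r \<le> s" using r by (simp add: s_def)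
  have x': "norm (x - p) < s" and y': "norm (y - p') < 4 * s"
    using x y unfolding chain_ball_def p_def p'_def e_def s_def by (auto simp: dist_norm norm_minus_commute)
  have "p' - p = (6 * s) *\<^sub>R e"
    unfolding p_def p'_def s_def scaleR_diff_left[symmetric] by (simp add: algebra_simps)
  then have pp: "norm (p' - p) = 6 * s" using e rs r by simp
  have "2 * r * (4 ^ Suc k - 1) = 8 * s - 2 * r" by (simp add: s_def algebra_simps)
  then have p': "norm p' = 8 * s - 2 * r" unfolding p'_def using e rs r by simp
  have eq: "y - x = (p' - p) + ((y - p') - (x - p))" by simp
  have "norm (y - x) \<le> norm (p' - p) + (norm (y - p') + norm (x - p))"
    unfolding eq using norm_triangle_ineq norm_triangle_ineq4 by (meson add_left_mono order_trans)
  then show "norm (y - x) \<le> 11 * (r * 4 ^ k)" using pp x' y' by (simp add: s_def[symmetric])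
  have "norm (p' - p) \<le> norm (y - x) + (norm (y - p') + norm (x - p))"
  proof -
    have "norm (p' - p) = norm ((y - x) - ((y - p') - (x - p)))" by simp
    then show ?thesis
      using norm_triangle_ineq4[of "y - x" "(y - p') - (x - p)"] norm_triangle_ineq4[of "y - p'" "x - p"]
      by linarith
  qed
  then show "r * 4 ^ k \<le> norm (y - x)" using pp x' y' by (simp add: s_def[symmetric])
  have "norm p' \<le> norm y + norm (y - p')"
    using norm_triangle_ineq4[of y "y - p'"] by simp
  then show "r * 4 ^ k \<le> norm y" using p' y' rs r by (simp add: s_def[symmetric])
  have "norm y \<le> norm p' + norm (y - p')"
    using norm_triangle_ineq[of p' "y - p'"] by simp
  then show "norm y \<le> 12 * (r * 4 ^ k)" using p' y' rs r by (simp add: s_def[symmetric])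
qed

text \<open>
  The sign of \<open>q\<close> decides whether \<open>t = s\<close> or \<open>t = 12 s\<close> is the worst case; the minimum covers both.
  The constant arises from \<open>1 + (12 s)\<^sup>2 \<le> 145 s\<^sup>2\<close>.
\<close>

lemma weight_lower_bound:
  fixes q s t p c0 D :: real
  assumes s: "1 \<le> s" and t: "s \<le> t" "t \<le> 12 * s" and D: "s \<le> D" "D \<le> 11 * s" and p: "0 \<le> p" and c0: "0 \<le> c0"
  shows "c0 * min 1 (145 powr q) * 11 powr - p * s powr (2 * q - p) \<le> c0 * (1 + t\<^sup>2) powr q * D powr - p"
proof -
  have "s\<^sup>2 \<le> t\<^sup>2" using s t by (intro power_mono) auto
  then have lo: "s\<^sup>2 \<le> 1 + t\<^sup>2" by linarith
  have "t\<^sup>2 \<le> (12 * s)\<^sup>2" using s t by (intro power_mono) auto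
  moreover have "1 \<le> s\<^sup>2" using s by simp
  ultimately have hi: "1 + t\<^sup>2 \<le> 145 * s\<^sup>2" by (simp add: power_mult_distrib)
  have "s\<^sup>2 = s powr 2" using s by simp
  then have sq: "(s\<^sup>2) powr q = s powr (2 * q)" by (simp only: powr_powr)
  have "min 1 (145 powr q) * s powr (2 * q) \<le> (1 + t\<^sup>2) powr q"
  proof (cases "0 \<le> q")
    case True
    have "min 1 (145 powr q) * s powr (2 * q) \<le> 1 * s powr (2 * q)"
      by (intro mult_right_mono) auto
    also have "\<dots> \<le> (1 + t\<^sup>2) powr q"
      unfolding sq[symmetric] mult_1 using True lo by (intro powr_mono2) auto
    finally show ?thesis .
  next
    case False
    have "min 1 (145 powr q) * s powr (2 * q) \<le> 145 powr q * s powr (2 * q)"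
      by (intro mult_right_mono) auto
    also have "\<dots> = (145 * s\<^sup>2) powr q"
      unfolding sq[symmetric] using s by (simp add: powr_mult)
    also have "\<dots> \<le> (1 + t\<^sup>2) powr q"
      using False hi by (intro powr_mono2') (auto intro: add_pos_nonneg)
    finally show ?thesis .
  qed
  moreover have "11 powr - p * s powr - p \<le> D powr - p"
  proof -
    have "11 powr - p * s powr - p = (11 * s) powr - p" using s by (simp add: powr_mult)
    also have "\<dots> \<le> D powr - p" using p D s by (intro powr_mono2') auto
    finally show ?thesis .
  qed
  ultimately have "(min 1 (145 powr q) * s powr (2 * q)) * (11 powr - p * s powr - p) \<le> (1 + t\<^sup>2) powr q * D powr - p"
    by (intro mult_mono) auto
  then have "c0 * ((min 1 (145 powr q) * s powr (2 * q)) * (11 powr - p * s powr - p)) \<le> c0 * ((1 + t\<^sup>2) powr q * D powr - p)"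
    using c0 by (rule mult_left_mono)
  moreover have "s powr (2 * q - p) = s powr (2 * q) * s powr - p"
    by (simp add: powr_add[symmetric])
  ultimately show ?thesis by (simp only: ac_simps)
qed

lemma norm_l2_indicator:
  assumes A: "A \<in> sets borel" "emeasure lborel A < \<infinity>"
  shows "norm (l2_indicator A) = sqrt (measure lborel A)"
proof -
  have "(norm (l2_indicator A))\<^sup>2 = (\<integral>x. indicator A x \<partial>lborel)"
    unfolding norm_l2_square
  proof (rule integral_cong_AE)
    show "AE x in lborel. (fun_of (l2_indicator A) x)\<^sup>2 = indicator A x"
      using fun_of_l2_indicator[OF A] by eventually_elim (simp add: indicator_def)
  qed (use A in auto)
  then have "(norm (l2_indicator A))\<^sup>2 = measure lborel A" by simp
  then show ?thesis by (metis norm_ge_zero real_sqrt_unique)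
qed

text \<open>
  The mean over a ball of volume \<open>V\<close> is at most \<open>\<parallel>u\<parallel> / sqrt V\<close>. This is where it matters that \<open>u\<close> is
  in L2: constants have energy 0.
\<close>

lemma chain_ball_mean_tendsto_0:
  fixes u :: "'a::euclidean_space l2"
  assumes r: "1 \<le> r"
  shows "(\<lambda>k. (\<integral>x. \<bar>fun_of u x\<bar> * indicator (chain_ball r k) x \<partial>lborel) / measure lborel (chain_ball r k :: 'a set)) \<longlonglongrightarrow> 0"
proof (rule tendsto_sandwich[OF _ _ tendsto_const])
  let ?B = "\<lambda>k. chain_ball r k :: 'a set"
  let ?v = "measure lborel (ball (0::'a) 1)"
  have v: "0 < ?v" by simp
  note B = chain_ball_sets[of r] emeasure_chain_ball_finite[of r]
  show "\<forall>\<^sub>F k in sequentially. 0 \<le> (\<integral>x. \<bar>fun_of u x\<bar> * indicator (?B k) x \<partial>lborel) / measure lborel (?B k)"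
    by (intro always_eventually allI divide_nonneg_nonneg Bochner_Integration.integral_nonneg) auto
  have bound: "(\<integral>x. \<bar>fun_of u x\<bar> * indicator (?B k) x \<partial>lborel) / measure lborel (?B k) \<le> norm (l2_abs u) / sqrt ?v * (1/2) ^ k" for k
  proof -
    have "(\<integral>x. \<bar>fun_of u x\<bar> * indicator (?B k) x \<partial>lborel) = (\<integral>x. fun_of (l2_abs u) x * indicator (?B k) x \<partial>lborel)"
    proof (rule integral_cong_AE)
      show "AE x in lborel. \<bar>fun_of u x\<bar> * indicator (?B k) x = fun_of (l2_abs u) x * indicator (?B k) x"
        using fun_of_l2_abs[of u] by eventually_elim simp
    qed measurable
    also have "\<dots> = inner (l2_abs u) (l2_indicator (?B k))"
      by (rule inner_l2_indicator[OF B, symmetric])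
    also have "\<dots> \<le> norm (l2_abs u) * sqrt (measure lborel (?B k))"
      using norm_cauchy_schwarz[of "l2_abs u" "l2_indicator (?B k)"] by (simp add: norm_l2_indicator[OF B])
    finally have le: "(\<integral>x. \<bar>fun_of u x\<bar> * indicator (?B k) x \<partial>lborel) \<le> norm (l2_abs u) * sqrt (measure lborel (?B k))" .
    have "(4::real) ^ k \<le> r * 4 ^ k" using r by simp
    also have "\<dots> \<le> (r * 4 ^ k) ^ DIM('a)"
      using r by (intro self_le_power) (auto intro: order_trans[OF r])
    finally have m: "?v * 4 ^ k \<le> measure lborel (?B k)"
      using v r by (simp add: measure_chain_ball)
    have mpos: "0 < measure lborel (?B k)"
      by (rule less_le_trans[OF _ m]) (use v in simp)
    have "(\<integral>x. \<bar>fun_of u x\<bar> * indicator (?B k) x \<partial>lborel) / measure lborel (?B k)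
        \<le> norm (l2_abs u) * sqrt (measure lborel (?B k)) / measure lborel (?B k)"
      using le mpos by (intro divide_right_mono) auto
    also have "\<dots> = norm (l2_abs u) / sqrt (measure lborel (?B k))"
      using mpos by (simp add: field_simps)
    also have "\<dots> \<le> norm (l2_abs u) / sqrt (?v * 4 ^ k)"
      using m mpos v by (intro divide_left_mono) auto
    also have "\<dots> = norm (l2_abs u) / sqrt ?v * (1/2) ^ k"
    proof -
      have "sqrt ((4::real) ^ k) = 2 ^ k"
        using real_sqrt_power[of 4 k] by simp
      then show ?thesis by (simp add: real_sqrt_mult field_simps power_divide)
    qed
    finally show ?thesis .
  qed
  show "\<forall>\<^sub>F k in sequentially. (\<integral>x. \<bar>fun_of u x\<bar> * indicator (?B k) x \<partial>lborel) / measure lborel (?B k) \<le> norm (l2_abs u) / sqrt ?v * (1/2) ^ k"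
    by (intro always_eventually allI bound)
  show "(\<lambda>k. norm (l2_abs u) / sqrt ?v * (1/2) ^ k) \<longlonglongrightarrow> 0"
    by (intro tendsto_mult_right_zero LIMSEQ_power_zero) auto
qed


section \<open>Transience of the big jump form\<close>

text \<open>
  From a ball of radius \<open>s\<close> in the chain, a jump into the next one has length comparable to \<open>s\<close> and
  ends at distance comparable to \<open>s\<close> from the origin. Its density is therefore at least a constant
  times \<open>s\<^sup>2\<^sup>q\<close> (from \<open>a2\<close>) times \<open>s\<close> to the power \<open>- (d + \<alpha>)\<close> (from the stable tail).
\<close>

lemma big_jumps_integral_ge:
  fixes J0 :: "'a::euclidean_space \<Rightarrow> 'a measure" and a1 a2 :: "'a \<Rightarrow> real"
  assumes \<alpha>: "0 < \<alpha>" and J0: "nonneg_kernel J0"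
    and tail: "\<forall>A\<in>sets borel. emeasure (J0 x) ((+) x ` A) \<ge> emeasure (stable_tail \<alpha>) A"
    and meas: "a1 \<in> borel_measurable borel" "a2 \<in> borel_measurable borel"
    and pos: "\<And>x. 0 < a1 x" "\<And>x. 0 < a2 x"
    and c0: "0 < c0" and growth: "\<And>x. c0 * (1 + (norm x)\<^sup>2) powr q \<le> a2 x"
    and r: "1 \<le> r" and x: "x \<in> chain_ball r k" and h [measurable]: "h \<in> borel_measurable borel"
  shows "ennreal (c0 * min 1 (145 powr q) * 11 powr - (real DIM('a) + \<alpha>) *
        (r * 4 ^ k) powr (2 * q - (real DIM('a) + \<alpha>))) *
      (\<integral>\<^sup>+y. indicator (chain_ball r (Suc k)) y * h y \<partial>lborel)
    \<le> (\<integral>\<^sup>+y. h y \<partial>big_jumps (jump_kernel a1 a2 J0) x)"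
proof -
  let ?d = "real DIM('a)"
  define \<kappa> where "\<kappa> = c0 * min 1 (145 powr q) * 11 powr - (?d + \<alpha>) * (r * 4 ^ k) powr (2 * q - (?d + \<alpha>))"
  have s: "1 \<le> r * 4 ^ k" using r by (intro mult_ge1_I) auto
  have [measurable]: "(\<lambda>y. jump_coeff a1 a2 x y) \<in> borel_measurable borel"
    using measurable_compose[OF measurable_Pair1' borel_measurable_jump_coeff[OF meas], of x] by simp
  define g where "g y = ennreal (jump_coeff a1 a2 x y) * (indicator {y. norm (x - y) \<ge> 1} y * h y)" for y
  have g [measurable]: "g \<in> borel_measurable borel"
    unfolding g_def indicator_def by measurable
  have "ennreal \<kappa> * (\<integral>\<^sup>+y. indicator (chain_ball r (Suc k)) y * h y \<partial>lborel)
      = (\<integral>\<^sup>+y. ennreal \<kappa> * (indicator (chain_ball r (Suc k)) y * h y) \<partial>lborel)"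
    by (rule nn_integral_cmult[symmetric]) measurable
  also have "\<dots> \<le> (\<integral>\<^sup>+y. ennreal (indicator {z. norm z \<ge> 1} (y - x) * norm (y - x) powr - (?d + \<alpha>)) * g y \<partial>lborel)"
  proof (rule nn_integral_mono)
    fix y
    show "ennreal \<kappa> * (indicator (chain_ball r (Suc k)) y * h y)
        \<le> ennreal (indicator {z. norm z \<ge> 1} (y - x) * norm (y - x) powr - (?d + \<alpha>)) * g y"
    proof (cases "y \<in> chain_ball r (Suc k)")
      case True
      note geo = chain_ball_geometry[OF _ x True]
      have r0: "0 < r" using r by simp
      have far: "1 \<le> norm (y - x)" using geo(1)[OF r0] s by simp
      have "\<kappa> \<le> c0 * (1 + (norm y)\<^sup>2) powr q * norm (y - x) powr - (?d + \<alpha>)"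
        unfolding \<kappa>_def
        by (rule weight_lower_bound[OF s geo(3,4)[OF r0] geo(1,2)[OF r0]]) (use \<alpha> c0 in auto)
      also have "\<dots> \<le> jump_coeff a1 a2 x y * norm (y - x) powr - (?d + \<alpha>)"
      proof (rule mult_right_mono)
        have "jump_coeff a1 a2 x y = a2 x + a2 y"
          using far by (simp add: jump_coeff_def norm_minus_commute)
        then show "c0 * (1 + (norm y)\<^sup>2) powr q \<le> jump_coeff a1 a2 x y"
          using growth[of y] pos(2)[of x] by linarith
      qed simp
      finally have "ennreal \<kappa> \<le> ennreal (jump_coeff a1 a2 x y * norm (y - x) powr - (?d + \<alpha>))"
        by (rule ennreal_leI)
      also have "\<dots> = ennreal (norm (y - x) powr - (?d + \<alpha>)) * ennreal (jump_coeff a1 a2 x y)"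
        by (subst mult.commute) (rule ennreal_mult', simp)
      finally have "ennreal \<kappa> * h y \<le> ennreal (norm (y - x) powr - (?d + \<alpha>)) * ennreal (jump_coeff a1 a2 x y) * h y"
        by (rule mult_right_mono) simp
      then show ?thesis using True far by (simp add: g_def norm_minus_commute[of x y] mult.assoc)
    qed simp
  qed
  also have "\<dots> \<le> (\<integral>\<^sup>+y. g y \<partial>J0 x)"
    by (rule stable_tail_translate_le) (use J0 g tail in \<open>auto simp: nonneg_kernel_def\<close>)
  also have "\<dots> = (\<integral>\<^sup>+y. h y \<partial>big_jumps (jump_kernel a1 a2 J0) x)"
    unfolding g_def by (rule nn_integral_jump_kernel(2)[OF meas J0 h, symmetric])
  finally show ?thesis unfolding \<kappa>_def .
qed

text \<open>
  Two consecutive balls of the chain, of radius about \<open>s\<close>, have volumes of order \<open>s\<^sup>d\<close>, so the total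
  jump rate between them is at least of order \<open>s\<close> to the power \<open>\<delta> = 2 q + d - \<alpha>\<close>. The
  corresponding part of the energy bounds the difference of the two means of \<open>\<bar>u\<bar>\<close> by
  \<open>sqrt (E u u)\<close> times \<open>s\<close> to the power \<open>- \<delta> / 2\<close>. As \<open>\<delta> > 0\<close>, these bounds are summable along the
  chain, and the means tend to 0.
\<close>

lemma big_jump_form_dominates_L1:
  fixes J0 :: "'a::euclidean_space \<Rightarrow> 'a measure" and a1 a2 :: "'a \<Rightarrow> real"
  assumes \<alpha>: "0 < \<alpha>" and J0: "nonneg_kernel J0"
    and tail: "\<forall>x. \<forall>A\<in>sets borel. emeasure (J0 x) ((+) x ` A) \<ge> emeasure (stable_tail \<alpha>) A"
    and meas: "a1 \<in> borel_measurable borel" "a2 \<in> borel_measurable borel"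
    and pos: "\<And>x. 0 < a1 x" "\<And>x. 0 < a2 x"
    and int: "locally_integrable (\<lambda>x. \<integral>\<^sup>+y. ennreal (min 1 ((norm (x - y))\<^sup>2)) \<partial>jump_kernel a1 a2 J0 x)"
    and c0: "0 < c0" and growth: "\<And>x. c0 * (1 + (norm x)\<^sup>2) powr q \<le> a2 x"
    and q: "(\<alpha> - real DIM('a)) / 2 < q"
    and r: "1 \<le> r"
  obtains C where "0 \<le> C" and
    "\<And>u. u \<in> jump_form_domain (big_jumps (jump_kernel a1 a2 J0)) \<Longrightarrow>
      (\<integral>x. \<bar>fun_of u x\<bar> * indicator (ball 0 r) x \<partial>lborel)
      \<le> C * sqrt (jump_form (big_jumps (jump_kernel a1 a2 J0)) u u)"
proof -
  let ?d = "real DIM('a)"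
  let ?K = "big_jumps (jump_kernel a1 a2 J0)"
  let ?B = "\<lambda>k. chain_ball r k :: 'a set"
  define v where "v = measure lborel (ball (0::'a) 1)"
  have v: "0 < v" by (simp add: v_def)
  define \<delta> where "\<delta> = 2 * q + ?d - \<alpha>"
  have \<delta>: "0 < \<delta>" using q by (simp add: \<delta>_def field_simps)
  \<comment> \<open>The radii grow by the factor 4 and the differences of the means scale like \<open>s powr (- \<delta> / 2)\<close>.\<close>
  define \<beta> where "\<beta> = 2 powr - \<delta>"
  have \<beta>: "0 \<le> \<beta>" "\<beta> < 1" using \<delta> by (auto simp: \<beta>_def powr_less_one)
  define G where "G = c0 * min 1 (145 powr q) * 11 powr - (?d + \<alpha>)"
  have G: "0 < G" using c0 by (simp add: G_def)
  define H where "H = G * v\<^sup>2"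
  have H: "0 < H" using G v by (simp add: H_def)
  define m where "m u k = (\<integral>x. \<bar>fun_of u x\<bar> * indicator (?B k) x \<partial>lborel) / measure lborel (?B k)" for u k
  have r0: "0 < r" using r by simp
  have vol_pos: "0 < measure lborel (?B k)" for k
    using v r0 by (simp add: measure_chain_ball v_def)
  note B = chain_ball_sets[of r] emeasure_chain_ball_finite[of r]
  have step: "\<bar>m u k - m u (Suc k)\<bar> \<le> sqrt (jump_form ?K u u / H) * \<beta> ^ k"
    if u: "u \<in> jump_form_domain ?K" for u k
  proof -
    define s where "s = r * 4 ^ k"
    have s: "1 \<le> s" unfolding s_def using r by (intro mult_ge1_I) auto
    define \<kappa> where "\<kappa> = G * s powr (2 * q - (?d + \<alpha>))"
    have \<kappa>: "0 \<le> \<kappa>" using G by (simp add: \<kappa>_def)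
    let ?h = "\<lambda>x y. ennreal ((fun_of u x - fun_of u y)\<^sup>2)"
    have sets: "sets (?K x) = sets borel" for x
      using J0 by (simp add: big_jumps_def jump_kernel_def nonneg_kernel_def)
    have \<Psi>: "(\<lambda>x. \<integral>\<^sup>+y. ?h x y \<partial>?K x) \<in> borel_measurable lebesgue"
      by (rule borel_measurable_big_jumps_integral[OF meas pos J0 int]) measurable
    note E = jump_form_eq_nn_integral[OF sets \<Psi> u]
    have uB: "integrable lborel (\<lambda>x. \<bar>fun_of u x\<bar> * indicator (?B k) x)" for k
      using integrable_abs[OF integrable_fun_of_indicator[OF B, of u k]] by (simp add: abs_mult)
    have "ennreal \<kappa> * ennreal (measure lborel (?B k) * measure lborel (?B (Suc k)) * (m u k - m u (Suc k))\<^sup>2)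
        \<le> ennreal \<kappa> * (\<integral>\<^sup>+x. indicator (?B k) x * (\<integral>\<^sup>+y. indicator (?B (Suc k)) y * ?h x y \<partial>lborel) \<partial>lborel)"
      unfolding m_def
      by (intro mult_left_mono mean_difference_le_energy vol_pos B uB borel_measurable_fun_of) simp
    also have "\<dots> = (\<integral>\<^sup>+x. ennreal \<kappa> * (indicator (?B k) x * (\<integral>\<^sup>+y. indicator (?B (Suc k)) y * ?h x y \<partial>lborel)) \<partial>lborel)"
      by (rule nn_integral_cmult[symmetric]) measurable
    also have "\<dots> \<le> (\<integral>\<^sup>+x. (\<integral>\<^sup>+y. ?h x y \<partial>?K x) \<partial>lborel)"
    proof (rule nn_integral_mono)
      fix x
      show "ennreal \<kappa> * (indicator (?B k) x * (\<integral>\<^sup>+y. indicator (?B (Suc k)) y * ?h x y \<partial>lborel))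
          \<le> (\<integral>\<^sup>+y. ?h x y \<partial>?K x)"
      proof (cases "x \<in> ?B k")
        case True
        have "ennreal \<kappa> * (\<integral>\<^sup>+y. indicator (?B (Suc k)) y * ?h x y \<partial>lborel) \<le> (\<integral>\<^sup>+y. ?h x y \<partial>?K x)"
          unfolding \<kappa>_def G_def s_def
          by (rule big_jumps_integral_ge[OF \<alpha> J0 spec[OF tail] meas pos c0 growth r True]) auto
        with True show ?thesis by simp
      qed simp
    qed
    also have "\<dots> = ennreal (jump_form ?K u u)"
      unfolding E(1) by (rule nn_integral_completion[symmetric])
    finally have "\<kappa> * (measure lborel (?B k) * measure lborel (?B (Suc k)) * (m u k - m u (Suc k))\<^sup>2) \<le> jump_form ?K u u"
      using \<kappa> E(2) by (simp add: ennreal_mult'[symmetric])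
    moreover have "H * (4 powr \<delta>) ^ k * (m u k - m u (Suc k))\<^sup>2
        \<le> \<kappa> * (measure lborel (?B k) * measure lborel (?B (Suc k)) * (m u k - m u (Suc k))\<^sup>2)"
    proof -
      have s0: "0 < s" using s by simp
      have "(4 powr \<delta>) ^ k = (4 ^ k) powr \<delta>"
        by (simp add: powr_realpow[symmetric] powr_powr mult.commute)
      also have "\<dots> \<le> s powr \<delta>"
        using r \<delta> unfolding s_def by (intro powr_mono2) auto
      also have "\<dots> = s powr (2 * q - (?d + \<alpha>)) * (s ^ DIM('a) * s ^ DIM('a))"
        using s0 by (simp add: \<delta>_def powr_realpow[symmetric] powr_add[symmetric] algebra_simps)
      finally have "H * (4 powr \<delta>) ^ k \<le> \<kappa> * ((v * s ^ DIM('a)) * (v * s ^ DIM('a)))"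
        using G v by (simp add: H_def \<kappa>_def power2_eq_square mult.assoc mult.left_commute)
      also have "\<dots> \<le> \<kappa> * (measure lborel (?B k) * measure lborel (?B (Suc k)))"
      proof (intro mult_left_mono mult_mono \<kappa>)
        show "v * s ^ DIM('a) \<le> measure lborel (?B k)"
          using r0 by (simp add: measure_chain_ball v_def s_def)
        have "s ^ DIM('a) \<le> (r * 4 ^ Suc k) ^ DIM('a)"
          using s0 r0 by (intro power_mono) (auto simp: s_def)
        then show "v * s ^ DIM('a) \<le> measure lborel (?B (Suc k))"
          using r0 v by (simp add: measure_chain_ball v_def[symmetric] del: power_Suc)
      qed (use v s0 in auto)
      finally show ?thesis by (simp add: mult_right_mono mult.assoc[symmetric])
    qed
    ultimately have "H * (4 powr \<delta>) ^ k * (m u k - m u (Suc k))\<^sup>2 \<le> jump_form ?K u u" by linarith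
    moreover have "(4 powr \<delta>) ^ k * (\<beta> ^ k)\<^sup>2 = 1"
    proof -
      have "4 powr \<delta> * \<beta>\<^sup>2 = (4 powr \<delta>) * (4 powr - \<delta>)"
        unfolding \<beta>_def power2_eq_square by (subst powr_mult[symmetric]) auto
      also have "\<dots> = 1" by (simp add: powr_minus)
      finally have "(4 powr \<delta> * \<beta>\<^sup>2) ^ k = 1" by simp
      then show ?thesis by (simp add: power_mult_distrib power_mult[symmetric] mult.commute)
    qed
    ultimately have "(m u k - m u (Suc k))\<^sup>2 \<le> jump_form ?K u u / H * (\<beta> ^ k)\<^sup>2"
    proof -
      assume le: "H * (4 powr \<delta>) ^ k * (m u k - m u (Suc k))\<^sup>2 \<le> jump_form ?K u u"
        and one: "(4 powr \<delta>) ^ k * (\<beta> ^ k)\<^sup>2 = 1"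
      have "(m u k - m u (Suc k))\<^sup>2 = (m u k - m u (Suc k))\<^sup>2 * ((4 powr \<delta>) ^ k * (\<beta> ^ k)\<^sup>2)"
        unfolding one by simp
      also have "\<dots> = (H * (4 powr \<delta>) ^ k * (m u k - m u (Suc k))\<^sup>2) / H * (\<beta> ^ k)\<^sup>2"
        using H by simp
      also have "\<dots> \<le> jump_form ?K u u / H * (\<beta> ^ k)\<^sup>2"
        using le H by (intro mult_right_mono divide_right_mono) auto
      finally show ?thesis .
    qed
    then have "sqrt ((m u k - m u (Suc k))\<^sup>2) \<le> sqrt (jump_form ?K u u / H * (\<beta> ^ k)\<^sup>2)"
      by (rule real_sqrt_le_mono)
    moreover have "sqrt (jump_form ?K u u / H * (\<beta> ^ k)\<^sup>2) = sqrt (jump_form ?K u u / H) * \<beta> ^ k"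
      using \<beta> by (subst real_sqrt_mult) simp
    ultimately show ?thesis by simp
  qed
  define C where "C = measure lborel (ball (0::'a) r) / (sqrt H * (1 - \<beta>))"
  show ?thesis
  proof (rule that)
    show "0 \<le> C" using H \<beta> by (simp add: C_def)
    fix u assume u: "u \<in> jump_form_domain ?K"
    have "0 \<le> jump_form ?K u u"
      using step[OF u, of 0] order_trans[OF abs_ge_zero] H by (force simp: zero_le_divide_iff)
    then have "m u 0 \<le> sqrt (jump_form ?K u u / H) / (1 - \<beta>)"
      using H chain_ball_mean_tendsto_0[OF r, of u]
      by (intro null_sequence_le_geometric[OF _ step[OF u] \<beta>]) (auto simp: m_def)
    then have "measure lborel (ball (0::'a) r) * m u 0 \<le> measure lborel (ball (0::'a) r) * (sqrt (jump_form ?K u u / H) / (1 - \<beta>))"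
      by (rule mult_left_mono) simp
    moreover have "measure lborel (ball (0::'a) r) * m u 0 = (\<integral>x. \<bar>fun_of u x\<bar> * indicator (ball 0 r) x \<partial>lborel)"
      using vol_pos[of 0] by (simp add: m_def chain_ball_0)
    ultimately show "(\<integral>x. \<bar>fun_of u x\<bar> * indicator (ball 0 r) x \<partial>lborel) \<le> C * sqrt (jump_form ?K u u)"
      by (simp add: C_def real_sqrt_divide)
  qed
qed

theorem theorem3p8:
  fixes \<alpha> :: real
    and J0 :: "'a::euclidean_space \<Rightarrow> 'a measure"
    and a1 a2 :: "'a \<Rightarrow> real"
  assumes "0 < \<alpha>" and "\<alpha> < 2"
    and "nonneg_kernel J0"
    and "symmetric_kernel J0"
    and "\<forall>x. \<forall>A\<in>sets borel. emeasure (J0 x) ((+) x ` A) \<ge> emeasure (stable_tail \<alpha>) A"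
    and "a1 \<in> borel_measurable borel" and "\<forall>x. 0 < a1 x"
    and "a2 \<in> borel_measurable borel" and "\<forall>x. 0 < a2 x"
    and "symmetric_kernel (jump_kernel a1 a2 J0)"
    and "locally_integrable
           (\<lambda>x. \<integral>\<^sup>+y. ennreal (min 1 ((norm (x - y))\<^sup>2)) \<partial>jump_kernel a1 a2 J0 x)"
    and "\<exists>c0>0. \<exists>q>(\<alpha> - real DIM('a)) / 2. \<forall>x. a2 x \<ge> c0 * (1 + (norm x)\<^sup>2) powr q"
  shows "transient (jump_form (big_jumps (jump_kernel a1 a2 J0)))
                   (jump_form_closure (big_jumps (jump_kernel a1 a2 J0)))"
proof (rule transient_if_locally_dominated)
  let ?K = "big_jumps (jump_kernel a1 a2 J0)"
  fix n :: nat
  obtain c0 q where c0: "0 < c0" and q: "(\<alpha> - real DIM('a)) / 2 < q"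
    and growth: "\<And>x. c0 * (1 + (norm x)\<^sup>2) powr q \<le> a2 x"
    using assms(12) by blast
  obtain C where C: "0 \<le> C" "\<And>u. u \<in> jump_form_domain ?K \<Longrightarrow>
      (\<integral>x. \<bar>fun_of u x\<bar> * indicator (ball 0 (real (Suc n))) x \<partial>lborel) \<le> C * sqrt (jump_form ?K u u)"
    by (rule big_jump_form_dominates_L1[OF assms(1,3,5,6,8) assms(7)[rule_format] assms(9)[rule_format]
          assms(11) c0 growth q, of "real (Suc n)"]) auto
  show "\<exists>C\<ge>0. \<forall>u\<in>jump_form_closure ?K.
      (\<integral>x. \<bar>fun_of u x\<bar> * indicator (ball 0 (real n)) x \<partial>lborel) \<le> C * sqrt (jump_form ?K u u)"
  proof (intro exI conjI ballI)
    fix u assume "u \<in> jump_form_closure ?K"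
    then have u: "u \<in> jump_form_domain ?K" by (simp add: jump_form_closure_def)
    have int: "integrable lborel (\<lambda>x. \<bar>fun_of u x\<bar> * indicator (ball 0 s) x)" for s
    proof -
      have "emeasure lborel (ball (0::'a) s) < \<infinity>" by (rule emeasure_lborel_ball_finite)
      from integrable_abs[OF integrable_fun_of_indicator[OF _ this, of u]] show ?thesis
        by (simp add: abs_mult)
    qed
    have "(\<integral>x. \<bar>fun_of u x\<bar> * indicator (ball 0 (real n)) x \<partial>lborel)
        \<le> (\<integral>x. \<bar>fun_of u x\<bar> * indicator (ball 0 (real (Suc n))) x \<partial>lborel)"
      by (intro integral_mono int) (auto simp: indicator_def)
    also have "\<dots> \<le> C * sqrt (jump_form ?K u u)" by (rule C(2)[OF u])
    finally show "(\<integral>x. \<bar>fun_of u x\<bar> * indicator (ball 0 (real n)) x \<partial>lborel) \<le> C * sqrt (jump_form ?K u u)" .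
  qed (rule C(1))
qed

end
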